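(* Let $F(x) = x^n+ ax+b \in \mathbb{Z}[x]$ be irreducible over $\mathbb{Q}$ and let $K=\mathbb{Q}(\theta)$, where $\theta$ is a complex root of $F(x)$. Let $p$ be an odd prime number such that $p \mid b$, $p \mid (n-1)$ and $p \nmid a$. Write $n-1 = u\cdot p^k$, where $p \nmid u$. Let $\sigma = \nu_p(b)$, $\rho = \nu_p(a^{p-1}-1)$, $\tau = \min (\sigma, \rho)$, and $\kappa = \min ( \tau , k+1)$. If one of the following conditions holds: (1) $\tau \neq k+1$ and $\kappa > \frac{N_p(m)}{N_p(m,u,a)}$ for some integer $m>1$ (with $N_p(m,u,a)>0$); (2) $p < \sigma \cdot N_p(1,u,a) + 1$ and $\sigma < \min(\rho,k+1)$; (3) $p < \rho \cdot N_p(1,u,a) + 1$ and $\rho < \min(\sigma,k+1)$; (4) $p <(k+1) \cdot N_p(1,u,a) + 1$ and $k+1 < \tau$; then $K$ is not monogenic.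
   Context: For a prime $p$ and an integer $t$, $\nu_p(t)$ is the $p$-adic valuation of $t$ (with $\nu_p(0)=\infty$). $\mathbb{F}_p$ is the field with $p$ elements. For positive integers $m,s$ and an integer $t$: $N_p(m)$ denotes the number of monic irreducible polynomials of degree $m$ in $\mathbb{F}_p[x]$, and $N_p(m,s,t)$ denotes the number of monic irreducible factors of degree $m$ of the polynomial $x^s+\overline{t}$ in $\mathbb{F}_p[x]$, where $\overline{t}$ is the reduction of $t$ modulo $p$. $\mathbb{Z}_K$ denotes the ring of integers of $K$. $K$ is called monogenic if $\mathbb{Z}_K=\mathbb{Z}[\eta]$ for some $\eta\in\mathbb{Z}_K$ with $K=\mathbb{Q}(\eta)$; otherwise $K$ is not monogenic. *)

theory Defs
  imports
    Complex_Main
    "HOL-Library.Extended_Real"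
    "HOL-Computational_Algebra.Computational_Algebra"
begin

definition padic_val :: "nat \<Rightarrow> int \<Rightarrow> enat" where
  "padic_val p t = (if t = 0 then \<infinity> else enat (multiplicity (int p) t))"

(* In the next two definitions the coefficient field is passed as a type; for F_p it is any
   field type with p elements.  Irreducible factors are counted without multiplicity. *)

definition num_irred :: "'f::field itself \<Rightarrow> nat \<Rightarrow> nat" where
  "num_irred _ m = card {f :: 'f poly. lead_coeff f = 1 \<and> irreducible f \<and> degree f = m}"

definition num_irred_factors :: "'f::field itself \<Rightarrow> nat \<Rightarrow> nat \<Rightarrow> int \<Rightarrow> nat" where
  "num_irred_factors _ m s t =
     card {f :: 'f poly. lead_coeff f = 1 \<and> irreducible f \<and> degree f = m \<and>
                         f dvd monom 1 s + [:of_int t:]}"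

definition is_subfield :: "complex set \<Rightarrow> bool" where
  "is_subfield L \<longleftrightarrow> 0 \<in> L \<and> 1 \<in> L \<and>
     (\<forall>x\<in>L. \<forall>y\<in>L. x + y \<in> L \<and> x * y \<in> L) \<and>
     (\<forall>x\<in>L. - x \<in> L \<and> inverse x \<in> L)"

definition rat_adjoin :: "complex \<Rightarrow> complex set" where
  "rat_adjoin x = \<Inter> {L. is_subfield L \<and> x \<in> L}"

definition int_adjoin :: "complex \<Rightarrow> complex set" where
  "int_adjoin x = {poly (map_poly of_int g) x | g :: int poly. True}"

definition ring_of_integers :: "complex set \<Rightarrow> complex set" where
  "ring_of_integers K = {x \<in> K. algebraic_int x}"

definition monogenic :: "complex set \<Rightarrow> bool" where
  "monogenic K \<longleftrightarrow>
     (\<exists>\<eta>\<in>ring_of_integers K. ring_of_integers K = int_adjoin \<eta> \<and> K = rat_adjoin \<eta>)"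

end

theory Submission
  imports Defs
begin

text \<open>
  Let \<open>V\<close> be a valuation ring of \<open>\<complex>\<close> in which \<open>p\<close> is not a unit. Since \<open>F\<close> reduces to
  \<open>x (x\<^sup>u + a) ^ p\<^sup>k\<close> modulo \<open>p\<close>, each root \<open>\<omega>\<close> of \<open>x\<^sup>u + a\<close> is close to several roots of \<open>F\<close>, and the
  Newton polygon of \<open>F(\<omega> + y)\<close> has \<open>\<kappa>\<close> sides of different slopes, each with denominator equal to its
  width. Every root \<open>\<theta>'\<close> of \<open>F\<close> is an embedding of \<open>K\<close> into \<open>\<complex>\<close>, and pulling back the maximal
  ideal of \<open>V\<close> gives a prime of the ring of integers above \<open>p\<close>. Suppose that this ring is \<open>\<int>[\<eta>]\<close>, and let
  \<open>G\<close> be the minimal polynomial of \<open>\<eta>\<close>. Then primes above \<open>p\<close> correspond to monic irreducible factors \<open>\<gamma>\<close> of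
  \<open>G\<close> modulo \<open>p\<close>. If the prime comes from a factor \<open>\<phi>\<close> of \<open>x\<^sup>u + a\<close> and a side of width \<open>w\<close>, then
  \<open>deg \<gamma> \<ge> deg \<phi>\<close> because the residue field contains a root of \<open>\<phi>\<close>, and \<open>\<gamma>\<close> has multiplicity at
  least \<open>w\<close> in \<open>G\<close> modulo \<open>p\<close> because the slope has denominator \<open>w\<close>. Since only \<open>w deg \<phi>\<close> embeddings
  belong to that prime, \<open>deg \<gamma> = deg \<phi>\<close>. Different pairs of a factor and a side give different primes, so the
  \<open>\<kappa>\<close> sides over the factors of degree \<open>m\<close> require \<open>\<kappa> N\<^sub>p(m,u,a)\<close> different monic irreducible polynomials of
  degree \<open>m\<close>. For \<open>m = 1\<close> the factor \<open>x\<close> of \<open>F\<close> modulo \<open>p\<close> requires one more.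
\<close>

section \<open>Valuation rings\<close>

text \<open>The estimates for a single prime are one-sided: the Newton polygon bounds the number of
  embeddings from above, while the residue field and the slope bound the degree and the multiplicity
  of \<open>\<gamma>\<close> from below. They meet because the width of the side is a factor of
  both. The polygon comes from binomial coefficients: for \<open>t < \<kappa>\<close> the
  coefficient of \<open>y ^ (p ^ (k - t))\<close> has valuation \<open>t\<close>, so each side drops
  by 1 (a side of width 1 by at least 1), which makes the denominator of the slope equal to the
  width. Heights are cut off at \<open>\<kappa>\<close> by the divisibility of the values of
  \<open>F\<close> and its derivative at \<open>\<omega>\<close>. The delicate point is
  \<open>F \<omega>\<close>, whose valuation must be exactly \<open>\<kappa>\<close> when
  \<open>\<kappa> \<le> k\<close>. If \<open>\<sigma> = \<rho>\<close>, its two terms may cancel,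
  but then the residue of \<open>\<omega>\<close> lies in the prime field; hence the separate cases
  of degree \<open>m > 1\<close> and of distinct valuations. For \<open>m = 1\<close> there are only
  \<open>p\<close> monic linear polynomials, which is the origin of the comparison of
  \<open>p\<close> with a multiple of \<open>N\<^sub>p(1,u,a)\<close> plus 1. Oddness of
  \<open>p\<close> keeps the slopes distinct.\<close>

definition subring :: "'a::comm_ring_1 set \<Rightarrow> bool" where
  "subring R \<longleftrightarrow> 1 \<in> R \<and> (\<forall>x\<in>R. \<forall>y\<in>R. x - y \<in> R \<and> x * y \<in> R)"

definition coeffs_in :: "'a::comm_ring_1 set \<Rightarrow> 'a poly \<Rightarrow> bool" where
  "coeffs_in R q \<longleftrightarrow> (\<forall>i. coeff q i \<in> R)"

lemma subringD:
  assumes "subring R"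
  shows "1 \<in> R" "0 \<in> R" "x \<in> R \<Longrightarrow> y \<in> R \<Longrightarrow> x - y \<in> R" "x \<in> R \<Longrightarrow> y \<in> R \<Longrightarrow> x * y \<in> R"
    "x \<in> R \<Longrightarrow> - x \<in> R" "x \<in> R \<Longrightarrow> y \<in> R \<Longrightarrow> x + y \<in> R" "x \<in> R \<Longrightarrow> x ^ k \<in> R"
proof -
  show 1: "1 \<in> R" and d: "\<And>x y. x \<in> R \<Longrightarrow> y \<in> R \<Longrightarrow> x - y \<in> R"
    and m: "\<And>x y. x \<in> R \<Longrightarrow> y \<in> R \<Longrightarrow> x * y \<in> R"
    using assms by (auto simp: subring_def)
  show z: "0 \<in> R" using d[OF 1 1] by simp
  show n: "- x \<in> R" if "x \<in> R" for x using d[OF z that] by simp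
  show "x \<in> R \<Longrightarrow> y \<in> R \<Longrightarrow> x + y \<in> R" for x y using d[OF _ n[of y], of x] by simp
  show "x \<in> R \<Longrightarrow> x ^ k \<in> R" for x by (induction k) (auto simp: 1 m)
qed

lemma subring_sum: "subring R \<Longrightarrow> (\<And>i. i \<in> A \<Longrightarrow> f i \<in> R) \<Longrightarrow> sum f A \<in> R"
  by (induction A rule: infinite_finite_induct) (auto simp: subringD)

lemma subring_of_nat: "subring R \<Longrightarrow> of_nat k \<in> R"
  by (induction k) (auto simp: subringD)

lemma subring_of_int: "subring R \<Longrightarrow> of_int k \<in> R"
  by (cases k) (auto simp: subringD subring_of_nat simp del: of_nat_Suc)

lemma coeffs_in_pCons: "coeffs_in R (pCons c q) \<longleftrightarrow> c \<in> R \<and> coeffs_in R q"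
  by (auto simp: coeffs_in_def coeff_pCons split: nat.splits)

lemma coeffs_in_0: "subring R \<Longrightarrow> coeffs_in R 0"
  by (simp add: coeffs_in_def subringD)

lemma coeffs_in_diff: "subring R \<Longrightarrow> coeffs_in R p \<Longrightarrow> coeffs_in R q \<Longrightarrow> coeffs_in R (p - q)"
  by (simp add: coeffs_in_def subringD)

lemma coeffs_in_mult: "subring R \<Longrightarrow> coeffs_in R p \<Longrightarrow> coeffs_in R q \<Longrightarrow> coeffs_in R (p * q)"
  by (auto simp: coeffs_in_def coeff_mult intro!: subring_sum subringD)

lemma poly_in_subring: "subring R \<Longrightarrow> coeffs_in R q \<Longrightarrow> x \<in> R \<Longrightarrow> poly q x \<in> R"
  by (auto simp: coeffs_in_def poly_altdef intro!: subring_sum subringD)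

definition adjoin :: "'a::comm_ring_1 set \<Rightarrow> 'a \<Rightarrow> 'a set" where
  "adjoin R x = {poly q x | q. coeffs_in R q}"

lemma subring_adjoin: 
  assumes "subring R" shows "subring (adjoin R x)"
  unfolding subring_def
proof (intro conjI ballI)
  have "poly 1 x = 1" "coeffs_in R 1"
    using assms by (auto simp: coeffs_in_def subringD)
  then show "1 \<in> adjoin R x" unfolding adjoin_def by (metis (mono_tags, lifting) mem_Collect_eq)
  fix a b assume "a \<in> adjoin R x" "b \<in> adjoin R x"
  then obtain p q where *: "coeffs_in R p" "coeffs_in R q" "a = poly p x" "b = poly q x"
    unfolding adjoin_def by blast
  show "a - b \<in> adjoin R x" using coeffs_in_diff[OF assms *(1,2)] *(3,4)
    unfolding adjoin_def by (auto intro!: exI[of _ "p - q"])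
  show "a * b \<in> adjoin R x" using coeffs_in_mult[OF assms *(1,2)] *(3,4)
    unfolding adjoin_def by (auto intro!: exI[of _ "p * q"])
qed

lemma subset_adjoin: assumes "subring R" shows "R \<subseteq> adjoin R x"
proof
  fix c assume "c \<in> R"
  then have "coeffs_in R [:c:]" "poly [:c:] x = c"
    using assms by (auto simp: coeffs_in_pCons coeffs_in_0)
  then show "c \<in> adjoin R x" unfolding adjoin_def by (smt (verit, ccfv_SIG) mem_Collect_eq)
qed

lemma mem_adjoin: assumes "subring R" shows "x \<in> adjoin R x"
proof -
  have "coeffs_in R [:0, 1:]" "poly [:0, 1:] x = x"
    using assms by (auto simp: coeffs_in_pCons coeffs_in_0 subringD)
  then show "x \<in> adjoin R x" unfolding adjoin_def by (smt (verit, ccfv_SIG) mem_Collect_eq)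
qed

section \<open>Existence of valuation rings (Chevalley) and integral closure\<close>

definition valuation_ring :: "'a::field set \<Rightarrow> bool" where
  "valuation_ring V \<longleftrightarrow> subring V \<and> (\<forall>x. x \<in> V \<or> inverse x \<in> V)"

text \<open>Chevalley's argument: the shorter of two representations of 1 eliminates the leading term of the
  longer one.\<close>

lemma valuation_ring_eliminate:
  fixes x y :: "'a::field"
  assumes V: "subring V" and y: "y \<in> V"
    and unit: "\<And>b. b \<in> V \<Longrightarrow> inverse (1 - y * b) \<in> V \<and> 1 - y * b \<noteq> 0"
    and x: "x \<noteq> 0"
    and d: "1 = y * (\<Sum>i\<le>d. a i * x ^ i)" "\<And>i. a i \<in> V" "d > 0"
    and e: "1 = y * (\<Sum>i\<le>e. b i * inverse x ^ i)" "\<And>i. b i \<in> V"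
    and "e \<le> d"
  shows "\<exists>a'. (\<forall>i. a' i \<in> V) \<and> 1 = y * (\<Sum>i\<le>d-1. a' i * x ^ i)"
proof -
  \<comment> \<open>Only the constant term of the second relation is moved to the left. Its
    coefficient \<open>c\<close> is a unit, so multiplication by \<open>x ^ d\<close> expresses
    \<open>x ^ d\<close> through lower powers of \<open>x\<close>.\<close>
  define c where "c = 1 - y * b 0"
  have c: "inverse c \<in> V" "c \<noteq> 0" using unit[of "b 0"] e by (auto simp: c_def)
  have "{..e} = insert 0 {1..e}" by auto
  then have "1 = y * b 0 + y * (\<Sum>i=1..e. b i * inverse x ^ i)"
    by (subst e(1)) (simp add: algebra_simps)
  then have "c = y * (\<Sum>i=1..e. b i * inverse x ^ i)" by (simp add: c_def algebra_simps)
  then have "c * x ^ d = y * (\<Sum>i=1..e. b i * inverse x ^ i * x ^ d)"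
    by (simp add: sum_distrib_right mult.assoc)
  also have "(\<Sum>i=1..e. b i * inverse x ^ i * x ^ d) = (\<Sum>i=1..e. b i * x ^ (d - i))"
    using x \<open>e \<le> d\<close> by (intro sum.cong) (auto simp: power_diff field_simps)
  also have "\<dots> = (\<Sum>j\<le>d-1. (if d - j \<le> e then b (d - j) else 0) * x ^ j)"
  proof -
    have "(\<Sum>j\<le>d-1. (if d - j \<le> e then b (d - j) else 0) * x ^ j) = 
        (\<Sum>j | j \<le> d-1 \<and> d - j \<le> e. b (d - j) * x ^ j)"
      by (intro sum.mono_neutral_cong_right) auto
    also have "\<dots> = (\<Sum>i=1..e. b i * x ^ (d - i))"
      by (rule sum.reindex_bij_witness[of _ "\<lambda>i. d - i" "\<lambda>i. d - i"])
         (use \<open>e \<le> d\<close> d(3) in auto)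
    finally show ?thesis by simp
  qed
  finally have xd: "x ^ d = inverse c * y * (\<Sum>j\<le>d-1. (if d - j \<le> e then b (d - j) else 0) * x ^ j)"
    using c by (simp add: field_simps)
  define a' where "a' j = a j + a d * inverse c * y * (if d - j \<le> e then b (d - j) else 0)" for j
  have "{..d} = insert d {..d-1}" using d(3) by auto
  then have "1 = y * (a d * x ^ d + (\<Sum>i\<le>d-1. a i * x ^ i))"
    using d(3) by (subst d(1)) simp
  also have "a d * x ^ d + (\<Sum>i\<le>d-1. a i * x ^ i) = (\<Sum>i\<le>d-1. a' i * x ^ i)"
    unfolding xd a'_def by (simp add: sum_distrib_left sum.distrib algebra_simps)
  finally have "1 = y * (\<Sum>i\<le>d-1. a' i * x ^ i)" .
  moreover have "a' i \<in> V" for i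
    using V y d(2) e(2) c unfolding a'_def by (auto intro!: subringD[OF V])
  ultimately show ?thesis by blast
qed

lemma poly_eq_sum_le: "degree q \<le> d \<Longrightarrow> poly q x = (\<Sum>i\<le>d. coeff q i * x ^ i)"
  for q :: "'a::comm_ring_1 poly"
  unfolding poly_altdef by (intro sum.mono_neutral_left) (auto simp: coeff_eq_0)

text \<open>If neither \<open>x\<close> nor \<open>inverse x\<close> were in \<open>V\<close>,
  maximality would put \<open>inverse y\<close> into both adjunctions. This writes 1 as
  \<open>y\<close> times a polynomial in \<open>x\<close> and as \<open>y\<close> times one in
  \<open>inverse x\<close>; with both of least degree, \<open>valuation_ring_eliminate\<close> gives
  a contradiction.\<close>

lemma valuation_ring_maximal:
  fixes y :: "'a::field"
  assumes V: "subring V" and y: "y \<in> V" "inverse y \<notin> V"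
    and max: "\<And>W. subring W \<Longrightarrow> inverse y \<notin> W \<Longrightarrow> V \<subseteq> W \<Longrightarrow> W = V"
  shows "valuation_ring V"
proof -
  have y0: "y \<noteq> 0" using y subringD(2)[OF V] by auto
  have adj: "\<exists>q. coeffs_in V q \<and> inverse y = poly q x" if "x \<notin> V" for x
  proof -
    have "inverse y \<in> adjoin V x"
    proof (rule ccontr)
      assume "inverse y \<notin> adjoin V x"
      from max[OF subring_adjoin[OF V] this subset_adjoin[OF V]] that mem_adjoin[OF V, of x]
      show False by simp
    qed
    then show ?thesis unfolding adjoin_def by blast
  qed
  \<comment> \<open>Otherwise adjoining the inverse of \<open>c = 1 - y * b\<close> yields
    \<open>c ^ N * inverse y \<in> V\<close> for some \<open>N\<close>. Since \<open>c ^ N\<close>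
    has the form \<open>1 - y * v\<close>, this puts \<open>inverse y\<close> itself into
    \<open>V\<close>.\<close>
  have unit: "inverse (1 - y * b) \<in> V \<and> 1 - y * b \<noteq> 0" if b: "b \<in> V" for b
  proof (rule ccontr)
    assume *: "\<not> ?thesis"
    define c where "c = 1 - y * b"
    have "c \<noteq> 0"
    proof
      assume "c = 0"
      then have "inverse y = b" using y0 by (simp add: c_def field_simps)
      then show False using b y by simp
    qed
    with * have "inverse c \<notin> V" by (simp add: c_def)
    from adj[OF this] obtain q where q: "coeffs_in V q" "inverse y = poly q (inverse c)" by blast
    have cV: "c \<in> V" using b y V by (auto simp: c_def subringD)
    have "c ^ degree q * poly q (inverse c) \<in> V"
      unfolding poly_altdef sum_distrib_left
    proof (intro subring_sum[OF V])
      fix i assume "i \<in> {..degree q}"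
      then have eq: "c ^ degree q * (coeff q i * inverse c ^ i) = coeff q i * c ^ (degree q - i)"
        using \<open>c \<noteq> 0\<close> by (simp add: power_diff power_inverse divide_inverse)
      show "c ^ degree q * (coeff q i * inverse c ^ i) \<in> V"
        unfolding eq using q(1) cV by (simp add: coeffs_in_def subringD[OF V])
    qed
    then have 1: "c ^ N * inverse y \<in> V" if "N = degree q" for N using q that by simp
    have 2: "\<exists>v\<in>V. c ^ N = 1 - y * v" for N
    proof (induction N)
      case 0
      show ?case by (rule bexI[of _ 0]) (auto simp: subringD[OF V])
    next
      case (Suc N)
      then obtain v where v: "v \<in> V" "c ^ N = 1 - y * v" by blast
      have "c ^ Suc N = c * (1 - y * v)" using v by simp
      also have "\<dots> = 1 - y * (v + b - y * b * v)"
        by (simp add: c_def algebra_simps)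
      finally have "c ^ Suc N = 1 - y * (v + b - y * b * v)" .
      moreover have "v + b - y * b * v \<in> V" using v b y by (auto intro!: subringD[OF V])
      ultimately show ?case by blast
    qed
    obtain v where v: "v \<in> V" "c ^ degree q = 1 - y * v" using 2 by blast
    have "inverse y = c ^ degree q * inverse y + v"
      using v y0 by (simp add: field_simps)
    also have "\<dots> \<in> V" using 1 v by (auto intro!: subringD[OF V])
    finally show False using y by simp
  qed
  define R where "R x d \<longleftrightarrow> (\<exists>a. (\<forall>i. a i \<in> V) \<and> 1 = y * (\<Sum>i\<le>d. a i * x ^ i))" for x and d :: nat
  have ex: "\<exists>d. R x d" if "x \<notin> V" for x
  proof -
    from adj[OF that] obtain q where q: "coeffs_in V q" "inverse y = poly q x" by blast
    have "1 = y * (\<Sum>i\<le>degree q. coeff q i * x ^ i)"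
      using q y0 by (simp add: poly_altdef[symmetric] flip: q(2))
    then show ?thesis using q(1) unfolding R_def coeffs_in_def by blast
  qed
  have pos: "d > 0" if "R x d" for x d
  proof (rule ccontr)
    assume d: "\<not> d > 0"
    from \<open>R x d\<close> obtain a where "\<forall>i. a i \<in> V" "1 = y * (\<Sum>i\<le>d. a i * x ^ i)"
      unfolding R_def by blast
    with d have "a 0 \<in> V" "1 = y * a 0" by auto
    then obtain c where "c \<in> V" "1 = y * c" by blast
    then have "inverse y = c" using y0 by (simp add: field_simps)
    then show False using \<open>c \<in> V\<close> y by simp
  qed
  have step: "R x (d - 1)" if "x \<noteq> 0" "R x d" "R (inverse x) e" "e \<le> d" for x d e
  proof -
    from that(2) obtain a where a: "\<forall>i. a i \<in> V" "1 = y * (\<Sum>i\<le>d. a i * x ^ i)"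
      unfolding R_def by blast
    from that(3) obtain b where b: "\<forall>i. b i \<in> V" "1 = y * (\<Sum>i\<le>e. b i * inverse x ^ i)"
      unfolding R_def by blast
    show ?thesis unfolding R_def
      by (rule valuation_ring_eliminate[OF V y(1) unit that(1) a(2) _ _ b(2)])
         (use a b pos[OF that(2)] that(4) in auto)
  qed
  have "x \<in> V \<or> inverse x \<in> V" for x
  proof (rule ccontr)
    assume *: "\<not> ?thesis"
    then have x0: "x \<noteq> 0" using subringD(2)[OF V] by auto
    define d where "d = (LEAST d. R x d)"
    define e where "e = (LEAST d. R (inverse x) d)"
    have d: "R x d" and e: "R (inverse x) e"
      unfolding d_def e_def using LeastI_ex[OF ex, of x] LeastI_ex[OF ex, of "inverse x"] * by blast+
    have nd: "\<not> R x (d - 1)" 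
      using not_less_Least[of "d - 1" "R x"] pos[OF d] by (simp add: d_def)
    have ne: "\<not> R (inverse x) (e - 1)"
      using not_less_Least[of "e - 1" "R (inverse x)"] pos[OF e] by (simp add: e_def)
    show False
    proof (cases "e \<le> d")
      case False
      then show False using step[of "inverse x" e d] d e x0 ne by simp
    qed (use step[OF x0 d e] nd in blast)
  qed
  then show ?thesis using V by (simp add: valuation_ring_def)
qed

lemma valuation_ring_exists:
  fixes y :: "'a::field"
  assumes "subring R" "y \<in> R" "inverse y \<notin> R"
  obtains V where "valuation_ring V" "R \<subseteq> V" "inverse y \<notin> V"
proof -
  define A where "A = {W. subring W \<and> R \<subseteq> W \<and> inverse y \<notin> W}"
  have "\<exists>M\<in>A. \<forall>X\<in>A. M \<subseteq> X \<longrightarrow> X = M"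
  proof (rule subset_Zorn_nonempty)
    show "A \<noteq> {}" using assms by (auto simp: A_def)
    fix C assume C: "C \<noteq> {}" "subset.chain A C"
    have "subring (\<Union>C)" unfolding subring_def
    proof (intro conjI ballI)
      show "1 \<in> \<Union>C" using C by (auto simp: subset.chain_def A_def subring_def)
      fix a b assume "a \<in> \<Union>C" "b \<in> \<Union>C"
      then obtain W1 W2 where "a \<in> W1" "b \<in> W2" "W1 \<in> C" "W2 \<in> C" by blast
      then obtain W where "a \<in> W" "b \<in> W" "W \<in> C"
        using C(2) by (metis subset_chain_def subsetD)
      moreover then have "subring W" using C(2) by (auto simp: subset.chain_def A_def)
      ultimately show "a - b \<in> \<Union>C" "a * b \<in> \<Union>C" using subringD by blast+
    qed
    then show "\<Union>C \<in> A" using C by (auto simp: subset.chain_def A_def)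
  qed
  then obtain V where V: "V \<in> A" "\<And>X. X \<in> A \<Longrightarrow> V \<subseteq> X \<Longrightarrow> X = V" by blast
  have "valuation_ring V"
    using V assms by (intro valuation_ring_maximal[of V y]) (auto simp: A_def)
  then show ?thesis using that V by (auto simp: A_def)
qed

lemma valuation_ring_algebraic_int:
  fixes x :: "'a::field_char_0"
  assumes V: "valuation_ring V" and x: "algebraic_int x"
  shows "x \<in> V"
proof (rule ccontr)
  assume nx: "x \<notin> V"
  have S: "subring V" and inv: "inverse x \<in> V" using V nx by (auto simp: valuation_ring_def)
  from x obtain q where q: "lead_coeff q = 1" "\<And>i. coeff q i \<in> \<int>" "poly q x = 0"
    by (auto simp: algebraic_int.simps)
  have x0: "x \<noteq> 0" using nx subringD(2)[OF S] by auto
  define d where "d = degree q"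
  have d: "d > 0"
  proof (rule ccontr)
    assume "\<not> d > 0"
    then obtain c where c: "q = [:c:]" by (metis d_def degree_eq_zeroE gr0I)
    then show False using q by auto
  qed
  have "{..d} = insert d {..<d}" by auto
  then have "0 = x ^ d + (\<Sum>i<d. coeff q i * x ^ i)"
    using q by (simp add: poly_altdef d_def)
  then have "x ^ d = - (\<Sum>i<d. coeff q i * x ^ i)" by (simp add: eq_neg_iff_add_eq_0)
  then have "x ^ d * inverse x ^ (d - 1) = - (\<Sum>i<d. coeff q i * x ^ i * inverse x ^ (d - 1))"
    by (simp add: sum_distrib_right)
  also have "(\<Sum>i<d. coeff q i * x ^ i * inverse x ^ (d - 1)) = (\<Sum>i<d. coeff q i * inverse x ^ (d - 1 - i))"
    using x0 d by (intro sum.cong) (auto simp: power_diff field_simps)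
  also have "x ^ d * inverse x ^ (d - 1) = x"
    using d x0 by (cases d) (auto simp: field_simps)
  finally have eq: "x = - (\<Sum>i<d. coeff q i * inverse x ^ (d - 1 - i))" .
  have "coeff q i \<in> V" for i using q(2)[of i] by (auto elim!: Ints_cases simp: subring_of_int[OF S])
  then have "- (\<Sum>i<d. coeff q i * inverse x ^ (d - 1 - i)) \<in> V"
    using inv by (intro subringD(5)[OF S] subring_sum[OF S] subringD(4)[OF S] subringD(7)[OF S]) auto
  with eq nx show False by simp
qed

text \<open>For the converse, an \<open>x\<close> outside \<int>[1/x] would be avoided by some
  valuation ring; so \<open>x\<close> is a polynomial in \<open>inverse x\<close>, and clearing
  denominators gives an integral equation. Integrality can thus be tested in one valuation ring at a
  time, which serves as a substitute for Gauss's lemma.\<close>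

lemma algebraic_int_iff_valuation_rings:
  fixes x :: "'a::field_char_0"
  shows "algebraic_int x \<longleftrightarrow> (\<forall>V. valuation_ring V \<longrightarrow> x \<in> V)"
proof
  assume x: "\<forall>V. valuation_ring V \<longrightarrow> x \<in> V"
  have Z: "subring (\<int> :: 'a set)" by (auto simp: subring_def)
  have "x \<in> adjoin \<int> (inverse x)"
  proof (rule ccontr)
    assume "x \<notin> adjoin \<int> (inverse x)"
    then obtain V where "valuation_ring V" "x \<notin> V"
      using valuation_ring_exists[OF subring_adjoin[OF Z, of "inverse x"] mem_adjoin[OF Z]] by auto
    then show False using x by simp
  qed
  then obtain q where q: "coeffs_in \<int> q" "x = poly q (inverse x)" by (auto simp: adjoin_def)
  show "algebraic_int x"
  proof (cases "x = 0")
    case False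
    define d where "d = degree q"
    have "x ^ Suc d = (\<Sum>i\<le>d. coeff q i * inverse x ^ i) * x ^ d"
      using q by (simp add: poly_altdef d_def)
    also have "\<dots> = (\<Sum>i\<le>d. coeff q i * x ^ (d - i))"
      unfolding sum_distrib_right using False by (intro sum.cong) (auto simp: power_diff field_simps)
    finally have *: "x ^ Suc d = (\<Sum>i\<le>d. coeff q i * x ^ (d - i))" .
    define r where "r = monom 1 (Suc d) - (\<Sum>i\<le>d. monom (coeff q i) (d - i))"
    have "poly r x = 0" using * by (simp add: r_def poly_monom poly_sum)
    moreover have deg: "degree (\<Sum>i\<le>d. monom (coeff q i) (d - i)) < Suc d"
      by (intro degree_sum_less) (auto intro: le_less_trans[OF degree_monom_le])
    have "coeff r (Suc d) = 1" unfolding r_def using deg by (simp add: coeff_eq_0)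
    moreover have "degree r = Suc d"
      unfolding r_def using deg
      by (metis (no_types, lifting) degree_add_eq_left degree_minus degree_monom_eq one_neq_zero
          uminus_add_conv_diff add.commute)
    moreover have "coeff r i \<in> \<int>" for i
      using q(1) unfolding r_def coeffs_in_def
      by (auto simp: coeff_sum intro!: Ints_diff Ints_sum)
    ultimately show ?thesis by (intro algebraic_int.intros[of r]) auto
  qed simp
qed (use valuation_ring_algebraic_int in blast)

section \<open>Residue fields and places\<close>

text \<open>Zero has its own clause because \<open>inverse 0 = 0\<close> lies in
  \<open>V\<close>.\<close>

definition maximal_ideal :: "'a::field set \<Rightarrow> 'a set" where
  "maximal_ideal V = {x \<in> V. x = 0 \<or> inverse x \<notin> V}"

lemma maximal_ideal_mult:
  assumes V: "valuation_ring V" and x: "x \<in> maximal_ideal V" and y: "y \<in> V"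
  shows "x * y \<in> maximal_ideal V"
proof -
  have S: "subring V" using V by (simp add: valuation_ring_def)
  have "inverse (x * y) \<notin> V" if "x * y \<noteq> 0"
  proof
    assume "inverse (x * y) \<in> V"
    then have "y * inverse (x * y) \<in> V" using y S by (simp add: subringD)
    then have "inverse x \<in> V" using that by (simp add: field_simps)
    then show False using x that by (simp add: maximal_ideal_def)
  qed
  then show ?thesis using x y S by (auto simp: maximal_ideal_def subringD)
qed

lemma maximal_ideal_add:
  assumes V: "valuation_ring V" and x: "x \<in> maximal_ideal V" and y: "y \<in> maximal_ideal V"
  shows "x + y \<in> maximal_ideal V"
proof -
  have S: "subring V" and val: "\<And>z. z \<in> V \<or> inverse z \<in> V"
    using V by (auto simp: valuation_ring_def)
  \<comment> \<open>Of two nonzero elements one divides the other in \<open>V\<close>, and the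
    divisor is factored out of the sum.\<close>
  have *: "a + b \<in> maximal_ideal V"
    if "a \<in> maximal_ideal V" "b \<in> maximal_ideal V" "b / a \<in> V" "a \<noteq> 0" for a b
  proof -
    have "a + b = a * (1 + b / a)" using that by (simp add: field_simps)
    also have "\<dots> \<in> maximal_ideal V"
      by (rule maximal_ideal_mult[OF V that(1)]) (use that S in \<open>simp add: subringD\<close>)
    finally show ?thesis .
  qed
  consider "x = 0" | "y = 0" | "x \<noteq> 0" "y \<noteq> 0" by blast
  then show ?thesis
  proof cases
    case 3
    then show ?thesis using val[of "x / y"] *[OF x y] *[OF y x] by (auto simp: add.commute)
  qed (use x y in auto)
qed

lemma maximal_ideal_uminus:
  assumes V: "valuation_ring V" and x: "x \<in> maximal_ideal V"
  shows "- x \<in> maximal_ideal V"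
  using maximal_ideal_mult[OF V x, of "-1"] V by (auto simp: valuation_ring_def subringD)

lemma maximal_ideal_0 [simp]: "valuation_ring V \<Longrightarrow> 0 \<in> maximal_ideal V"
  by (simp add: maximal_ideal_def valuation_ring_def subringD)

text \<open>The type \<open>'f\<close> only serves to fix the number \<open>CARD('f)\<close>, which becomes a non-unit.\<close>

definition vring :: "'f itself \<Rightarrow> complex set" where
  "vring _ = (SOME V. valuation_ring V \<and>
     (card (UNIV :: 'f set) \<ge> 2 \<longrightarrow> inverse (of_nat (card (UNIV :: 'f set))) \<notin> V))"

lemma vring:
  "valuation_ring (vring TYPE('f))"
  "card (UNIV :: 'f set) \<ge> 2 \<Longrightarrow> inverse (of_nat (card (UNIV :: 'f set))) \<notin> vring TYPE('f)"
proof -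
  define N where "N = card (UNIV :: 'f set)"
  have "\<exists>V. valuation_ring V \<and> (N \<ge> 2 \<longrightarrow> inverse (of_nat N :: complex) \<notin> V)"
  proof (cases "N \<ge> 2")
    case N: True
    have "inverse (of_nat N :: complex) \<notin> \<int>"
    proof
      assume "inverse (of_nat N :: complex) \<in> \<int>"
      then obtain z where "inverse (of_nat N :: complex) = of_int z" by (auto elim: Ints_cases)
      then have "of_int z * of_nat N = (1 :: complex)" using N by (auto simp: field_simps)
      then have "of_int (z * int N) = (of_int 1 :: complex)" by simp
      then have "z * int N = 1" by (subst (asm) of_int_eq_iff)
      then show False using N by (simp add: zmult_eq_1_iff)
    qed
    then show ?thesis
      using valuation_ring_exists[of "\<int> :: complex set" "of_nat N"] by (auto simp: subring_def)
  next
    case False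
    have "valuation_ring (UNIV :: complex set)" by (simp add: valuation_ring_def subring_def)
    then show ?thesis using False by blast
  qed
  from someI_ex[OF this] show "valuation_ring (vring TYPE('f))"
    "card (UNIV :: 'f set) \<ge> 2 \<Longrightarrow> inverse (of_nat (card (UNIV :: 'f set))) \<notin> vring TYPE('f)"
    by (simp_all add: vring_def N_def)
qed

abbreviation vmax :: "'f itself \<Rightarrow> complex set" where
  "vmax f \<equiv> maximal_ideal (vring f)"

lemma vring_subring: "subring (vring TYPE('f))"
  using vring by (auto simp: valuation_ring_def)

lemmas vringD = subringD[OF vring_subring]
lemmas vmaxD = maximal_ideal_mult[OF vring(1)] maximal_ideal_add[OF vring(1)] 
  maximal_ideal_uminus[OF vring(1)] maximal_ideal_0[OF vring(1)]

text \<open>Members of one coset satisfy the same predicate under \<open>SOME\<close>, so the choice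
  depends on the coset alone, and equality of representatives is congruence modulo the maximal
  ideal.\<close>

definition coset_rep :: "'f itself \<Rightarrow> complex \<Rightarrow> complex" where
  "coset_rep f x = (SOME y. x - y \<in> vmax f)"

lemma coset_rep: "x - coset_rep TYPE('f) x \<in> vmax TYPE('f)"
  unfolding coset_rep_def by (rule someI[of _ x]) (simp add: vmaxD)

lemma coset_rep_in: 
  assumes "x \<in> vring TYPE('f)"
  shows "coset_rep TYPE('f) x \<in> vring TYPE('f)"
  using vringD(3)[OF assms, of "x - coset_rep TYPE('f) x"] coset_rep[of x, where 'f = 'f]
  by (simp add: maximal_ideal_def)

lemma coset_rep_eq_iff:
  "coset_rep TYPE('f) x = coset_rep TYPE('f) y \<longleftrightarrow> x - y \<in> vmax TYPE('f)"
proof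
  assume "coset_rep TYPE('f) x = coset_rep TYPE('f) y"
  then show "x - y \<in> vmax TYPE('f)"
    using vmaxD(2)[OF coset_rep[of x] vmaxD(3)[OF coset_rep[of y, where 'f = 'f]]] by simp
next
  assume *: "x - y \<in> vmax TYPE('f)"
  have "x - z \<in> vmax TYPE('f) \<longleftrightarrow> y - z \<in> vmax TYPE('f)" for z
    using vmaxD(2)[of "x - y" "y - z"] vmaxD(2)[of "- (x - y)" "x - z"] vmaxD(3)[OF *] * by auto
  then show "coset_rep TYPE('f) x = coset_rep TYPE('f) y" by (simp add: coset_rep_def)
qed

text \<open>The residue field has to be a type of class \<open>field\<close> so that polynomials
  over it are available. It is carried by the representatives, indexed by the phantom type
  \<open>'f\<close> that also fixes the valuation ring.\<close>

typedef 'f residue = "coset_rep TYPE('f) ` vring TYPE('f)"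
  using vringD by blast

definition residue :: "complex \<Rightarrow> 'f residue" where
  "residue x = Abs_residue (coset_rep TYPE('f) x)"

lemma residue_eq_iff:
  assumes "x \<in> vring TYPE('f)" "y \<in> vring TYPE('f)"
  shows "(residue x :: 'f residue) = residue y \<longleftrightarrow> x - y \<in> vmax TYPE('f)"
  using assms by (simp add: residue_def Abs_residue_inject[OF imageI imageI] coset_rep_eq_iff)

lemma residue_Rep:
  "Rep_residue (z :: 'f residue) \<in> vring TYPE('f)" "residue (Rep_residue z) = z"
proof -
  obtain x where x: "x \<in> vring TYPE('f)" "Rep_residue z = coset_rep TYPE('f) x"
    using Rep_residue[of z] by blast
  show "Rep_residue z \<in> vring TYPE('f)" using x coset_rep_in by simp
  have "coset_rep TYPE('f) (coset_rep TYPE('f) x) = coset_rep TYPE('f) x"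
    using vmaxD(3)[OF coset_rep[of x, where 'f = 'f]] by (simp add: coset_rep_eq_iff)
  then show "residue (Rep_residue z) = z"
    by (metis residue_def x(2) Rep_residue_inverse)
qed

lemma residue_cases:
  fixes z :: "'f residue"
  obtains x where "x \<in> vring TYPE('f)" "z = residue x"
  using residue_Rep[of z] by metis

lemma Rep_residue_diff:
  assumes "x \<in> vring TYPE('f)"
  shows "Rep_residue (residue x :: 'f residue) - x \<in> vmax TYPE('f)"
  using residue_eq_iff[OF residue_Rep(1)[of "residue x :: 'f residue"] assms] by (simp add: residue_Rep)

instantiation residue :: (type) field
begin

definition "zero_residue = (residue 0 :: 'a residue)"
definition "one_residue = (residue 1 :: 'a residue)"
definition "plus_residue (x :: 'a residue) (y :: 'a residue) = (residue (Rep_residue x + Rep_residue y) :: 'a residue)"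
definition "minus_residue (x :: 'a residue) (y :: 'a residue) = (residue (Rep_residue x - Rep_residue y) :: 'a residue)"
definition "uminus_residue (x :: 'a residue) = (residue (- Rep_residue x) :: 'a residue)"
definition "times_residue (x :: 'a residue) (y :: 'a residue) = (residue (Rep_residue x * Rep_residue y) :: 'a residue)"
definition "inverse_residue (x :: 'a residue) = (if x = 0 then 0 else residue (inverse (Rep_residue x)) :: 'a residue)"
definition "divide_residue (x :: 'a residue) (y :: 'a residue) = x * inverse y"

lemma residue_add:
  assumes "x \<in> vring TYPE('a)" "y \<in> vring TYPE('a)"
  shows "(residue (x + y) :: 'a residue) = residue x + residue y"
proof -
  have "Rep_residue (residue x :: 'a residue) + Rep_residue (residue y :: 'a residue) - (x + y) \<in> vmax TYPE('a)"
    using vmaxD(2)[OF Rep_residue_diff[OF assms(1)] Rep_residue_diff[OF assms(2)]]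
    by (simp add: algebra_simps)
  then show ?thesis unfolding plus_residue_def
    using assms by (metis residue_eq_iff residue_Rep(1) vringD(6))
qed

lemma residue_uminus:
  assumes "x \<in> vring TYPE('a)"
  shows "(residue (- x) :: 'a residue) = - residue x"
proof -
  have "- Rep_residue (residue x :: 'a residue) - (- x) \<in> vmax TYPE('a)"
    using vmaxD(3)[OF Rep_residue_diff[OF assms(1)]] by simp
  then show ?thesis unfolding uminus_residue_def
    using assms by (metis residue_eq_iff residue_Rep(1) vringD(5))
qed

lemma residue_mult:
  assumes "x \<in> vring TYPE('a)" "y \<in> vring TYPE('a)"
  shows "(residue (x * y) :: 'a residue) = residue x * residue y"
proof -
  define x' y' where "x' = Rep_residue (residue x :: 'a residue)" "y' = Rep_residue (residue y :: 'a residue)"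
  have *: "x' \<in> vring TYPE('a)" "y' \<in> vring TYPE('a)" by (simp_all add: x'_y'_def residue_Rep)
  have "(x' - x) * y' + (y' - y) * x \<in> vmax TYPE('a)"
    using assms Rep_residue_diff[OF assms(1)] Rep_residue_diff[OF assms(2)] *
    by (intro vmaxD) (auto simp: x'_y'_def)
  then have "x' * y' - x * y \<in> vmax TYPE('a)" by (simp add: algebra_simps)
  then show ?thesis unfolding times_residue_def
    using assms * by (metis residue_eq_iff vringD(4) x'_y'_def)
qed

lemma residue_diff:
  assumes "x \<in> vring TYPE('a)" "y \<in> vring TYPE('a)"
  shows "(residue (x - y) :: 'a residue) = residue x - residue y"
proof -
  have "Rep_residue (residue x :: 'a residue) - Rep_residue (residue y :: 'a residue) - (x - y) \<in> vmax TYPE('a)"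
    using vmaxD(2)[OF Rep_residue_diff[OF assms(1)] vmaxD(3)[OF Rep_residue_diff[OF assms(2)]]]
    by (simp add: algebra_simps)
  then show ?thesis unfolding minus_residue_def
    using assms by (metis residue_eq_iff residue_Rep(1) vringD(3))
qed

lemma residue_inverse:
  assumes "x \<in> vring TYPE('a)" "x \<notin> vmax TYPE('a)"
  shows "inverse x \<in> vring TYPE('a)" "x \<noteq> 0"
  using assms vmaxD(4) by (auto simp: maximal_ideal_def)

instance
proof
  fix x y z :: "'a residue"
  obtain a b c where *: "a \<in> vring TYPE('a)" "b \<in> vring TYPE('a)" "c \<in> vring TYPE('a)"
    "x = residue a" "y = residue b" "z = residue c" by (metis residue_cases)
  note hom = residue_add[symmetric] residue_mult[symmetric] residue_uminus[symmetric] 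
    residue_diff[symmetric] vringD
  note [simp] = *
  show "x + y + z = x + (y + z)" by (simp add: hom algebra_simps)
  show "x + y = y + x" by (simp add: hom algebra_simps)
  show "0 + x = x" by (simp add: hom zero_residue_def)
  show "- x + x = 0" by (simp add: hom zero_residue_def)
  show "x - y = x + - y" by (simp add: hom)
  show "x * y * z = x * (y * z)" by (simp add: hom algebra_simps)
  show "x * y = y * x" by (simp add: hom algebra_simps)
  show "1 * x = x" by (simp add: hom one_residue_def)
  show "(x + y) * z = x * z + y * z" by (simp add: hom algebra_simps)
  show "(0 :: 'a residue) \<noteq> 1"
    using residue_eq_iff[of 0 1, where 'f = 'a]
    by (auto simp: zero_residue_def one_residue_def vringD maximal_ideal_def)
  show "inverse (0 :: 'a residue) = 0" by (simp add: inverse_residue_def)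
  show "x div y = x * inverse y" by (simp add: divide_residue_def)
  show "inverse x * x = 1" if "x \<noteq> 0"
  proof -
    define a' where "a' = Rep_residue x"
    have a': "a' \<in> vring TYPE('a)" "x = residue a'" by (simp_all only: a'_def residue_Rep)
    then have "a' \<notin> vmax TYPE('a)"
      using that residue_eq_iff[of a' 0] by (auto simp: zero_residue_def vringD)
    from residue_inverse[OF a'(1) this] a' that show ?thesis
      unfolding inverse_residue_def a'_def[symmetric]
      by (simp add: one_residue_def residue_mult[symmetric] del: *)
  qed
qed

end

section \<open>Homomorphisms on subrings, and places\<close>

definition ring_hom_on :: "'a::comm_ring_1 set \<Rightarrow> ('a \<Rightarrow> 'b::comm_ring_1) \<Rightarrow> bool" where
  "ring_hom_on R f \<longleftrightarrow> subring R \<and> f 1 = 1 \<and>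
     (\<forall>x\<in>R. \<forall>y\<in>R. f (x - y) = f x - f y \<and> f (x * y) = f x * f y)"

lemma ring_hom_onD:
  assumes "ring_hom_on R f"
  shows "subring R" "f 1 = 1" "f 0 = 0" "x \<in> R \<Longrightarrow> y \<in> R \<Longrightarrow> f (x - y) = f x - f y"
    "x \<in> R \<Longrightarrow> y \<in> R \<Longrightarrow> f (x * y) = f x * f y"
    "x \<in> R \<Longrightarrow> f (- x) = - f x" "x \<in> R \<Longrightarrow> y \<in> R \<Longrightarrow> f (x + y) = f x + f y"
    "x \<in> R \<Longrightarrow> f (x ^ k) = f x ^ k" "f (of_nat k) = of_nat k" "f (of_int l) = of_int l"
proof -
  show S: "subring R" and 1: "f 1 = 1"
    and d: "\<And>x y. x \<in> R \<Longrightarrow> y \<in> R \<Longrightarrow> f (x - y) = f x - f y"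
    and m: "\<And>x y. x \<in> R \<Longrightarrow> y \<in> R \<Longrightarrow> f (x * y) = f x * f y"
    using assms by (auto simp: ring_hom_on_def)
  show 0: "f 0 = 0" using d[of 1 1] subringD[OF S] by simp
  show u: "f (- x) = - f x" if "x \<in> R" for x
    using d[of 0 x] that 0 subringD[OF S] by simp
  show a: "f (x + y) = f x + f y" if "x \<in> R" "y \<in> R" for x y
    using d[of x "- y"] u[of y] that subringD[OF S] by simp
  show "x \<in> R \<Longrightarrow> f (x ^ k) = f x ^ k" by (induction k) (auto simp: 1 m subringD[OF S])
  show n: "f (of_nat k) = of_nat k" for k
    by (induction k) (auto simp: 0 1 a subringD[OF S] subring_of_nat[OF S])
  show "f (of_int l) = of_int l"
    by (cases l) (auto simp: n u d 1 subringD[OF S] subring_of_nat[OF S] simp del: of_nat_Suc)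
qed

lemma ring_hom_on_sum:
  assumes f: "ring_hom_on R f" and "\<And>i. i \<in> A \<Longrightarrow> g i \<in> R"
  shows "f (sum g A) = (\<Sum>i\<in>A. f (g i))"
  using assms(2)
  by (induction A rule: infinite_finite_induct) 
     (auto simp: ring_hom_onD[OF f] subring_sum[OF ring_hom_onD(1)[OF f]])

lemma coeff_map_poly_hom: "ring_hom_on R f \<Longrightarrow> coeff (map_poly f p) i = f (coeff p i)"
  by (simp add: coeff_map_poly ring_hom_onD)

lemma map_poly_hom_add:
  assumes "ring_hom_on R f" "coeffs_in R p" "coeffs_in R q"
  shows "map_poly f (p + q) = map_poly f p + map_poly f q"
  using assms by (intro poly_eqI) (auto simp: coeff_map_poly_hom[OF assms(1)] ring_hom_onD coeffs_in_def)

lemma map_poly_hom_diff: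
  assumes "ring_hom_on R f" "coeffs_in R p" "coeffs_in R q"
  shows "map_poly f (p - q) = map_poly f p - map_poly f q"
  using assms by (intro poly_eqI) (auto simp: coeff_map_poly_hom[OF assms(1)] ring_hom_onD coeffs_in_def)

lemma map_poly_hom_mult:
  assumes f: "ring_hom_on R f" and p: "coeffs_in R p" and q: "coeffs_in R q"
  shows "map_poly f (p * q) = map_poly f p * map_poly f q"
proof (rule poly_eqI)
  fix n
  have "f (\<Sum>i\<le>n. coeff p i * coeff q (n - i)) = (\<Sum>i\<le>n. f (coeff p i * coeff q (n - i)))"
    using p q by (intro ring_hom_on_sum[OF f]) 
      (auto simp: coeffs_in_def intro: subringD[OF ring_hom_onD(1)[OF f]])
  also have "\<dots> = (\<Sum>i\<le>n. f (coeff p i) * f (coeff q (n - i)))"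
    using p q by (intro sum.cong refl ring_hom_onD(5)[OF f]) (auto simp: coeffs_in_def)
  finally show "coeff (map_poly f (p * q)) n = coeff (map_poly f p * map_poly f q) n"
    by (simp add: coeff_map_poly_hom[OF f] coeff_mult)
qed

lemma map_poly_hom_pCons: "ring_hom_on R f \<Longrightarrow> map_poly f (pCons c p) = pCons (f c) (map_poly f p)"
  by (rule poly_eqI) (auto simp: coeff_map_poly_hom coeff_pCons split: nat.splits)

lemma subring_UNIV [simp]: "subring UNIV" and coeffs_in_UNIV [simp]: "coeffs_in UNIV p"
  by (auto simp: subring_def coeffs_in_def)

lemma ring_hom_on_of_int: "ring_hom_on UNIV of_int"
  by (auto simp: ring_hom_on_def)

lemma ring_hom_on_of_rat: "ring_hom_on UNIV (of_rat :: rat \<Rightarrow> 'a::field_char_0)"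
  by (auto simp: ring_hom_on_def of_rat_diff of_rat_mult)

text \<open>A valuation ring with its reduction map. \<open>red_inverse\<close> makes non-units
  reduce to 0, so the kernel on \<open>V\<close> is exactly the maximal ideal; values of
  \<open>red\<close> outside \<open>V\<close> are left open.\<close>

locale place =
  fixes V :: "complex set" and red :: "complex \<Rightarrow> 'r::field"
  assumes valuation: "valuation_ring V"
    and red_hom: "ring_hom_on V red"
    and red_inverse: "x \<notin> V \<Longrightarrow> red (inverse x) = 0"

lemma place_exists:
  "\<exists>V (red :: complex \<Rightarrow> 'f::{field,finite} residue).
     place V red \<and> red (of_nat (card (UNIV :: 'f set))) = 0"
proof (intro exI conjI)
  have V: "\<And>x :: complex. x \<in> vring TYPE('f) \<or> inverse x \<in> vring TYPE('f)"
    using vring(1) by (auto simp: valuation_ring_def)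
  have zero: "(residue x :: 'f residue) = 0" if "x \<in> vmax TYPE('f)" for x
    using that residue_eq_iff[of x 0, where 'f = 'f]
    by (auto simp: zero_residue_def vringD maximal_ideal_def)
  show "place (vring TYPE('f)) (residue :: complex \<Rightarrow> 'f residue)"
  proof
    show "valuation_ring (vring TYPE('f))" by (rule vring)
    show "ring_hom_on (vring TYPE('f)) (residue :: complex \<Rightarrow> 'f residue)"
      unfolding ring_hom_on_def
      by (auto simp: vring_subring residue_diff residue_mult one_residue_def)
    show "(residue (inverse x) :: 'f residue) = 0" if "x \<notin> vring TYPE('f)" for x
      using that V[of x] by (intro zero) (auto simp: maximal_ideal_def)
  qed
  have "card {0, 1 :: 'f} \<le> card (UNIV :: 'f set)" by (rule card_mono) auto
  then show "(residue (of_nat (card (UNIV :: 'f set))) :: 'f residue) = 0"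
    using vring(2)[where 'f = 'f] V[of "of_nat (card (UNIV :: 'f set))"]
    by (intro zero) (auto simp: maximal_ideal_def)
qed

section \<open>Reduction of polynomials\<close>

lemma coeffs_in_synthetic_div:
  assumes "subring V" "coeffs_in V q" "z \<in> V" shows "coeffs_in V (synthetic_div q z)"
  using assms(2)
  by (induction q) (auto simp: coeffs_in_pCons coeffs_in_0 poly_in_subring assms)

text \<open>The coefficients of \<open>S\<close> are \<open>c\<^sub>d z\<^sup>i + c\<^sub>d\<^sub>-\<^sub>1 z\<^sup>i\<^sup>-\<^sup>1 + \<dots>\<close> where \<open>c\<^sub>i\<close> are those of \<open>Q\<close>.\<close>

lemma coeffs_in_cofactor:
  fixes z :: "'a::field"
  assumes V: "valuation_ring V" and Q: "coeffs_in V Q" and QS: "Q = [:- z, 1:] * S"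
  shows "coeffs_in V S" "coeffs_in V (smult z S)"
proof -
  have sub: "subring V" using V by (simp add: valuation_ring_def)
  have "coeffs_in V S \<and> coeffs_in V (smult z S)"
  proof (cases "z \<in> V")
    case True
    have "Q + smult z S = pCons 0 S" by (simp add: QS)
    then have "S = synthetic_div Q z" using synthetic_div_unique by blast
    then have "coeffs_in V S" using coeffs_in_synthetic_div[OF sub Q True] by simp
    then show ?thesis using True by (simp add: coeffs_in_def subringD[OF sub])
  next
    case False
    define w where "w = inverse z"
    have w: "w \<in> V" using False V by (auto simp: valuation_ring_def w_def)
    have z0: "z \<noteq> 0" using False subringD[OF sub] by auto
    \<comment> \<open>With \<open>z\<close> outside \<open>V\<close> the linear factor is
      renormalised to constant term 1, so the coefficients of the cofactor are found from the lowest
      one upwards.\<close>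
    define T where "T = smult (- z) S"
    have QT: "Q = [:1, - w:] * T"
      unfolding QS T_def w_def using z0 by (simp add: smult_add_right)
    have TV: "coeff T i \<in> V" for i
    proof (induction i)
      case 0
      have "coeff Q 0 = coeff T 0" by (simp add: QT)
      then show ?case using Q by (metis coeffs_in_def)
    next
      case (Suc i)
      have "coeff Q (Suc i) = coeff T (Suc i) - w * coeff T i" by (simp add: QT)
      then have "coeff T (Suc i) = coeff Q (Suc i) + w * coeff T i" by simp
      then show ?case using Suc w Q by (simp add: subringD[OF sub] coeffs_in_def)
    qed
    have "coeff S i = - (w * coeff T i)" "coeff (smult z S) i = - coeff T i" for i
      using z0 by (simp_all add: T_def w_def)
    then show ?thesis using TV w unfolding coeffs_in_def by (simp only: subringD[OF sub] simp_thms)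
  qed
  then show "coeffs_in V S" "coeffs_in V (smult z S)" by auto
qed

lemma order_linear: "order c [:- a, 1:] = (if c = a then 1 else 0)" for a :: "'x::field"
  using order_power_n_n[of a 1] by (auto intro!: order_0I)

context place
begin

definition unit :: "complex \<Rightarrow> bool" where
  "unit x \<longleftrightarrow> x \<in> V \<and> red x \<noteq> 0"

lemma subring_V: "subring V"
  using valuation by (simp add: valuation_ring_def)

lemmas VD = subringD[OF subring_V] subring_of_nat[OF subring_V] subring_of_int[OF subring_V]
lemmas redD = ring_hom_onD[OF red_hom]

lemma algebraic_int_V: "algebraic_int x \<Longrightarrow> x \<in> V"
  using valuation valuation_ring_algebraic_int by blast

lemma inverse_V: "x \<notin> V \<Longrightarrow> inverse x \<in> V"
  using valuation by (auto simp: valuation_ring_def)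

lemma unit_inverse:
  assumes "unit x" shows "unit (inverse x)" "x \<noteq> 0"
proof -
  show 0: "x \<noteq> 0" using assms by (auto simp: unit_def redD)
  have V: "inverse x \<in> V"
    using assms red_inverse[of "inverse x"] by (auto simp: unit_def)
  have "red x * red (inverse x) = red (x * inverse x)"
    using assms V by (simp add: redD unit_def)
  also have "\<dots> = 1" using 0 by (simp add: redD)
  finally show "unit (inverse x)" using V by (auto simp: unit_def)
qed

lemma unit_mult: "unit x \<Longrightarrow> unit y \<Longrightarrow> unit (x * y)"
  by (auto simp: unit_def redD VD)

lemma unit_power: "unit x \<Longrightarrow> unit (x ^ k)"
  by (auto simp: unit_def redD VD)

lemma unit_uminus: "unit x \<Longrightarrow> unit (- x)"
  by (auto simp: unit_def redD VD)

lemma V_divide_unit: "x \<in> V \<Longrightarrow> unit y \<Longrightarrow> x / y \<in> V"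
  using unit_inverse(1)[of y] by (auto simp: divide_inverse unit_def VD)

lemma mult_unit_iff: 
  assumes "unit y" 
  shows "x * y \<in> V \<longleftrightarrow> x \<in> V" "unit (x * y) \<longleftrightarrow> unit x"
proof -
  have x: "x = (x * y) * inverse y" using unit_inverse[OF assms] by simp
  show "x * y \<in> V \<longleftrightarrow> x \<in> V"
    using x assms unit_inverse[OF assms] by (metis VD(4) unit_def)
  show "unit (x * y) \<longleftrightarrow> unit x"
    using x assms unit_inverse[OF assms] by (metis unit_mult)
qed

lemma power_in_V: 
  assumes "x ^ k \<in> V" "k > 0" shows "x \<in> V"
proof (rule ccontr)
  assume *: "x \<notin> V"
  then have i: "inverse x \<in> V" "red (inverse x) = 0" using inverse_V red_inverse by auto
  have "x \<noteq> 0" using * VD by auto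
  then have "1 = inverse x ^ k * x ^ k" by (simp add: power_inverse)
  also have "red \<dots> = red (inverse x) ^ k * red (x ^ k)" using i assms by (simp add: redD VD)
  also have "\<dots> = 0" using i assms by simp
  finally show False by (simp add: redD)
qed

lemma unit_power_iff: "k > 0 \<Longrightarrow> unit (x ^ k) \<longleftrightarrow> unit x"
  using power_in_V[of x k] by (auto simp: unit_def VD redD)

text \<open>Gauss's lemma: dividing by \<open>z\<close> those linear factors whose root \<open>z\<close> is not integral makes them
  reduce to a constant.\<close>

lemma reduction_roots:
  assumes "coeffs_in V Q" "map_poly red Q \<noteq> 0"
  shows "degree (map_poly red Q) = size {#z \<in># proots Q. z \<in> V#} \<and>
    (\<forall>c. order c (map_poly red Q) = size {#z \<in># proots Q. z \<in> V \<and> red z = c#})"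
  using assms
proof (induction "degree Q" arbitrary: Q)
  case 0
  then obtain a where Q: "Q = [:a:]" by (metis degree_eq_zeroE)
  have "map_poly red Q = [:red a:]" by (simp add: Q map_poly_hom_pCons[OF red_hom])
  moreover have "order c [:red a:] = 0" for c
    using 0 calculation by (intro order_0I) auto
  ultimately show ?case by (simp add: Q)
next
  case (Suc d)
  then have Q0: "Q \<noteq> 0" by auto
  obtain z where z: "poly Q z = 0"
    using Suc(2) fundamental_theorem_of_algebra[of Q] by (auto simp: constant_degree)
  define S where "S = synthetic_div Q z"
  have QS: "Q = [:- z, 1:] * S" using synthetic_div_correct'[of z Q] z by (simp add: S_def)
  have dS: "degree S = d" using Suc(2) by (simp add: S_def degree_synthetic_div)
  have S0: "S \<noteq> 0" using QS Q0 by auto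
  have pr: "proots Q = add_mset z (proots S)"
    unfolding QS using S0 by (subst proots_mult) auto
  show ?case
  proof (cases "z \<in> V")
    case True
    note SV = coeffs_in_cofactor(1)[OF valuation Suc(3) QS]
    have lin: "coeffs_in V [:- z, 1:]" using True by (simp add: coeffs_in_pCons coeffs_in_0[OF subring_V] VD)
    have red: "map_poly red Q = [:- red z, 1:] * map_poly red S"
      unfolding QS map_poly_hom_mult[OF red_hom lin SV]
      using True by (simp add: map_poly_hom_pCons[OF red_hom] redD)
    then have S1: "map_poly red S \<noteq> 0" using Suc(4) by auto
    note IH = Suc(1)[OF dS[symmetric] SV S1]
    have "degree (map_poly red Q) = Suc (degree (map_poly red S))"
      unfolding red using S1 by (subst degree_mult_eq) auto
    moreover have "order c (map_poly red Q) = (if c = red z then 1 else 0) + order c (map_poly red S)" for c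
      unfolding red using Suc(4) red by (subst order_mult) (auto simp: order_linear)
    ultimately show ?thesis using IH True by (auto simp: pr)
  next
    case False
    define w where "w = inverse z"
    have w: "w \<in> V" "red w = 0" using False inverse_V red_inverse by (auto simp: w_def)
    have z0: "z \<noteq> 0" using False VD by auto
    define T where "T = smult (- z) S"
    have QT: "Q = [:1, - w:] * T"
      unfolding QS T_def w_def using z0 by (simp add: smult_add_right)
    have TV: "coeffs_in V T"
      using coeffs_in_cofactor(2)[OF valuation Suc(3) QS] by (simp add: T_def coeffs_in_def VD)
    have lin: "coeffs_in V [:1, - w:]" using w by (simp add: coeffs_in_pCons coeffs_in_0[OF subring_V] VD)
    have red: "map_poly red Q = map_poly red T"
      unfolding QT map_poly_hom_mult[OF red_hom lin TV]
      using w by (simp add: map_poly_hom_pCons[OF red_hom] redD)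
    have dT: "degree T = d" "proots T = proots S" using z0 dS by (auto simp: T_def)
    note IH = Suc(1)[OF dT(1)[symmetric] TV Suc(4)[unfolded red]]
    show ?thesis using IH False by (simp add: red pr dT)
  qed
qed

lemma reduction_split_prod:
  assumes "finite A" "A \<subseteq> V"
  shows "coeffs_in V (\<Prod>x\<in>A. [:- x, 1:])"
    "map_poly red (\<Prod>x\<in>A. [:- x, 1:]) = (\<Prod>x\<in>A. [:- red x, 1:])"
proof -
  have "coeffs_in V (\<Prod>x\<in>A. [:- x, 1:]) \<and> 
      map_poly red (\<Prod>x\<in>A. [:- x, 1:]) = (\<Prod>x\<in>A. [:- red x, 1:])"
    using assms
  proof (induction A rule: finite_induct)
    case empty
    then show ?case by (auto simp: coeffs_in_def VD redD)
  next
    case (insert x A)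
    have lin: "coeffs_in V [:- x, 1:]" using insert by (simp add: coeffs_in_pCons coeffs_in_0[OF subring_V] VD)
    have "map_poly red ([:- x, 1:] * (\<Prod>x\<in>A. [:- x, 1:])) = 
        [:- red x, 1:] * map_poly red (\<Prod>x\<in>A. [:- x, 1:])"
      using insert lin by (subst map_poly_hom_mult[OF red_hom lin])
        (auto simp: map_poly_hom_pCons[OF red_hom] redD)
    then show ?case using insert coeffs_in_mult[OF subring_V lin] by simp
  qed
  then show "coeffs_in V (\<Prod>x\<in>A. [:- x, 1:])"
    "map_poly red (\<Prod>x\<in>A. [:- x, 1:]) = (\<Prod>x\<in>A. [:- red x, 1:])" by auto
qed

end

lemma dvd_prod_linear_cancel:
  fixes D :: "'a::field poly"
  assumes "finite A" "D dvd (\<Prod>x\<in>A. [:- f x, 1:])"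
  shows "D dvd (\<Prod>x | x \<in> A \<and> poly D (f x) = 0. [:- f x, 1:])"
proof -
  have step: "D dvd B" if "D dvd [:- c, 1:] * B" "poly D c \<noteq> 0" for c B
  proof -
    from that(1) obtain q where q: "[:- c, 1:] * B = D * q" ..
    have "poly D c * poly q c = poly ([:- c, 1:] * B) c" by (simp only: q poly_mult)
    then have "poly q c = 0" using that by simp
    then obtain q' where q': "q = [:- c, 1:] * q'" by (auto simp: poly_eq_0_iff_dvd dvd_def)
    then have "[:- c, 1:] * B = [:- c, 1:] * (D * q')" using q by (simp only: mult.left_commute)
    then have "B = D * q'" by (subst (asm) mult_cancel_left) auto
    then show ?thesis by simp
  qed
  have sub: "D dvd (\<Prod>x\<in>B. [:- f x, 1:])" if "C = A - B" "finite C" "B \<subseteq> A" "\<forall>x\<in>C. poly D (f x) \<noteq> 0" for B C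
    using that(2,1,3,4)
  proof (induction C arbitrary: B rule: finite_induct)
    case empty
    then show ?case using assms by (metis Diff_eq_empty_iff subset_antisym)
  next
    case (insert x C)
    have x: "x \<in> A" "x \<notin> B" using insert.prems(1) by auto
    have "C = A - insert x B" using insert.prems(1) insert.hyps(2) by blast
    then have "D dvd (\<Prod>x\<in>insert x B. [:- f x, 1:])"
      using insert.IH[of "insert x B"] insert.prems x by blast
    moreover have "finite B" using insert.prems(2) assms(1) by (rule finite_subset)
    moreover from this have "(\<Prod>x\<in>insert x B. [:- f x, 1:]) = [:- f x, 1:] * (\<Prod>x\<in>B. [:- f x, 1:])"
      using x(2) by (rule prod.insert)
    ultimately have "D dvd [:- f x, 1:] * (\<Prod>x\<in>B. [:- f x, 1:])" by metis
    then show ?case by (rule step) (use insert.prems(3) in blast)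
  qed
  show ?thesis
  proof (rule sub[OF refl])
    show "finite (A - {x \<in> A. poly D (f x) = 0})" using assms(1) by (rule finite_Diff)
  qed blast+
qed

lemma degree_prod_linear: "degree (\<Prod>x\<in>A. [:- f x, 1 :: 'a::field:]) = card A"
  by (cases "finite A") (auto simp: degree_prod_eq_sum_degree)

section \<open>Prime fields and kernels of evaluation maps\<close>

lemma of_int_prime_field:
  assumes "prime (card (UNIV :: 'f::{field,finite} set))"
  shows "(of_int i :: 'f) = 0 \<longleftrightarrow> int (card (UNIV :: 'f set)) dvd i" "\<exists>i. (of_int i :: 'f) = c"
proof -
  define p where "p = card (UNIV :: 'f set)"
  \<comment> \<open>Translation by 1 permutes the field, so the number of its elements is 0 in
    it.\<close>
  have "(\<Sum>x\<in>UNIV. x) = (\<Sum>x\<in>UNIV. x + 1 :: 'f)"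
    by (rule sum.reindex_bij_witness[of _ "\<lambda>x. x + 1" "\<lambda>x. x - 1"]) auto
  then have "of_nat p = (0 :: 'f)" by (simp add: sum.distrib p_def)
  then have "CHAR('f) dvd p" by (simp add: of_nat_eq_0_iff_char_dvd)
  moreover have "CHAR('f) \<noteq> 1" using of_nat_eq_0_iff_char_dvd[of 1, where 'a = 'f] by auto
  ultimately have C: "CHAR('f) = p" using assms unfolding p_def by (metis prime_nat_iff)
  then show "(of_int i :: 'f) = 0 \<longleftrightarrow> int (card (UNIV :: 'f set)) dvd i"
    by (simp add: of_int_eq_0_iff_char_dvd p_def)
  have "inj_on (of_nat :: nat \<Rightarrow> 'f) {..<p}"
  proof (rule inj_onI)
    fix i j assume ij: "i \<in> {..<p}" "j \<in> {..<p}" "(of_nat i :: 'f) = of_nat j"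
    then have "(of_int (int i - int j) :: 'f) = 0" by simp
    then have "int p dvd int i - int j" by (subst (asm) of_int_eq_0_iff_char_dvd) (simp add: C)
    then show "i = j" using ij(1,2) zdvd_not_zless[of "int i - int j" "int p"]
      zdvd_not_zless[of "int j - int i" "int p"] by (force simp: dvd_diff_commute)
  qed
  then have "card ((of_nat :: nat \<Rightarrow> 'f) ` {..<p}) = p" by (simp add: card_image)
  then have "(of_nat :: nat \<Rightarrow> 'f) ` {..<p} = UNIV"
    by (intro card_subset_eq) (auto simp: p_def)
  then obtain k where "c = of_nat k" by blast
  then have "of_int (int k) = c" by simp
  then show "\<exists>i. (of_int i :: 'f) = c" ..
qed

text \<open>Covers evaluation of rational polynomials at complex numbers (\<open>qev\<close>) and of
  polynomials over the prime field at residues (\<open>ev\<close>). The kernel is generated by a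
  minimal polynomial, irreducible because the target is a domain.\<close>

locale poly_eval =
  fixes ev :: "'k::field poly \<Rightarrow> 'r::idom"
  assumes ev_add: "ev (f + g) = ev f + ev g"
    and ev_mult: "ev (f * g) = ev f * ev g"
    and ev_1: "ev 1 = 1"
begin

lemma ev_smult: "ev (smult c f) = ev [:c:] * ev f"
  using ev_mult[of "[:c:]" f] by simp

lemma minimal_polynomial:
  assumes "h \<noteq> 0" "ev h = 0"
  obtains g where "lead_coeff g = 1" "irreducible g" "\<And>s. ev s = 0 \<longleftrightarrow> g dvd s"
proof -
  define P where "P g \<longleftrightarrow> g \<noteq> 0 \<and> ev g = 0" for g
  define g0 where "g0 = arg_min degree P"
  have g0: "P g0" unfolding g0_def by (rule arg_min_natI[of P h]) (use assms in \<open>simp add: P_def\<close>)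
  have min: "degree g0 \<le> degree g" if "P g" for g
    unfolding g0_def using that by (rule arg_min_nat_le)
  define g where "g = smult (inverse (lead_coeff g0)) g0"
  have lc: "lead_coeff g0 \<noteq> 0" using g0 by (simp add: P_def)
  have g: "P g" "degree g = degree g0" "lead_coeff g = 1"
    using g0 lc by (auto simp: P_def g_def ev_smult)
  have iff: "ev s = 0 \<longleftrightarrow> g dvd s" for s
  proof
    assume s: "ev s = 0"
    have "s = s div g * g + s mod g" by simp
    then have "ev s = ev (s div g) * ev g + ev (s mod g)" by (metis ev_add ev_mult)
    then have "ev (s mod g) = 0" using s g by (simp add: P_def)
    then have "s mod g = 0"
      using min[of "s mod g"] degree_mod_less'[of g s] g by (fastforce simp: P_def)
    then show "g dvd s" by auto
  qed (use g in \<open>auto simp: P_def ev_mult elim!: dvdE\<close>)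
  moreover have "irreducible g"
  proof (rule irreducibleI)
    show "g \<noteq> 0" using g by (simp add: P_def)
    show "\<not> g dvd 1" using iff[of 1] ev_1 by simp
    fix a b assume ab: "g = a * b"
    have unit: "y dvd 1" if "g = x * y" "ev x = 0" for x y
    proof -
      from iff that(2) have "g dvd x" by blast
      then obtain q where "x = g * q" ..
      then have "x * 1 = x * (y * q)" using that(1) by (simp add: mult.assoc)
      moreover have "x \<noteq> 0" using g(1) that(1) by (auto simp: P_def)
      ultimately have "1 = y * q" by (metis mult_cancel_left)
      then show ?thesis by (metis dvd_triv_left)
    qed
    have "ev a = 0 \<or> ev b = 0" using g(1) by (simp add: P_def ab ev_mult)
    then show "a dvd 1 \<or> b dvd 1" using unit[of a b] unit[of b a] ab by (auto simp: mult.commute)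
  qed
  ultimately show ?thesis using g(3) by (rule_tac that) 
qed

lemma irreducible_minimal:
  assumes "irreducible \<phi>" "ev \<phi> = 0"
  shows "ev s = 0 \<longleftrightarrow> \<phi> dvd s"
proof -
  obtain g where g: "irreducible g" "\<And>s. ev s = 0 \<longleftrightarrow> g dvd s"
    using minimal_polynomial[of \<phi>] assms by (metis not_irreducible_zero)
  then have "g dvd \<phi>" using assms by blast
  then have "\<phi> dvd g" using assms(1) g(1) by (metis irreducibleD' irreducible_not_unit)
  with \<open>g dvd \<phi>\<close> show ?thesis using g(2) by (meson dvd_trans)
qed

lemma irreducible_monic_unique:
  assumes "irreducible \<phi>" "ev \<phi> = 0" "lead_coeff \<phi> = 1"
    "irreducible \<psi>" "ev \<psi> = 0" "lead_coeff \<psi> = 1"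
  shows "\<phi> = \<psi>"
proof -
  have "\<phi> dvd \<psi>" "\<psi> dvd \<phi>" using irreducible_minimal assms by blast+
  then obtain k where k: "\<psi> = \<phi> * k" by (auto simp: dvd_def)
  have "\<phi> \<noteq> 0" "k \<noteq> 0" using assms k by auto
  have "degree \<phi> = degree \<psi>"
    using \<open>\<phi> dvd \<psi>\<close> \<open>\<psi> dvd \<phi>\<close> assms by (intro antisym dvd_imp_degree_le) auto
  then have "degree k = 0" using k degree_mult_eq[OF \<open>\<phi> \<noteq> 0\<close> \<open>k \<noteq> 0\<close>] by simp
  then obtain b where "k = [:b:]" by (metis degree_eq_zeroE)
  then have "lead_coeff \<psi> = lead_coeff \<phi> * b" using k by (simp add: lead_coeff_mult)
  then have "b = 1" using assms(3,6) by simp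
  then show ?thesis using k \<open>k = [:b:]\<close> by simp
qed

end

locale fplace = place V red for V and red :: "complex \<Rightarrow> 'r::field" +
  fixes Fp :: "'f::{field,finite} itself" and p :: nat
  assumes p_def: "p = card (UNIV :: 'f set)" and prime_p: "prime p" and red_p: "red (of_nat p) = 0"
begin

lemmas of_int_Fp = of_int_prime_field[where 'f = 'f, folded p_def, OF prime_p]

lemma red_of_int_eq_0_iff: "red (of_int i) = 0 \<longleftrightarrow> int p dvd i"
proof
  assume "int p dvd i"
  then obtain j where "i = int p * j" by blast
  then show "red (of_int i) = 0" using red_p by (simp add: redD VD)
next
  assume r: "red (of_int i) = 0"
  show "int p dvd i"
  proof (rule ccontr)
    assume "\<not> int p dvd i"
    then have "coprime (int p) i" using prime_p by (intro prime_imp_coprime) auto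
    then obtain x y where "x * int p + y * i = 1"
      using bezout_int[of "int p" i] by auto
    then have "red (of_int (x * int p + y * i)) = 1" by (simp add: redD)
    moreover have "red (of_int (x * int p + y * i)) = 0"
      using r red_p by (simp add: redD VD)
    ultimately show False by simp
  qed
qed

lemma unit_of_int_iff: "unit (of_int i) \<longleftrightarrow> \<not> int p dvd i"
  by (simp add: unit_def VD red_of_int_eq_0_iff)

text \<open>The embedding of the prime field into the residue field of \<open>V\<close>, which may
  be larger. Every element of \<open>'f\<close> is an integer, and \<open>emb_of_int\<close> shows
  that the chosen integer does not matter.\<close>

definition emb :: "'f \<Rightarrow> 'r" where
  "emb c = of_int (SOME i. of_int i = c)"

lemma emb_of_int: "emb (of_int i) = of_int i"
proof -
  define j where "j = (SOME j. (of_int j :: 'f) = of_int i)"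
  have "(of_int j :: 'f) = of_int i" unfolding j_def by (rule someI[of _ i]) simp
  then have "(of_int (j - i) :: 'f) = 0" by simp
  then have "red (of_int (j - i)) = 0" using of_int_Fp(1) red_of_int_eq_0_iff by blast
  then have "(of_int (j - i) :: 'r) = 0" unfolding redD(10) .
  then have "of_int j = (of_int i :: 'r)" by simp
  then show ?thesis by (simp add: j_def emb_def)
qed

lemma Fp_cases: obtains i where "c = (of_int i :: 'f)"
  using of_int_Fp(2) by metis

lemma ring_hom_on_emb: "ring_hom_on UNIV emb"
proof -
  have "emb 1 = 1" using emb_of_int[of 1] by simp
  moreover have "emb (x - y) = emb x - emb y" for x y
    using emb_of_int by (rule_tac Fp_cases[of x], rule_tac Fp_cases[of y]) (metis of_int_diff)
  moreover have "emb (x * y) = emb x * emb y" for x y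
    using emb_of_int by (rule_tac Fp_cases[of x], rule_tac Fp_cases[of y]) (metis of_int_mult)
  ultimately show ?thesis by (simp add: ring_hom_on_def)
qed

lemma emb_eq_0_iff [simp]: "emb c = 0 \<longleftrightarrow> c = 0"
proof -
  obtain i where i: "c = of_int i" by (rule Fp_cases)
  have "emb c = 0 \<longleftrightarrow> red (of_int i) = 0" by (simp add: i emb_of_int redD)
  then show ?thesis by (simp add: i of_int_Fp red_of_int_eq_0_iff)
qed

definition ev :: "'r \<Rightarrow> 'f poly \<Rightarrow> 'r" where
  "ev c g = poly (map_poly emb g) c"

lemma ev_simps [simp]:
  "ev c (g + h) = ev c g + ev c h" "ev c (g - h) = ev c g - ev c h" "ev c (g * h) = ev c g * ev c h"
  "ev c 0 = 0" "ev c (pCons d g) = emb d + c * ev c g"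
  by (simp_all add: ev_def map_poly_hom_add[OF ring_hom_on_emb] map_poly_hom_diff[OF ring_hom_on_emb]
      map_poly_hom_mult[OF ring_hom_on_emb] map_poly_hom_pCons[OF ring_hom_on_emb])

lemma ev_1 [simp]: "ev c 1 = 1"
  using ev_simps(5)[of c 1 0] ring_hom_onD(2)[OF ring_hom_on_emb] by (simp add: one_pCons)

lemma ev_dvd: "g dvd h \<Longrightarrow> ev c g = 0 \<Longrightarrow> ev c h = 0"
  by (auto elim!: dvdE)

lemma ev_int_poly: 
  assumes "z \<in> V" shows "ev (red z) (map_poly of_int s) = red (poly (map_poly of_int s) z)"
proof (induction s)
  case (pCons i s)
  have "poly (map_poly of_int s) z \<in> V"
    by (rule poly_in_subring[OF subring_V _ assms]) 
       (auto simp: coeffs_in_def coeff_map_poly VD)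
  then show ?case using pCons assms
    by (simp add: map_poly_hom_pCons[OF ring_hom_on_of_int] emb_of_int redD VD)
qed (simp add: redD)

lemma lift_poly: obtains s :: "int poly" where "map_poly of_int s = (g :: 'f poly)"
proof -
  define l where "l c = (if c = 0 then 0 else SOME i. of_int i = (c :: 'f))" for c
  have l: "of_int (l c) = c" for c
    using someI_ex[OF of_int_Fp(2)[of c]] by (auto simp: l_def)
  have "l 0 = 0" by (simp add: l_def)
  then have "map_poly of_int (map_poly l g) = g"
    by (intro poly_eqI) (simp add: coeff_map_poly l)
  then show ?thesis by (rule that)
qed

lemma poly_eval_ev: "poly_eval (ev c)"
  by unfold_locales simp_all

end

section \<open>Binomial coefficients with a prime power factor\<close>

text \<open>As \<open>0 < l < p ^ j\<close>, the factor \<open>l\<close> absorbs at most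
  \<open>j - 1\<close> of the \<open>k\<close> factors \<open>p\<close>.\<close>

lemma prime_power_dvd_cancel:
  fixes p :: nat
  assumes p: "prime p" and dvd: "p ^ k dvd l * c" and l: "0 < l" "l < p ^ j" and "j \<le> k"
  shows "p ^ Suc (k - j) dvd c"
proof -
  obtain m where m: "l = p ^ multiplicity p l * m" "\<not> p dvd m"
    using multiplicity_decompose'[of l p] l p by (metis not_prime_unit not_less_zero)
  define v where "v = multiplicity p l"
  have "p ^ v \<le> l" using m l unfolding v_def by (metis dvd_imp_le dvd_triv_left)
  then have "p ^ v < p ^ j" using l by linarith
  then have v: "v < j" using p by (metis prime_gt_1_nat power_less_imp_less_exp)
  have "p ^ k = p ^ v * p ^ (k - v)" using v \<open>j \<le> k\<close> by (simp flip: power_add)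
  moreover have "l * c = p ^ v * (m * c)" by (subst m(1)) (simp add: v_def mult.assoc)
  ultimately have "p ^ v * p ^ (k - v) dvd p ^ v * (m * c)" using dvd by metis
  then have "p ^ (k - v) dvd m * c" using p by (simp add: prime_gt_0_nat)
  moreover have "coprime (p ^ (k - v)) m"
    using m(2) p by (simp add: prime_imp_coprime)
  ultimately have "p ^ (k - v) dvd c" by (simp add: coprime_dvd_mult_right_iff)
  moreover have "Suc (k - j) \<le> k - v" using v \<open>j \<le> k\<close> by simp
  ultimately show ?thesis by (metis dvd_trans le_imp_power_dvd)
qed

context
  fixes p u k N :: nat
  assumes p: "prime p" and u: "\<not> p dvd u" and N: "N = u * p ^ k"
begin

lemma N_pos: "N > 0"
  using u p N by (auto intro!: Nat.gr0I simp: prime_gt_0_nat)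

lemma binomial_dvd:
  assumes "0 < l" "l < p ^ j" "j \<le> k"
  shows "p ^ Suc (k - j) dvd (N choose l)"
proof (rule prime_power_dvd_cancel[OF p _ assms])
  have "l * (N choose l) = N * ((N - 1) choose (l - 1))"
    using assms(1) by (simp add: times_binomial_minus1_eq)
  then show "p ^ k dvd l * (N choose l)" by (simp add: N)
qed

text \<open>Pascal's rule, with \<open>2 \<le> l\<close> keeping \<open>l - 1\<close> positive. For
  \<open>l = 1\<close> the coefficient is 1 modulo \<open>p ^ k\<close>; there
  \<open>taylor_1_V\<close> uses cancellation against \<open>a\<close>.\<close>

lemma binomial_Suc_dvd:
  assumes "2 \<le> l" "l < p ^ j" "j \<le> k"
  shows "p ^ Suc (k - j) dvd (Suc N choose l)"
proof -
  have l: "l = Suc (l - 1)" using assms(1) by simp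
  have "Suc N choose l = (N choose (l - 1)) + (N choose l)"
    by (subst l, subst binomial_Suc_Suc) (use assms(1) in simp)
  moreover have "p ^ Suc (k - j) dvd (N choose l)" "p ^ Suc (k - j) dvd (N choose (l - 1))"
    using assms binomial_dvd[of l j] binomial_dvd[of "l - 1" j] by simp_all
  ultimately show ?thesis by (metis dvd_add)
qed

text \<open>For \<open>0 < l < p ^ k\<close> the coefficient \<open>N choose l\<close> vanishes
  modulo \<open>p\<close>, so by Pascal's rule neighbouring coefficients of row \<open>N - 1\<close>
  are negatives of each other.\<close>

lemma binomial_pred_cong:
  assumes "l < p ^ k"
  shows "int p dvd int ((N - 1) choose l) - (- 1) ^ l"
  using assms
proof (induction l)
  case (Suc l)
  have "p ^ Suc (k - k) dvd (N choose Suc l)" using Suc by (intro binomial_dvd) auto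
  then have "int p dvd int (N choose Suc l)" by simp
  moreover have "N choose Suc l = ((N - 1) choose l) + ((N - 1) choose Suc l)"
    using N_pos by (cases N) auto
  ultimately have "int p dvd (int ((N - 1) choose l) + int ((N - 1) choose Suc l))" by simp
  moreover have "int p dvd int ((N - 1) choose l) - (- 1) ^ l" using Suc by simp
  ultimately have "int p dvd (int ((N - 1) choose l) + int ((N - 1) choose Suc l)) - 
    (int ((N - 1) choose l) - (- 1) ^ l)" by (rule dvd_diff)
  then show ?case by (simp add: algebra_simps)
qed auto

text \<open>These are the vertices of the Newton polygon. In
  \<open>p ^ j * (N choose p ^ j) = N * C\<close> the factor \<open>C\<close> is \<plusminus>1
  modulo \<open>p\<close>, and the other Pascal summand \<open>N choose (p ^ j - 1)\<close> is
  divisible by one more power of \<open>p\<close>.\<close>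

lemma binomial_Suc_exact:
  assumes "1 \<le> j" "j \<le> k"
  obtains c where "Suc N choose p ^ j = p ^ (k - j) * c" "\<not> p dvd c"
proof -
  have p1: "p > 1" using p by (rule prime_gt_1_nat)
  have pj: "p ^ j \<ge> p ^ 1" "p ^ j \<le> p ^ k" using assms p1 power_increasing[of 1 j p] power_increasing[of j k p] by simp_all
  define C where "C = (N - 1) choose (p ^ j - 1)"
  have C: "\<not> p dvd C"
  proof
    assume "p dvd C"
    then have "int p dvd int C" by simp
    moreover have "int p dvd int C - (- 1) ^ (p ^ j - 1)"
    proof (unfold C_def, rule binomial_pred_cong)
      have "p ^ j - 1 < p ^ j" using p1 by simp
      then show "p ^ j - 1 < p ^ k" using pj(2) by linarith
    qed
    ultimately have "int p dvd int C - (int C - (- 1) ^ (p ^ j - 1))" by (rule dvd_diff)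
    then have "int p dvd (- 1) ^ (p ^ j - 1)" by simp
    then have "int p dvd 1" by (auto simp: minus_one_power_iff split: if_splits)
    then show False using p1 by simp
  qed
  have "p ^ j * (N choose p ^ j) = N * C"
    using p1 by (simp add: times_binomial_minus1_eq C_def)
  also have "\<dots> = p ^ j * (p ^ (k - j) * (u * C))"
    using assms by (simp add: N mult_ac flip: power_add)
  finally have 1: "N choose p ^ j = p ^ (k - j) * (u * C)" using p1 by simp
  have "p ^ Suc (k - j) dvd (N choose (p ^ j - 1))"
    using pj p1 assms by (intro binomial_dvd) auto
  then obtain x where x: "N choose (p ^ j - 1) = p ^ Suc (k - j) * x" by (auto simp: dvd_def)
  have "Suc (p ^ j - 1) = p ^ j" using p1 by simp
  then have "Suc N choose p ^ j = (N choose (p ^ j - 1)) + (N choose p ^ j)"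
    by (metis binomial_Suc_Suc)
  also have "\<dots> = p ^ (k - j) * (p * x + u * C)" unfolding 1 x by (simp add: algebra_simps)
  finally have "Suc N choose p ^ j = p ^ (k - j) * (p * x + u * C)" .
  moreover have "\<not> p dvd p * x + u * C"
  proof -
    have "\<not> p dvd u * C" using C u p prime_dvd_multD by blast
    then show ?thesis by (metis dvd_add_right_iff dvd_triv_left)
  qed
  ultimately show ?thesis by (rule that)
qed

end

text \<open>With \<open>A = a ^ (p - 1)\<close> and \<open>M = 1 + p + \<dots> + p ^ (k - 1)\<close> the left side is
  \<open>a * (A ^ M - 1)\<close>, and the cofactor of \<open>A - 1\<close> in \<open>A ^ M - 1\<close> is congruent to \<open>M\<close>.\<close>

lemma power_prime_power_diff:
  fixes a :: int
  assumes p: "prime p" and a: "\<not> int p dvd a" "int p dvd a ^ (p - 1) - 1" and k: "k > 0"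
  obtains D where "a ^ (p ^ k) - a = (a ^ (p - 1) - 1) * D" "\<not> int p dvd D"
proof -
  define A where "A = a ^ (p - 1)"
  define M where "M = (\<Sum>i<k. p ^ i)"
  have p1: "p > 1" using p by (rule prime_gt_1_nat)
  have "(p - 1) * M = p ^ k - 1"
  proof -
    have "int ((p - 1) * M) = int p ^ k - 1"
      using p1 power_diff_1_eq[of "int p" k] by (simp add: M_def of_nat_diff)
    also have "\<dots> = int (p ^ k - 1)" using p1 by (simp add: of_nat_diff)
    finally show ?thesis by linarith
  qed
  then have "p ^ k = Suc ((p - 1) * M)" using p1 by simp
  then have "a ^ (p ^ k) = a * A ^ M" by (simp only: A_def power_mult power_Suc)
  then have "a ^ (p ^ k) - a = a * (A ^ M - 1)" by (simp add: algebra_simps)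
  also have "A ^ M - 1 = (A - 1) * (\<Sum>i<M. A ^ i)" by (rule power_diff_1_eq)
  finally have eq: "a ^ (p ^ k) - a = (a ^ (p - 1) - 1) * (a * (\<Sum>i<M. A ^ i))"
    by (simp add: A_def)
  have A1: "int p dvd A ^ i - 1" for i
    using a(2) unfolding power_diff_1_eq[of A i] A_def[symmetric] by simp
  have "int p dvd (\<Sum>i<M. A ^ i - 1)" using A1 by (intro dvd_sum) auto
  then have S: "int p dvd (\<Sum>i<M. A ^ i) - int M" by (simp add: sum_subtractf)
  have "M = 1 + p * (\<Sum>i<k-1. p ^ i)"
    using k by (cases k) (auto simp: M_def sum.lessThan_Suc_shift sum_distrib_left simp del: sum.lessThan_Suc)
  then have "\<not> p dvd M" using p1 by (metis dvd_add_left_iff dvd_triv_left nat_dvd_1_iff_1 less_irrefl)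
  then have M: "\<not> int p dvd int M" by (simp only: int_dvd_int_iff) simp
  have "\<not> int p dvd (\<Sum>i<M. A ^ i)"
    using dvd_diff[OF _ S, of "\<Sum>i<M. A ^ i"] M by auto
  then have "\<not> int p dvd a * (\<Sum>i<M. A ^ i)"
    using a(1) p by (simp add: prime_dvd_mult_iff)
  with eq show ?thesis by (rule that)
qed

section \<open>The Newton polygon of the trinomial\<close>

lemma card_filter_roots_le:
  fixes Q :: "complex poly"
  assumes "Q \<noteq> 0"
  shows "finite {z. poly Q z = 0 \<and> P z}" "card {z. poly Q z = 0 \<and> P z} \<le> size {#z \<in># proots Q. P z#}"
    "{z. poly Q z = 0 \<and> P z} \<noteq> {} \<longleftrightarrow> size {#z \<in># proots Q. P z#} > 0"
proof -
  have *: "{z. poly Q z = 0 \<and> P z} = set_mset {#z \<in># proots Q. P z#}" using assms by auto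
  show "finite {z. poly Q z = 0 \<and> P z}" unfolding * by simp
  show "card {z. poly Q z = 0 \<and> P z} \<le> size {#z \<in># proots Q. P z#}"
    unfolding * size_multiset_overloaded_eq by (subst card_eq_sum, rule sum_mono) (auto simp: Suc_le_eq)
  show "{z. poly Q z = 0 \<and> P z} \<noteq> {} \<longleftrightarrow> size {#z \<in># proots Q. P z#} > 0"
    unfolding * by (metis nonempty_has_size set_mset_eq_empty_iff)
qed

context place
begin

text \<open>The degree of the reduction counts the integral roots and its order at 0 those in the
  maximal ideal. The difference is the width of the horizontal side of the Newton polygon.\<close>

lemma size_unit_roots:
  assumes "coeffs_in V Q" "map_poly red Q \<noteq> 0"
  shows "size {#z \<in># proots Q. unit z#} = degree (map_poly red Q) - order 0 (map_poly red Q)"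
proof -
  have "{#z \<in># proots Q. z \<in> V#} = {#z \<in># proots Q. z \<in> V \<and> red z = 0#} + {#z \<in># proots Q. unit z#}"
    by (rule multiset_eqI) (auto simp: unit_def)
  then have "size {#z \<in># proots Q. z \<in> V#} = 
      size {#z \<in># proots Q. z \<in> V \<and> red z = 0#} + size {#z \<in># proots Q. unit z#}"
    by simp
  then show ?thesis using reduction_roots[OF assms] by auto
qed

end

text \<open>Side \<open>t\<close> of the polygon of \<open>F(\<omega> + y)\<close> starts at the
  point \<open>(p ^ (k - t), t)\<close> and goes left to abscissa \<open>p ^ (k - Suc t)\<close>, or
  to 0 if it is the last one, \<open>t = \<kappa> - 1\<close>. A drop of 1 over this width means
  that its roots \<open>y\<close> have valuation 1 divided by the width.\<close>

definition newton_width :: "nat \<Rightarrow> nat \<Rightarrow> nat \<Rightarrow> nat \<Rightarrow> nat" where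
  "newton_width p k \<kappa> t = (if Suc t < \<kappa> then p ^ (k - t) - p ^ (k - Suc t) else p ^ (k - t))"

text \<open>The side \<open>t = k\<close> exists only if \<open>\<kappa> = k + 1\<close>. It has width 1, but its slope is only bounded from
  below and may be infinite.\<close>

definition (in place) newton_class :: "nat \<Rightarrow> nat \<Rightarrow> nat \<Rightarrow> nat \<Rightarrow> complex \<Rightarrow> bool" where
  "newton_class p k \<kappa> t y \<longleftrightarrow>
     (if t = k then y / of_nat p \<in> V else unit (y ^ newton_width p k \<kappa> t / of_nat p))"

text \<open>Here \<open>\<kappa>\<close> is only a lower bound for both valuations. That
  \<open>F \<omega>\<close> has valuation exactly \<open>\<kappa>\<close> is assumed separately for
  each \<open>\<omega>\<close>, since it can depend on the residue of
  \<open>\<omega>\<close>.\<close>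

locale trinomial = fplace V red Fp p
  for V and red :: "complex \<Rightarrow> 'r::field" and Fp :: "'f::{field,finite} itself" and p :: nat +
  fixes n u k \<kappa> :: nat and a b :: int
  assumes odd_p: "odd p" and n: "n = Suc (u * p ^ k)" and k: "k > 0" and u: "\<not> p dvd u"
    and a: "\<not> int p dvd a"
    and \<kappa>: "\<kappa> > 0" "\<kappa> \<le> Suc k" "int p ^ \<kappa> dvd b" "int p ^ \<kappa> dvd a ^ (p - 1) - 1"
begin

lemma p_ge_3: "p \<ge> 3"
  using odd_p prime_ge_2_nat[OF prime_p] by (cases "p = 2") auto

lemma u_pos: "u > 0" using u by (auto intro: Nat.gr0I)

lemma width_pos: "t < \<kappa> \<Longrightarrow> newton_width p k \<kappa> t > 0"
  using p_ge_3 \<kappa>(2) by (auto simp: newton_width_def intro!: power_strict_increasing)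

lemma width_le: "newton_width p k \<kappa> t \<le> p ^ (k - t)"
  by (simp add: newton_width_def)

lemma power_split: "t < k \<Longrightarrow> p ^ (k - t) = p * p ^ (k - Suc t)"
  by (simp add: Suc_diff_Suc flip: power_Suc)

text \<open>This uses \<open>p \<ge> 3\<close>: with \<open>q = p ^ (k - Suc s)\<close> the wider
  side has width \<open>p * q - q > q\<close>, and the other at most \<open>q\<close>. For
  \<open>p = 2\<close> the last two widths would coincide.\<close>

lemma width_strict:
  assumes "s < t" "t < \<kappa>"
  shows "newton_width p k \<kappa> t < newton_width p k \<kappa> s"
proof -
  have t: "t \<le> k" using assms \<kappa>(2) by simp
  have "newton_width p k \<kappa> t \<le> p ^ (k - t)" by (rule width_le)
  also have "\<dots> \<le> p ^ (k - Suc s)" using assms t p_ge_3 by (intro power_increasing) auto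
  also have "\<dots> < p ^ (k - s) - p ^ (k - Suc s)"
  proof -
    have "p ^ (k - s) = p * p ^ (k - Suc s)" using assms t by (intro power_split) simp
    moreover have "3 * p ^ (k - Suc s) \<le> p * p ^ (k - Suc s)" using p_ge_3 by (rule mult_le_mono1)
    moreover have "p ^ (k - Suc s) > 0" using p_ge_3 by simp
    ultimately show ?thesis by linarith
  qed
  also have "\<dots> = newton_width p k \<kappa> s" using assms by (simp add: newton_width_def)
  finally show ?thesis .
qed

lemma of_nat_p: "of_nat p \<in> V" "\<not> unit (of_nat p)" "(of_nat p :: complex) \<noteq> 0"
  using red_p p_ge_3 by (auto simp: VD unit_def)

text \<open>The smaller width \<open>v\<close> makes \<open>y ^ v / p\<close> integral. Then
  \<open>y ^ w / p\<close> is this number times a positive power of the non-unit \<open>y\<close>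
  and cannot be a unit.\<close>

lemma newton_class_width_1:
  assumes "newton_class p k \<kappa> t y" "t < k" "newton_class p k \<kappa> s y" "t < s" "s < \<kappa>"
  shows False
proof -
  define w v where "w = newton_width p k \<kappa> t" "v = newton_width p k \<kappa> s"
  have wv: "v < w" "v > 0" using width_strict[of t s] width_pos[of s] assms by (auto simp: w_v_def)
  have w: "unit (y ^ w / of_nat p)" using assms by (simp add: newton_class_def w_v_def)
  have y: "red y = 0" "y \<in> V"
  proof -
    have "y ^ w = (y ^ w / of_nat p) * of_nat p" using of_nat_p by simp
    moreover have "y ^ w / of_nat p \<in> V" using w by (simp add: unit_def)
    ultimately have yw: "y ^ w \<in> V" "red (y ^ w) = 0"
      using VD(4)[OF _ of_nat_p(1)] redD(5)[OF _ of_nat_p(1)] red_p by (metis, metis mult_zero_right)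
    then show "y \<in> V" using power_in_V wv by (metis gr_zeroI not_less_zero)
    then show "red y = 0" using yw wv by (simp add: redD)
  qed
  have "y ^ v / of_nat p \<in> V"
  proof (cases "s = k")
    case True
    then have "y / of_nat p \<in> V" using assms by (simp add: newton_class_def)
    then have "y ^ (v - 1) * (y / of_nat p) \<in> V" using y by (intro VD)
    moreover have "y ^ v / of_nat p = y ^ (v - 1) * (y / of_nat p)"
      using wv by (cases v) auto
    ultimately show ?thesis by metis
  next
    case False
    then show ?thesis using assms by (simp add: newton_class_def w_v_def unit_def)
  qed
  moreover have "y ^ w / of_nat p = y ^ (w - v) * (y ^ v / of_nat p)"
    using wv by (simp flip: power_add)
  ultimately have "red (y ^ w / of_nat p) = red (y ^ (w - v)) * red (y ^ v / of_nat p)"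
    using redD(5)[of "y ^ (w - v)" "y ^ v / of_nat p"] y VD(7) by metis
  also have "red (y ^ (w - v)) = red y ^ (w - v)" using y by (simp add: redD)
  also have "\<dots> = 0" using y wv by simp
  finally show False using w by (simp add: unit_def)
qed

lemma newton_class_unique:
  assumes "newton_class p k \<kappa> t y" "newton_class p k \<kappa> s y" "t < \<kappa>" "s < \<kappa>"
  shows "t = s"
  using newton_class_width_1[of t y s] newton_class_width_1[of s y t] assms \<kappa>(2)
  by (meson less_Suc_eq_le linorder_neqE_nat order_less_le_trans)

lemma newton_class_mult_unit:
  assumes "unit v"
  shows "newton_class p k \<kappa> t (y * v) \<longleftrightarrow> newton_class p k \<kappa> t y"
proof -
  have eq: "y * v / of_nat p = y / of_nat p * v"
    "(y * v) ^ w / of_nat p = y ^ w / of_nat p * v ^ w" for w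
    by (simp_all add: power_mult_distrib)
  show ?thesis unfolding newton_class_def eq
    by (simp only: mult_unit_iff[OF assms] mult_unit_iff[OF unit_power[OF assms]])
qed

lemma newton_class_red:
  assumes "newton_class p k \<kappa> t y" "t < \<kappa>"
  shows "y \<in> V" "red y = 0"
proof -
  define w where "w = newton_width p k \<kappa> t"
  have w: "w > 0" using width_pos assms by (simp add: w_def)
  have *: "z * of_nat p \<in> V \<and> red (z * of_nat p) = 0" if "z \<in> V" for z
    using that of_nat_p red_p by (auto simp: VD redD)
  have "y \<in> V \<and> red y = 0"
  proof (cases "t = k")
    case True
    then show ?thesis using assms *[of "y / of_nat p"] of_nat_p by (simp add: newton_class_def)
  next
    case False
    then have "y ^ w / of_nat p \<in> V" using assms by (simp add: newton_class_def w_def unit_def)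
    then have yw: "y ^ w \<in> V" "red (y ^ w) = 0" using *[of "y ^ w / of_nat p"] of_nat_p by auto
    then have "y \<in> V" using power_in_V w by blast
    then show ?thesis using yw w by (simp add: redD)
  qed
  then show "y \<in> V" "red y = 0" by auto
qed

abbreviation F :: "complex \<Rightarrow> complex" where
  "F x \<equiv> x ^ n + of_int a * x + of_int b"

context
  fixes \<omega> :: complex
  assumes \<omega>: "\<omega> ^ u = - of_int a"
    and exact: "\<kappa> \<le> k \<Longrightarrow> unit (F \<omega> / of_nat p ^ \<kappa>)"
begin

lemma unit_omega: "unit \<omega>"
proof -
  have "unit (\<omega> ^ u)" using a unit_of_int_iff[of a] by (simp add: \<omega> unit_uminus)
  then show ?thesis using unit_power_iff u_pos by blast
qed

definition taylor :: "nat \<Rightarrow> complex" where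
  "taylor l = of_nat (n choose l) * \<omega> ^ (n - l) + 
     (if l = 0 then of_int a * \<omega> + of_int b else if l = 1 then of_int a else 0)"

lemma coeff_shift_scale:
  "coeff (pcompose (monom 1 n + monom (of_int a) 1 + monom (of_int b) 0) [:\<omega>, c:]) l = taylor l * c ^ l"
proof -
  have "coeff ([:\<omega>, c:] ^ n) l = of_nat (n choose l) * c ^ l * \<omega> ^ (n - l)"
  proof (cases "l \<le> n")
    case False
    have "degree ([:\<omega>, c:] ^ n) \<le> n" by (rule order_trans[OF degree_power_le]) simp
    then show ?thesis using False by (simp add: coeff_eq_0 binomial_eq_0)
  qed (rule coeff_linear_poly_power)
  moreover have "pcompose (monom 1 j) q = q ^ j" for q :: "complex poly" and j
    by (induction j) (simp_all add: monom_Suc pcompose_pCons pcompose_1)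
  moreover have "monom (of_int a) 1 = [:0, of_int a :: complex:]" "monom (of_int b) 0 = [:of_int b :: complex:]"
    by (simp_all add: monom_Suc monom_0)
  ultimately show ?thesis
    by (simp add: pcompose_add taylor_def pcompose_pCons coeff_pCons algebra_simps split: nat.splits)
qed

text \<open>Oddness of \<open>p\<close> pulls the sign out of \<open>(- a) ^ (p ^ k)\<close>, so
  that \<open>F \<omega>\<close> and the linear coefficient involve the small difference
  \<open>a - a ^ (p ^ k)\<close>.\<close>

lemma omega_power: "\<omega> ^ (u * p ^ k) = - of_int (a ^ (p ^ k))"
  using odd_p by (simp add: power_mult \<omega>)

lemma taylor_1: "taylor 1 = of_int (a - a ^ (p ^ k)) - of_nat (u * p ^ k) * of_int (a ^ (p ^ k))"
  unfolding taylor_def by (simp add: n omega_power algebra_simps)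

lemma F_omega: "taylor 0 = F \<omega>" "F \<omega> = \<omega> * of_int (a - a ^ (p ^ k)) + of_int b"
  unfolding taylor_def by (simp_all add: n omega_power algebra_simps)

lemma dvd_in_V: 
  assumes "int p ^ s dvd i" shows "of_int i / of_nat p ^ s \<in> V"
proof -
  obtain j where "i = int p ^ s * j" using assms by (auto simp: dvd_def)
  then have "of_int i / of_nat p ^ s = (of_int j :: complex)" using of_nat_p by simp
  then show ?thesis by (simp add: VD)
qed

lemma dvd_a: "s \<le> \<kappa> \<Longrightarrow> int p ^ s dvd a - a ^ (p ^ k)"
proof -
  assume s: "s \<le> \<kappa>"
  have 1: "int p ^ s dvd a ^ (p - 1) - 1" 
    using s \<kappa>(4) by (meson dvd_trans le_imp_power_dvd)
  have "int p dvd a ^ (p - 1) - 1" using \<kappa>(1,4) by (meson dvd_trans dvd_power)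
  from power_prime_power_diff[OF prime_p a this k] obtain D 
    where "a ^ (p ^ k) - a = (a ^ (p - 1) - 1) * D" by metis
  then have "int p ^ s dvd a ^ (p ^ k) - a" using 1 by simp
  then show ?thesis by (simp add: dvd_diff_commute)
qed

lemma taylor_0_V: "s \<le> \<kappa> \<Longrightarrow> taylor 0 / of_nat p ^ s \<in> V"
proof -
  assume s: "s \<le> \<kappa>"
  have "int p ^ s dvd b" using s \<kappa>(3) by (meson dvd_trans le_imp_power_dvd)
  from VD(6)[OF VD(4)[OF _ dvd_in_V[OF dvd_a[OF s]], of \<omega>] dvd_in_V[OF this]]
  show ?thesis using unit_omega unfolding F_omega by (simp add: unit_def add_divide_distrib)
qed

lemma taylor_1_V: 
  assumes "s \<le> \<kappa>" "s \<le> k" shows "taylor 1 / of_nat p ^ s \<in> V"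
proof -
  have "int p ^ s dvd int (u * p ^ k) * a ^ (p ^ k)"
    using assms(2) by (simp add: le_imp_power_dvd)
  then have "int p ^ s dvd (a - a ^ (p ^ k)) - int (u * p ^ k) * a ^ (p ^ k)"
    using dvd_a[OF assms(1)] by (rule dvd_diff[rotated])
  from dvd_in_V[OF this] show ?thesis unfolding taylor_1 by simp
qed

text \<open>For \<open>l \<ge> 2\<close> the binomial coefficient supplies the power of
  \<open>p\<close>. The bound by \<open>\<kappa>\<close> is for \<open>l = 1\<close>, where the
  divisibility of \<open>a - a ^ (p ^ k)\<close> is known only up to
  \<open>p ^ \<kappa>\<close>.\<close>

lemma taylor_V:
  assumes "l \<ge> 1" "l < p ^ j" "j \<le> k" "Suc (k - j) \<le> \<kappa>"
  shows "taylor l / of_nat p ^ Suc (k - j) \<in> V"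
proof (cases "l = 1")
  case True
  then have "j > 0" using assms by (auto intro: Nat.gr0I)
  then show ?thesis unfolding True using assms by (intro taylor_1_V) auto
next
  case False
  then have l: "l \<ge> 2" using assms by simp
  have "p ^ Suc (k - j) dvd (n choose l)"
    unfolding n by (rule binomial_Suc_dvd[OF prime_p u refl l assms(2,3)])
  then have "int p ^ Suc (k - j) dvd int (n choose l)" by (metis of_nat_dvd_iff of_nat_power)
  from VD(4)[OF dvd_in_V[OF this], of "\<omega> ^ (n - l)"] unit_omega l show ?thesis
    by (simp add: taylor_def unit_def VD)
qed

lemma taylor_in_V: "taylor l \<in> V"
  using unit_omega by (auto simp: taylor_def unit_def VD)

text \<open>Heights of the vertices. At \<open>j = 0\<close> the value
  \<open>\<kappa> = Suc k\<close> makes \<open>a - a ^ (p ^ k)\<close> divisible by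
  \<open>p ^ Suc k\<close>, so the term \<open>u * p ^ k * a ^ (p ^ k)\<close> alone decides the
  valuation.\<close>

lemma taylor_exact:
  assumes "j \<le> k" "j = 0 \<Longrightarrow> \<kappa> = Suc k"
  shows "unit (taylor (p ^ j) / of_nat p ^ (k - j))"
proof (cases "j = 0")
  case False
  then obtain c where c: "n choose p ^ j = p ^ (k - j) * c" "\<not> p dvd c"
    using binomial_Suc_exact[OF prime_p u refl, of j k] assms n by auto
  have "p ^ j > 1" using False p_ge_3 by (intro one_less_power) auto
  then have "taylor (p ^ j) / of_nat p ^ (k - j) = of_int (int c) * \<omega> ^ (n - p ^ j)"
    unfolding taylor_def c using of_nat_p by auto
  also have "unit \<dots>"
    using c(2) unit_omega by (intro unit_mult unit_power) (simp_all only: unit_of_int_iff int_dvd_int_iff not_False_eq_True)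
  finally show ?thesis .
next
  case True
  then have *: "\<kappa> = Suc k" using assms by simp
  from dvd_a[of \<kappa>] obtain d where d: "a - a ^ (p ^ k) = int p ^ Suc k * d" by (auto simp: * dvd_def)
  have "taylor 1 / of_nat p ^ k = of_int (int p * d - int u * a ^ (p ^ k))"
    unfolding taylor_1 d using of_nat_p by (simp add: field_simps)
  also have "unit \<dots>" unfolding unit_of_int_iff
  proof
    assume "int p dvd int p * d - int u * a ^ (p ^ k)"
    then obtain e where "int p * d - int u * a ^ (p ^ k) = int p * e" ..
    then have "int u * a ^ (p ^ k) = int p * (d - e)" by (simp add: algebra_simps)
    then have "int p dvd int u * a ^ (p ^ k)" by simp
    moreover have pp: "prime (int p)" using prime_p by simp
    ultimately have "int p dvd int u \<or> int p dvd a ^ (p ^ k)" by (metis prime_dvd_multD)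
    then show False using u a prime_dvd_power[OF pp] by auto
  qed
  finally show ?thesis using True by simp
qed

context
  fixes t :: nat and \<pi> :: complex
  assumes t: "t < \<kappa>" and \<pi>: "\<pi> ^ newton_width p k \<kappa> t = of_nat p"
begin

private abbreviation "r \<equiv> p ^ (k - t)"
private abbreviation "w \<equiv> newton_width p k \<kappa> t"

text \<open>Substituting \<open>\<pi> z\<close> for \<open>y\<close>, with \<open>\<pi>\<close> of
  valuation \<open>1 / w\<close>, tilts the polygon until side \<open>t\<close> is horizontal.
  Division by \<open>p ^ t * \<pi> ^ r\<close>, the size of the term at the right end of the side,
  moves it to height 0; its roots become unit roots if \<open>t \<noteq> k\<close>.\<close>

definition newton_poly :: "complex poly" where
  "newton_poly = smult (inverse (of_nat p ^ t * \<pi> ^ r))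
     (pcompose (monom 1 n + monom (of_int a) 1 + monom (of_int b) 0) [:\<omega>, \<pi>:])"

lemma t_le_k: "t \<le> k" using t \<kappa>(2) by simp

lemma pi: "\<pi> \<in> V" "red \<pi> = 0" "\<pi> \<noteq> 0"
proof -
  have *: "w > 0" using width_pos t by simp
  show "\<pi> \<noteq> 0" using \<pi> of_nat_p(3) * by (metis power_0_left less_irrefl)
  show V: "\<pi> \<in> V" using power_in_V[of \<pi> w] \<pi> * of_nat_p by simp
  have "red \<pi> ^ w = red (\<pi> ^ w)" using V by (simp add: redD)
  then show "red \<pi> = 0" using \<pi> red_p * by simp
qed

lemma coeff_newton: "coeff newton_poly l = taylor l * \<pi> ^ l / (of_nat p ^ t * \<pi> ^ r)"
  unfolding newton_poly_def coeff_smult coeff_shift_scale by (simp add: field_simps)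

lemma poly_newton: "poly newton_poly z = F (\<omega> + \<pi> * z) / (of_nat p ^ t * \<pi> ^ r)"
  unfolding newton_poly_def by (simp add: poly_pcompose poly_monom field_simps)

text \<open>Powers of \<open>p\<close> are converted into powers of \<open>\<pi>\<close>, so that only the inequality between the
  exponents remains to be checked.\<close>

lemma coeff_newton_max:
  assumes c: "taylor l / of_nat p ^ s \<in> V" and e: "w * t + r < w * s + l"
  shows "coeff newton_poly l \<in> V" "red (coeff newton_poly l) = 0"
proof -
  obtain e where e: "w * s + l = w * t + r + e" "e > 0"
    using e by (metis less_imp_add_positive)
  have "of_nat p ^ s * \<pi> ^ l = \<pi> ^ (w * s + l)" "of_nat p ^ t * \<pi> ^ r = \<pi> ^ (w * t + r)"
    by (simp_all add: power_add power_mult \<pi>)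
  then have 1: "of_nat p ^ s * \<pi> ^ l = of_nat p ^ t * \<pi> ^ r * \<pi> ^ e"
    by (simp only: e(1) power_add)
  have "coeff newton_poly l = taylor l / of_nat p ^ s * (of_nat p ^ s * \<pi> ^ l) / (of_nat p ^ t * \<pi> ^ r)"
    unfolding coeff_newton using of_nat_p by simp
  also have "\<dots> = taylor l / of_nat p ^ s * \<pi> ^ e"
    unfolding 1 using pi of_nat_p by simp
  finally have *: "coeff newton_poly l = taylor l / of_nat p ^ s * \<pi> ^ e" .
  show "coeff newton_poly l \<in> V" "red (coeff newton_poly l) = 0"
    unfolding * using VD(4)[OF c] redD(5)[OF c] VD(7)[OF pi(1)] redD(8)[OF pi(1)] pi(2) e(2) by simp_all
qed

lemma coeff_newton_eq:
  assumes "w * t + r = w * s + l"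
  shows "coeff newton_poly l = taylor l / of_nat p ^ s"
proof -
  have "of_nat p ^ s * \<pi> ^ l = \<pi> ^ (w * s + l)" "of_nat p ^ t * \<pi> ^ r = \<pi> ^ (w * t + r)"
    by (simp_all add: power_add power_mult \<pi>)
  then have 1: "of_nat p ^ t * \<pi> ^ r = of_nat p ^ s * \<pi> ^ l" using assms by simp
  show ?thesis unfolding coeff_newton 1 using pi of_nat_p by simp
qed

text \<open>To the right of \<open>r\<close> the known heights fall by 1 only when the abscissa
  grows by a factor \<open>p\<close>. After \<open>d > 0\<close> falls the abscissa is at least
  \<open>r * p ^ d \<ge> r * (d + 2)\<close>, and this exceeds \<open>w * d + r\<close> because
  \<open>w \<le> r\<close>.\<close>

lemma newton_right:
  assumes "l > r" shows "coeff newton_poly l \<in> V \<and> red (coeff newton_poly l) = 0"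
proof -
  have ex: "\<exists>d\<le>t. r * p ^ d \<le> l \<and> taylor l / of_nat p ^ (t - d) \<in> V"
  proof (cases "l \<ge> p ^ k")
    case True
    then show ?thesis using t_le_k taylor_in_V
      by (intro exI[of _ t]) (auto simp flip: power_add)
  next
    case False
    define j where "j = (LEAST j. l < p ^ j)"
    have lk: "l < p ^ k" using False by simp
    have j: "l < p ^ j" "j \<le> k" unfolding j_def
      using LeastI[of "\<lambda>j. l < p ^ j", OF lk] Least_le[of "\<lambda>j. l < p ^ j", OF lk] by blast+
    have "p ^ (k - t) < p ^ j" using assms j by simp
    then have kt: "k - t < j" by (rule power_less_imp_less_exp[rotated]) (use p_ge_3 in simp)
    then have "j - 1 < j" by simp
    then have jl: "p ^ (j - 1) \<le> l" unfolding j_def using not_less_Least not_le by blast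
    \<comment> \<open>\<open>p ^ (j - 1)\<close> is the largest power of \<open>p\<close> not
      exceeding \<open>l\<close>, and \<open>d\<close> is the excess of its exponent over that of
      \<open>r\<close>.\<close>
    define d where "d = j - 1 - (k - t)"
    have d: "d \<le> t" "t - d = Suc (k - j)" "k - t + d = j - 1" using kt j(2) t_le_k by (auto simp: d_def)
    have "r * p ^ d = p ^ (j - 1)" by (simp add: d flip: power_add)
    moreover have "taylor l / of_nat p ^ (t - d) \<in> V" unfolding d
      using assms j kt t t_le_k p_ge_3 by (intro taylor_V) (auto simp: d)
    ultimately show ?thesis using d jl by metis
  qed
  then obtain d where d: "d \<le> t" "r * p ^ d \<le> l" "taylor l / of_nat p ^ (t - d) \<in> V" by blast
  have "w * d + r < l"
  proof (cases "d = 0")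
    case False
    have "d + 2 \<le> p ^ d"
    proof -
      from False have "0 < d" by simp
      then have "d + 2 \<le> 3 ^ d" by (induction d rule: nat_induct_non_zero) auto
      also have "\<dots> \<le> p ^ d" using p_ge_3 by (rule power_mono) simp
      finally show ?thesis .
    qed
    then have "r * (d + 2) \<le> l" using d(2) by (meson le_trans mult_le_mono2)
    moreover have "w * d \<le> r * d" using width_le by (rule mult_le_mono1)
    moreover have "r > 0" using p_ge_3 by simp
    moreover have "r * (d + 2) = r * d + 2 * r" by (simp add: algebra_simps)
    ultimately show ?thesis by linarith
  qed (use assms in simp)
  moreover have "w * t = w * (t - d) + w * d" using d(1) by (simp flip: distrib_left)
  ultimately have "w * t + r < w * (t - d) + l" by simp
  from coeff_newton_max[OF d(3) this] show ?thesis by simp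
qed

lemma newton_top: "unit (coeff newton_poly r)"
proof -
  have "unit (taylor (p ^ (k - t)) / of_nat p ^ (k - (k - t)))"
    using t_le_k t \<kappa>(2) by (intro taylor_exact) auto
  then show ?thesis using t_le_k by (subst coeff_newton_eq[of t]) auto
qed

lemma newton_small_dvd:
  assumes "Suc t < \<kappa>" "l < p ^ (k - Suc t)"
  shows "taylor l / of_nat p ^ (t + 2) \<in> V"
proof (cases "l = 0")
  case True
  then show ?thesis using assms taylor_0_V[of "t + 2"] by simp
next
  case False
  have "k - Suc t > 0"
  proof (rule ccontr)
    assume "\<not> k - Suc t > 0"
    then have 0: "k - Suc t = 0" by simp
    show False using assms(2) False unfolding 0 by simp
  qed
  then have tk: "Suc (Suc t) \<le> k" by simp
  have *: "Suc (k - (k - Suc t)) = t + 2" using tk by simp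
  show ?thesis using taylor_V[of l "k - Suc t"] assms False unfolding * by simp
qed

lemma newton_mid_dvd:
  assumes "0 < l" "l < r"
  shows "taylor l / of_nat p ^ Suc t \<in> V"
proof -
  have "k - t > 0"
  proof (rule ccontr)
    assume "\<not> k - t > 0"
    then have 0: "k - t = 0" by simp
    show False using assms unfolding 0 by simp
  qed
  then have *: "Suc (k - (k - t)) = Suc t" by simp
  show ?thesis using taylor_V[of l "k - t"] assms t unfolding * by simp
qed

private abbreviation "l0 \<equiv> (if Suc t < \<kappa> then p ^ (k - Suc t) else 0)"

lemma w_l0: "w + l0 = r"
  unfolding newton_width_def using p_ge_3 t_le_k by (auto intro!: le_add_diff_inverse2 power_increasing)

lemma newton_left:
  assumes "l < l0"
  shows "coeff newton_poly l \<in> V \<and> red (coeff newton_poly l) = 0"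
proof -
  have t1: "Suc t < \<kappa>" "l < p ^ (k - Suc t)" using assms by (auto split: if_splits)
  have "t < k" using t1 \<kappa>(2) by simp
  have "3 * p ^ (k - Suc t) \<le> r" unfolding power_split[OF \<open>t < k\<close>] using p_ge_3 by (rule mult_le_mono1)
  moreover have "p ^ (k - Suc t) > 0" using p_ge_3 by simp
  \<comment> \<open>The line through side \<open>t\<close> has height
    \<open>t + r / w < t + 2\<close> at abscissa 0, so points of height at least
    \<open>t + 2\<close> left of the side lie strictly above it.\<close>
  ultimately have "r < 2 * w" using t1 by (simp add: newton_width_def)
  then have "w * t + r < w * (t + 2) + l" by (simp add: algebra_simps)
  from coeff_newton_max[OF newton_small_dvd[OF t1] this] show ?thesis by simp
qed

lemma newton_mid:
  assumes "l0 < l" "l < r"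
  shows "coeff newton_poly l \<in> V \<and> red (coeff newton_poly l) = 0"
proof -
  have "w * t + r < w * Suc t + l" using w_l0 assms by simp
  from coeff_newton_max[OF newton_mid_dvd this] assms show ?thesis by simp
qed

text \<open>For \<open>t = k\<close> the left end is at abscissa 0 with
  \<open>\<kappa> = Suc k\<close>, where \<open>F \<omega>\<close> may be more divisible or even 0.
  The last side for \<open>\<kappa> \<le> k\<close> is where \<open>exact\<close> enters.\<close>

lemma newton_bottom: "coeff newton_poly l0 \<in> V" "t \<noteq> k \<Longrightarrow> unit (coeff newton_poly l0)"
proof -
  have eq: "coeff newton_poly l0 = taylor l0 / of_nat p ^ Suc t"
    using w_l0 by (intro coeff_newton_eq) (simp only: mult_Suc_right add.assoc)
  show u: "unit (coeff newton_poly l0)" if "t \<noteq> k"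
  proof (cases "Suc t < \<kappa>")
    case True
    then have "t < k" using \<kappa>(2) by simp
    then have "unit (taylor (p ^ (k - Suc t)) / of_nat p ^ (k - (k - Suc t)))"
      using True \<kappa>(2) by (intro taylor_exact) auto
    then show ?thesis unfolding eq using True \<open>t < k\<close> by simp
  next
    case False
    then have "\<kappa> = Suc t" "\<kappa> \<le> k" using t t_le_k that by auto
    then show ?thesis unfolding eq using exact False by (simp add: F_omega(1))
  qed
  show "coeff newton_poly l0 \<in> V"
  proof (cases "t = k")
    case True
    then have "\<kappa> = Suc t" using t \<kappa>(2) by simp
    then show ?thesis unfolding eq using taylor_0_V[of "Suc t"] by simp
  qed (use u in \<open>simp add: unit_def\<close>)
qed

text \<open>Only the coefficients at the two ends of side \<open>t\<close> can survive reduction.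
  Degree \<open>r\<close> and order \<open>l0\<close> leave \<open>r - l0 = w\<close> unit roots
  when \<open>t \<noteq> k\<close>.\<close>

lemma newton_poly_reduction:
  shows "coeffs_in V newton_poly" "degree (map_poly red newton_poly) = r"
    "t \<noteq> k \<Longrightarrow> order 0 (map_poly red newton_poly) = l0" "map_poly red newton_poly \<noteq> 0"
proof -
  note cf = coeff_map_poly_hom[OF red_hom]
  show "coeffs_in V newton_poly" unfolding coeffs_in_def
  proof
    fix l
    show "coeff newton_poly l \<in> V"
      using newton_left[of l] newton_mid[of l] newton_right[of l] newton_bottom(1) newton_top
      unfolding unit_def by (metis linorder_neqE_nat)
  qed
  have top: "coeff (map_poly red newton_poly) r \<noteq> 0"
    using newton_top by (simp add: cf unit_def)
  then show n0: "map_poly red newton_poly \<noteq> 0" by auto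
  show "degree (map_poly red newton_poly) = r"
    by (intro antisym degree_le le_degree allI impI top) (use newton_right in \<open>simp add: cf\<close>)
  assume tk: "t \<noteq> k"
  have "monom 1 l0 dvd map_poly red newton_poly"
    unfolding monom_1_dvd_iff' cf using newton_left by blast
  moreover have "\<not> monom 1 (Suc l0) dvd map_poly red newton_poly"
    unfolding monom_1_dvd_iff' cf using newton_bottom(2)[OF tk] by (auto simp: unit_def)
  ultimately show "order 0 (map_poly red newton_poly) = l0"
    unfolding monom_1_dvd_iff[OF n0] by simp
qed

lemma newton_class_pi:
  "newton_class p k \<kappa> t (\<pi> * z) \<longleftrightarrow> (if t = k then z \<in> V else unit z)"
proof -
  have w: "w > 0" using width_pos t by simp
  have "(\<pi> * z) ^ w / of_nat p = z ^ w" using \<pi> of_nat_p(3) by (simp add: power_mult_distrib)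
  moreover have "\<pi> * z / of_nat p = z" if "t = k"
  proof -
    have "w = 1" using that t \<kappa>(2) by (simp add: newton_width_def)
    then have "\<pi> = of_nat p" using \<pi> by simp
    then show ?thesis using of_nat_p(3) by simp
  qed
  ultimately show ?thesis using unit_power_iff[OF w] by (simp add: newton_class_def)
qed

lemma newton_roots_pi:
  "finite {x. F x = 0 \<and> newton_class p k \<kappa> t (x - \<omega>)}"
  "card {x. F x = 0 \<and> newton_class p k \<kappa> t (x - \<omega>)} \<le> w"
  "{x. F x = 0 \<and> newton_class p k \<kappa> t (x - \<omega>)} \<noteq> {}"
proof -
  define P where "P = (\<lambda>z. if t = k then z \<in> V else unit z)"
  define Z where "Z = {z. poly newton_poly z = 0 \<and> P z}"
  have img: "{x. F x = 0 \<and> newton_class p k \<kappa> t (x - \<omega>)} = (\<lambda>z. \<omega> + \<pi> * z) ` Z"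
  proof (intro equalityI subsetI)
    fix x assume x: "x \<in> {x. F x = 0 \<and> newton_class p k \<kappa> t (x - \<omega>)}"
    define z where "z = (x - \<omega>) / \<pi>"
    have z: "x - \<omega> = \<pi> * z" "x = \<omega> + \<pi> * z" using pi by (simp_all add: z_def)
    have "z \<in> Z" using x newton_class_pi[of z] unfolding Z_def P_def poly_newton mem_Collect_eq z(1)
      by (simp flip: z(2))
    then show "x \<in> (\<lambda>z. \<omega> + \<pi> * z) ` Z" using z(2) by blast
  next
    fix x assume "x \<in> (\<lambda>z. \<omega> + \<pi> * z) ` Z"
    then show "x \<in> {x. F x = 0 \<and> newton_class p k \<kappa> t (x - \<omega>)}"
      using pi of_nat_p(3) newton_class_pi by (auto simp: Z_def P_def poly_newton)
  qed
  have n0: "newton_poly \<noteq> 0" using newton_poly_reduction(4) by auto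
  have "size {#z \<in># proots newton_poly. P z#} = w"
  proof (cases "t = k")
    case True
    \<comment> \<open>The reduction has degree 1, so there is exactly one integral root, whether or
      not it reduces to 0.\<close>
    have "w = 1" "r = 1" using True t \<kappa>(2) by (auto simp: newton_width_def)
    then show ?thesis using reduction_roots[OF newton_poly_reduction(1,4)] newton_poly_reduction(2) True
      by (simp add: P_def)
  next
    case False
    then show ?thesis using size_unit_roots[OF newton_poly_reduction(1,4)] w_l0
      unfolding newton_poly_reduction(2) newton_poly_reduction(3)[OF False] by (simp add: P_def)
  qed
  then have Z: "finite Z" "card Z \<le> w" "Z \<noteq> {}"
    using card_filter_roots_le[OF n0, of P] width_pos[OF t] by (auto simp: Z_def)
  then show "finite {x. F x = 0 \<and> newton_class p k \<kappa> t (x - \<omega>)}"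
    "card {x. F x = 0 \<and> newton_class p k \<kappa> t (x - \<omega>)} \<le> w"
    "{x. F x = 0 \<and> newton_class p k \<kappa> t (x - \<omega>)} \<noteq> {}"
    unfolding img by (auto intro: order_trans[OF card_image_le])
qed

end

lemma newton_roots:
  assumes "t < \<kappa>"
  shows "finite {x. F x = 0 \<and> newton_class p k \<kappa> t (x - \<omega>)}"
  "card {x. F x = 0 \<and> newton_class p k \<kappa> t (x - \<omega>)} \<le> newton_width p k \<kappa> t"
  "{x. F x = 0 \<and> newton_class p k \<kappa> t (x - \<omega>)} \<noteq> {}"
proof -
  obtain \<pi> :: complex where "\<pi> ^ newton_width p k \<kappa> t = of_nat p"
    using nth_root_exists[OF width_pos[OF assms]] by metis
  from newton_roots_pi[OF assms this] show
  "finite {x. F x = 0 \<and> newton_class p k \<kappa> t (x - \<omega>)}"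
  "card {x. F x = 0 \<and> newton_class p k \<kappa> t (x - \<omega>)} \<le> newton_width p k \<kappa> t"
  "{x. F x = 0 \<and> newton_class p k \<kappa> t (x - \<omega>)} \<noteq> {}" by auto
qed

end

end

section \<open>Number fields inside the complex numbers\<close>

definition iev :: "int poly \<Rightarrow> 'a::comm_ring_1 \<Rightarrow> 'a" where
  "iev s x = poly (map_poly of_int s) x"

definition qev :: "rat poly \<Rightarrow> 'a::field_char_0 \<Rightarrow> 'a" where
  "qev s x = poly (map_poly of_rat s) x"

lemma iev_simps [simp]:
  "iev (s + t) x = iev s x + iev t x" "iev (s - t) x = iev s x - iev t x" "iev (s * t) x = iev s x * iev t x"
  "iev 0 x = 0" "iev (pCons i s) x = of_int i + x * iev s x"
  by (simp_all add: iev_def map_poly_hom_add[OF ring_hom_on_of_int] map_poly_hom_diff[OF ring_hom_on_of_int]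
      map_poly_hom_mult[OF ring_hom_on_of_int] map_poly_hom_pCons[OF ring_hom_on_of_int])

lemma qev_simps [simp]:
  "qev (s + t) x = qev s x + qev t x" "qev (s - t) x = qev s x - qev t x" "qev (s * t) x = qev s x * qev t x"
  "qev 0 x = 0" "qev (pCons i s) x = of_rat i + x * qev s x"
  by (simp_all add: qev_def map_poly_hom_add[OF ring_hom_on_of_rat] map_poly_hom_diff[OF ring_hom_on_of_rat]
      map_poly_hom_mult[OF ring_hom_on_of_rat] map_poly_hom_pCons[OF ring_hom_on_of_rat])

lemma iev_1 [simp]: "iev 1 x = 1" and qev_1 [simp]: "qev 1 x = 1"
  by (simp_all add: one_pCons)

lemma iev_power [simp]: "iev (s ^ k) x = iev s x ^ k" and qev_power [simp]: "qev (r ^ k) x = qev r x ^ k"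
  by (induction k) simp_all

lemma qev_of_int_poly [simp]: "qev (map_poly of_int s) x = iev s x"
  by (induction s) (simp_all add: map_poly_hom_pCons[OF ring_hom_on_of_int])

lemma qev_pcompose: "qev (pcompose s t) x = qev s (qev t x)"
  by (induction s) (simp_all add: pcompose_pCons)

lemma iev_pcompose: "iev (pcompose s t) x = iev s (iev t x)"
  by (induction s) (simp_all add: pcompose_pCons)

lemma poly_eval_qev: "poly_eval (\<lambda>s. qev s x)"
  by unfold_locales simp_all

lemma irreducible_rat_rsquarefree:
  assumes "irreducible g"
  shows "rsquarefree (map_poly of_rat g :: complex poly)"
  unfolding rsquarefree_roots
proof (intro allI notI, elim conjE)
  fix x :: complex
  have pd: "pderiv (map_poly of_rat g :: complex poly) = map_poly of_rat (pderiv g)"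
    by (rule poly_eqI) (simp add: coeff_pderiv coeff_map_poly of_rat_mult del: of_nat_Suc)
  assume "poly (map_poly of_rat g) x = 0" "poly (pderiv (map_poly of_rat g)) x = 0"
  then have "qev g x = 0" "qev (pderiv g) x = 0" by (simp_all add: qev_def pd)
  then have "g dvd pderiv g"
    using poly_eval.irreducible_minimal[OF poly_eval_qev assms] by blast
  then have "degree g = 0" using not_dvd_pderiv by blast
  then obtain c where "g = [:c:]" by (metis degree_eq_zeroE)
  then show False using \<open>qev g x = 0\<close> assms by auto
qed

lemma finite_roots_rat: 
  assumes "g \<noteq> 0" shows "finite {x :: complex. qev g x = 0}"
  unfolding qev_def by (rule poly_roots_finite) (use assms in \<open>simp add: map_poly_eq_0_iff\<close>)

lemma is_subfieldD:
  assumes "is_subfield L"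
  shows "0 \<in> L" "1 \<in> L" "x \<in> L \<Longrightarrow> y \<in> L \<Longrightarrow> x + y \<in> L" "x \<in> L \<Longrightarrow> y \<in> L \<Longrightarrow> x * y \<in> L"
    "x \<in> L \<Longrightarrow> - x \<in> L" "x \<in> L \<Longrightarrow> inverse x \<in> L" "of_rat q \<in> L"
proof -
  show *: "0 \<in> L" "1 \<in> L" "\<And>x y. x \<in> L \<Longrightarrow> y \<in> L \<Longrightarrow> x + y \<in> L"
    "\<And>x y. x \<in> L \<Longrightarrow> y \<in> L \<Longrightarrow> x * y \<in> L"
    "\<And>x. x \<in> L \<Longrightarrow> - x \<in> L" "\<And>x. x \<in> L \<Longrightarrow> inverse x \<in> L"
    using assms by (auto simp: is_subfield_def)
  have nat: "of_nat k \<in> L" for k by (induction k) (auto simp: *)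
  have int: "of_int i \<in> L" for i by (cases i) (auto simp: * nat simp del: of_nat_Suc)
  obtain a b where "q = of_int a / of_int b" by (metis quotient_of_div surj_pair)
  then have "of_rat q = of_int a * inverse (of_int b :: complex)" 
    by (simp add: divide_inverse of_rat_mult of_rat_inverse)
  then show "of_rat q \<in> L" using int * by simp
qed

lemma is_subfield_rat_adjoin: "is_subfield (rat_adjoin x)"
  unfolding rat_adjoin_def is_subfield_def by blast

lemma qev_in_rat_adjoin: "qev r x \<in> rat_adjoin x"
proof -
  have x: "x \<in> rat_adjoin x" by (auto simp: rat_adjoin_def)
  show ?thesis by (induction r) (auto intro!: is_subfieldD[OF is_subfield_rat_adjoin] x)
qed

interpretation rat_complex: vector_space "\<lambda>q (x :: complex). of_rat q * x"
  by unfold_locales (simp_all add: of_rat_add of_rat_mult algebra_simps)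

text \<open>Dimension argument: the powers of \<open>qev r x\<close> up to exponent \<open>d\<close>
  lie in the rational span of the first \<open>d\<close> powers of \<open>x\<close>.\<close>

lemma algebraic_qev:
  fixes x :: complex
  assumes "f \<noteq> 0" "qev f x = 0"
  obtains c where "c \<noteq> 0" "qev c (qev r x) = 0"
proof -
  define d where "d = degree f"
  define T where "T = (\<lambda>i. x ^ i) ` {..<d}"
  define z where "z = qev r x"
  have span: "qev s x \<in> rat_complex.span T" for s
  proof -
    have "s = s div f * f + s mod f" by simp
    then have "qev s x = qev (s div f * f + s mod f) x" by simp
    also have "\<dots> = qev (s mod f) x" by (simp only: qev_simps assms mult_zero_right add_0)
    also have "\<dots> = (\<Sum>i<d. of_rat (coeff (s mod f) i) * x ^ i)"
    proof -
      have "d > 0"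
      proof (rule ccontr)
        assume "\<not> d > 0"
        then obtain c where "f = [:c:]" by (metis d_def degree_eq_zeroE gr0I)
        then show False using assms by simp
      qed
      then have "degree (map_poly of_rat (s mod f) :: complex poly) \<le> d - 1"
        using degree_mod_less'[of f s] assms(1) by (cases "s mod f = 0") 
          (fastforce simp: d_def degree_map_poly)+
      then have "qev (s mod f) x = (\<Sum>i\<le>d-1. coeff (map_poly of_rat (s mod f)) i * x ^ i)"
        unfolding qev_def by (rule poly_eq_sum_le)
      also have "{..d-1} = {..<d}" using \<open>d > 0\<close> by auto
      finally show ?thesis by (simp add: coeff_map_poly)
    qed
    also have "\<dots> \<in> rat_complex.span T"
      by (intro rat_complex.span_sum rat_complex.span_scale rat_complex.span_base) (auto simp: T_def)
    finally show ?thesis .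
  qed
  show ?thesis
  proof (cases "inj_on (\<lambda>i. z ^ i) {..d}")
    case True
    define S where "S = (\<lambda>i. z ^ i) ` {..d}"
    have card: "card S = Suc d" unfolding S_def by (subst card_image[OF True]) simp
    have "card T \<le> d" unfolding T_def using card_image_le[of "{..<d}"] by force
    moreover have "S \<subseteq> rat_complex.span T"
      unfolding S_def using span by (auto simp: z_def simp flip: qev_power)
    ultimately have "rat_complex.dependent S"
      using rat_complex.independent_span_bound[of T S] card by (fastforce simp: T_def)
    then obtain v where v: "\<exists>y\<in>S. v y \<noteq> 0" "(\<Sum>y\<in>S. of_rat (v y) * y) = 0"
      using rat_complex.dependent_finite[of S] by (auto simp: S_def)
    define c where "c = (\<Sum>i\<le>d. monom (v (z ^ i)) i)"
    have cf: "coeff c i = (if i \<le> d then v (z ^ i) else 0)" for i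
      by (simp add: c_def coeff_sum)
    have "c \<noteq> 0" using v(1) cf unfolding S_def by (auto simp: poly_eq_iff)
    moreover have "qev c z = 0"
    proof -
      have "degree c \<le> d" by (rule degree_le) (simp add: cf)
      then have "degree (map_poly of_rat c :: complex poly) \<le> d"
        by (rule order_trans[OF map_poly_degree_leq])
      then have "qev c z = (\<Sum>i\<le>d. coeff (map_poly of_rat c) i * z ^ i)"
        unfolding qev_def by (rule poly_eq_sum_le)
      also have "\<dots> = (\<Sum>i\<le>d. of_rat (v (z ^ i)) * z ^ i)"
        by (simp add: coeff_map_poly cf)
      also have "\<dots> = (\<Sum>y\<in>S. of_rat (v y) * y)"
        unfolding S_def by (subst sum.reindex[OF True]) simp
      finally show ?thesis using v by simp
    qed
    ultimately show ?thesis using that by (simp add: z_def)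
  next
    case False
    \<comment> \<open>Linear dependence concerns the set of powers, so two equal powers have to
      yield a relation directly.\<close>
    then obtain i j where ij: "i \<noteq> j" "z ^ i = z ^ j" by (auto simp: inj_on_def)
    define c where "c = monom (1 :: rat) i - monom 1 j"
    have "coeff c i = 1" using ij by (simp add: c_def)
    then have "c \<noteq> 0" by auto
    moreover have "qev c z = 0"
    proof -
      have "qev (monom 1 k) z = z ^ k" for k by (simp add: qev_def map_poly_monom poly_monom)
      then show ?thesis using ij by (simp add: c_def)
    qed
    ultimately show ?thesis using that by (simp add: z_def)
  qed
qed

lemma rat_adjoin_algebraic:
  assumes "irreducible f" "qev f x = 0" "y \<in> rat_adjoin x"
  obtains r where "y = qev r x"
proof -
  have "is_subfield {qev r x | r. True}"
    unfolding is_subfield_def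
  proof (intro conjI ballI)
    show "0 \<in> {qev r x | r. True}" "1 \<in> {qev r x | r. True}"
      by (metis (mono_tags, lifting) qev_simps(4) qev_1 mem_Collect_eq)+
    fix a assume "a \<in> {qev r x | r. True}"
    then obtain r where r: "a = qev r x" by blast
    have "- a = qev (0 - r) x" by (simp only: qev_simps r) simp
    then show "- a \<in> {qev r x | r. True}" by blast
    show "inverse a \<in> {qev r x | r. True}"
    proof (cases "a = 0")
      case False
      obtain c0 where "c0 \<noteq> 0" "qev c0 a = 0"
        using algebraic_qev[of f x r] assms r by (metis not_irreducible_zero)
      then obtain c where c: "irreducible c" "\<And>s. qev s a = 0 \<longleftrightarrow> c dvd s"
        using poly_eval.minimal_polynomial[OF poly_eval_qev] by metis
      \<comment> \<open>The inverse of \<open>a\<close> is read off \<open>d + a * e(a) = 0\<close>.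
        A zero \<open>d\<close> would make the minimal polynomial divide the shorter
        \<open>e\<close>.\<close>
      obtain d e where de: "c = pCons d e" by (cases c)
      have rel: "of_rat d + a * qev e a = 0" using c(2)[of c] by (simp add: de)
      have "d \<noteq> 0"
      proof
        assume "d = 0"
        then have "c dvd e" using rel False c(2) by simp
        moreover have "e \<noteq> 0" using c(1) by (auto simp: de \<open>d = 0\<close>)
        ultimately show False using dvd_imp_degree_le[of c e] by (simp add: de)
      qed
      then have "inverse a = of_rat (- inverse d) * qev e a"
      proof -
        define D :: complex where "D = of_rat d"
        have "D \<noteq> 0" "of_rat (- inverse d) = - inverse D" using \<open>d \<noteq> 0\<close>
          by (simp_all add: D_def of_rat_minus of_rat_inverse)
        moreover have "qev e a = - D / a" using rel False by (simp add: D_def field_simps eq_neg_iff_add_eq_0)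
        ultimately show ?thesis by (simp add: field_simps)
      qed
      also have "\<dots> = qev ([:- inverse d:] * pcompose e r) x" by (simp only: qev_pcompose r qev_simps mult_zero_right add_0_right)
      finally show ?thesis by blast
    qed (use r in auto)
    fix b assume "b \<in> {qev r x | r. True}"
    then obtain s where s: "b = qev s x" by blast
    have "a + b = qev (r + s) x" "a * b = qev (r * s) x" by (simp_all add: r s)
    then show "a + b \<in> {qev r x | r. True}" "a * b \<in> {qev r x | r. True}" by blast+
  qed
  moreover have "x = qev [:0, 1:] x" by simp
  then have "x \<in> {qev r x | r. True}" by blast
  ultimately have "y \<in> {qev r x | r. True}" using assms(3) unfolding rat_adjoin_def by blast
  then show ?thesis using that by blast
qed

lemma primitive_int_relation:
  assumes "c \<noteq> 0" "qev c z = (0 :: complex)"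
  obtains C where "content C = 1" "iev C z = 0"
proof -
  have "algebraic z" using assms
    by (intro algebraicI'[of "map_poly of_rat c"]) (auto simp: coeff_map_poly qev_def map_poly_eq_0_iff)
  then obtain C0 where C0: "C0 \<noteq> 0" "iev C0 z = 0" unfolding iev_def by (rule algebraicE') metis
  define C where "C = primitive_part C0"
  have "C0 = [:content C0:] * C" by (simp add: C_def)
  then have "iev C0 z = of_int (content C0) * iev C z"
    by (metis iev_simps(3,4,5) mult_zero_right add.right_neutral)
  then have "iev C z = 0" using C0 by (simp add: content_eq_zero_iff)
  moreover have "content C = 1" using C0 by (simp add: C_def)
  ultimately show ?thesis using that by blast
qed

text \<open>This includes non-integral \<open>z\<close>: every valuation ring contains
  \<open>z\<close> or \<open>inverse z\<close>, and \<open>coeffs_in_cofactor\<close> covers both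
  possibilities.\<close>

lemma algebraic_int_cofactor:
  fixes z :: complex
  assumes "map_poly of_int C = [:- z, 1:] * S"
  shows "algebraic_int (coeff S i)" "algebraic_int (z * coeff S i)"
proof -
  have "coeff S i \<in> V \<and> z * coeff S i \<in> V" if V: "valuation_ring V" for V :: "complex set"
  proof -
    have sub: "subring V" using V by (simp add: valuation_ring_def)
    have "coeffs_in V (map_poly of_int C)" 
      by (simp add: coeffs_in_def coeff_map_poly subring_of_int[OF sub])
    from coeffs_in_cofactor[OF V this assms] show ?thesis by (metis coeffs_in_def coeff_smult)
  qed
  then show "algebraic_int (coeff S i)" "algebraic_int (z * coeff S i)"
    by (auto simp: algebraic_int_iff_valuation_rings)
qed

text \<open>All roots of the rational minimal polynomial are integral, so its coefficients lie in
  every valuation ring. They are rational algebraic integers, hence integers.\<close>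

lemma algebraic_int_minimal_polynomial:
  fixes \<eta> :: complex
  assumes "algebraic_int \<eta>"
  obtains G :: "int poly" where "lead_coeff G = 1" "irreducible (map_poly of_int G :: rat poly)" "iev G \<eta> = 0"
proof -
  obtain G0 where G0: "iev G0 \<eta> = 0" "lead_coeff G0 = 1"
    using assms by (auto simp: algebraic_int_altdef_ipoly iev_def)
  then have "qev (map_poly of_int G0) \<eta> = 0" "map_poly of_int G0 \<noteq> (0 :: rat poly)"
    by (auto simp: map_poly_eq_0_iff)
  then obtain g where g: "lead_coeff g = 1" "irreducible g" "\<And>s. qev s \<eta> = 0 \<longleftrightarrow> g dvd s"
    using poly_eval.minimal_polynomial[OF poly_eval_qev] by metis
  have roots: "algebraic_int x" if "qev g x = 0" for x :: complex
  proof -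
    have "g dvd map_poly of_int G0" using g(3) G0 by (metis qev_of_int_poly)
    then have "qev (map_poly of_int G0) x = 0" using that by (auto elim!: dvdE simp del: qev_of_int_poly)
    then show ?thesis using G0(2) by (auto simp: algebraic_int_altdef_ipoly iev_def)
  qed
  have "coeff g i \<in> \<int>" for i
  proof -
    have prod: "map_poly of_rat g = (\<Prod>x | poly (map_poly of_rat g) x = 0. [:- x, 1 :: complex:])"
      using complex_poly_decompose_rsquarefree[OF irreducible_rat_rsquarefree[OF g(2)]] g(1)
      by (simp add: degree_map_poly coeff_map_poly)
    have "coeff (map_poly of_rat g :: complex poly) i \<in> V" if V: "valuation_ring V" for V
    proof -
      have sub: "subring V" using V by (simp add: valuation_ring_def)
      have "coeffs_in V (\<Prod>x\<in>A. [:- x, 1 :: complex:])" if "A \<subseteq> V" for A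
        using that
        by (induction A rule: infinite_finite_induct)
           (auto simp: coeffs_in_pCons coeffs_in_0[OF sub] subringD[OF sub] one_pCons simp del: mult_pCons_left
             intro!: coeffs_in_mult[OF sub])
      moreover have "{x. poly (map_poly of_rat g) x = 0} \<subseteq> V"
        using roots valuation_ring_algebraic_int[OF V] by (auto simp: qev_def)
      ultimately show ?thesis by (subst prod) (simp add: coeffs_in_def)
    qed
    then have "algebraic_int (of_rat (coeff g i) :: complex)"
      by (simp add: algebraic_int_iff_valuation_rings coeff_map_poly)
    then have "of_rat (coeff g i) \<in> (\<int> :: complex set)"
      by (rule rational_algebraic_int_is_int) simp
    then obtain j where "of_rat (coeff g i) = (of_int j :: complex)" by (auto elim: Ints_cases)
    then have "of_rat (coeff g i) = (of_rat (of_int j) :: complex)" by simp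
    then have "coeff g i = of_int j" by (subst (asm) of_rat_eq_iff)
    then show ?thesis by simp
  qed
  then have c: "of_int (floor (coeff g i)) = coeff g i" for i by (metis floor_of_int Ints_cases)
  define G where "G = map_poly floor g"
  have G: "map_poly of_int G = g"
    unfolding G_def by (rule poly_eqI) (simp add: coeff_map_poly c)
  moreover have "lead_coeff G = 1"
  proof -
    have "degree G = degree g" using G degree_map_poly[of "of_int :: int \<Rightarrow> rat" G] by auto
    then show ?thesis using g(1) by (simp add: G_def coeff_map_poly)
  qed
  moreover have "iev G \<eta> = 0" using g(3)[of g] unfolding G[symmetric] by simp
  ultimately show ?thesis using g(2) by (intro that[of G]) simp_all
qed

section \<open>Primes of a monogenic ring of integers\<close>

text \<open>\<open>integral\<close> states that \<int>[\<eta>] is integrally closed in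
  \<rat>(\<eta>); this is the form in which monogenicity is used. The roots of \<open>G\<close>
  stand for the embeddings of the field.\<close>

locale generator = fplace V red Fp p
  for V and red :: "complex \<Rightarrow> 'r::field" and Fp :: "'f::{field,finite} itself" and p :: nat +
  fixes \<eta> :: complex and G :: "int poly"
  assumes monic_G: "lead_coeff G = 1" and irreducible_G: "irreducible (map_poly of_int G :: rat poly)"
    and root_G: "iev G \<eta> = 0"
    and integral: "algebraic_int (qev r \<eta>) \<Longrightarrow> \<exists>s. qev r \<eta> = iev s \<eta>"
begin

definition conjugates :: "complex set" where
  "conjugates = {x. iev G x = 0}"

lemma conjugate_transfer:
  assumes "qev r \<eta> = 0" "x \<in> conjugates" shows "qev r x = 0"
proof -
  have "map_poly of_int G dvd r"
    using poly_eval.irreducible_minimal[OF poly_eval_qev irreducible_G, of \<eta>] root_G assms(1) by simp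
  then show ?thesis using assms(2) by (auto elim!: dvdE simp: conjugates_def)
qed

lemma conjugate_transfer_eq:
  assumes "qev r \<eta> = qev s \<eta>" "x \<in> conjugates" shows "qev r x = qev s x"
  using conjugate_transfer[OF _ assms(2), of "r - s"] assms(1) by simp

lemma conjugates_V: "x \<in> conjugates \<Longrightarrow> x \<in> V"
  using monic_G by (intro algebraic_int_V) (auto simp: algebraic_int_altdef_ipoly conjugates_def iev_def)

lemma G_nonzero: "(map_poly of_int G :: rat poly) \<noteq> 0"
  using irreducible_G by auto

lemma finite_conjugates: "finite conjugates"
  using finite_roots_rat[OF G_nonzero] by (simp add: conjugates_def)

lemma G_prod: "map_poly of_int G = (\<Prod>x\<in>conjugates. [:- x, 1 :: complex:])"
proof -
  have eq: "map_poly of_rat (map_poly of_int G) = (map_poly of_int G :: complex poly)"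
    by (rule poly_eqI) (simp add: coeff_map_poly)
  have "lead_coeff (map_poly of_int G :: complex poly) = 1"
    using monic_G by (simp add: degree_map_poly coeff_map_poly)
  then show ?thesis
    using complex_poly_decompose_rsquarefree[OF irreducible_rat_rsquarefree[OF irreducible_G]]
    unfolding eq by (simp add: conjugates_def iev_def)
qed

lemma iev_V: "x \<in> V \<Longrightarrow> iev s x \<in> V"
  unfolding iev_def by (rule poly_in_subring[OF subring_V]) (auto simp: coeffs_in_def coeff_map_poly VD)

lemma ev_red: "x \<in> V \<Longrightarrow> ev (red x) (map_poly of_int s) = red (iev s x)"
  unfolding iev_def by (rule ev_int_poly)

lemma ev_red_dvd:
  assumes "irreducible \<gamma>" "x \<in> V" "ev (red x) \<gamma> = 0"
  shows "red (iev s x) = 0 \<longleftrightarrow> \<gamma> dvd map_poly of_int s"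
  using poly_eval.irreducible_minimal[OF poly_eval_ev assms(1,3)] ev_red[OF assms(2)] by metis

text \<open>A primitive integral relation for \<open>z = r(\<eta>)\<close> yields elements \<open>B\<^sub>j\<close> and \<open>z B\<^sub>j\<close> of
  \<open>\<int>[\<eta>]\<close> that generate the unit ideal locally at \<open>p\<close>, so \<open>z\<close> is a quotient of two of them.\<close>

lemma fraction_representation:
  "\<exists>B B'. \<forall>x\<in>conjugates. (\<forall>j :: nat. iev (B j) x * qev r x = iev (B' j) x) \<and>
     (\<exists>j. unit (iev (B j) x) \<or> unit (iev (B' j) x))"
proof -
  define z where "z = qev r \<eta>"
  have "qev (map_poly of_int G) \<eta> = 0" using root_G by simp
  then obtain c where c: "c \<noteq> 0" "qev c z = 0" unfolding z_def by (rule algebraic_qev[OF G_nonzero])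
  then obtain C where C: "content C = 1" "iev C z = 0" by (rule primitive_int_relation)
  define S where "S = synthetic_div (map_poly of_int C) z"
  have CS: "map_poly of_int C = [:- z, 1:] * S"
    using synthetic_div_correct'[of z "map_poly of_int C"] C(2) by (simp add: S_def iev_def)
  have ai: "algebraic_int (coeff S j)" "algebraic_int (z * coeff S j)" for j
    using algebraic_int_cofactor[OF CS] by auto
  have zC: "coeff (map_poly of_int C :: complex poly) j = of_int (coeff C j)" for j
    by (simp add: coeff_map_poly)
  have rel: "of_int (coeff C j) = (if j = 0 then 0 else coeff S (j - 1)) - z * coeff S j" for j
    unfolding zC[symmetric] CS by (cases j) auto
  have Sq: "\<exists>s. coeff S j = qev s \<eta>" for j
  proof -
    \<comment> \<open>Descending induction: above the degree the coefficient is 0, and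
      \<open>rel\<close> obtains each lower coefficient from the next higher one.\<close>
    have "\<exists>s. coeff S (N - i) = qev s \<eta>" if "N > degree S" for i N
    proof (induction i)
      case 0
      have "coeff S N = qev 0 \<eta>" using that by (simp add: coeff_eq_0)
      then show ?case by (metis diff_zero)
    next
      case (Suc i)
      then obtain s where s: "coeff S (N - i) = qev s \<eta>" by blast
      show ?case
      proof (cases "N - i = 0")
        case True
        then have "N - Suc i = N - i" by simp
          then show ?thesis using s by metis
      next
        case False
        then have "N - Suc i = N - i - 1" by simp
        then have "coeff S (N - Suc i) = of_int (coeff C (N - i)) + z * coeff S (N - i)"
          using rel[of "N - i"] False by simp
        also have "\<dots> = qev ([:of_int (coeff C (N - i)):] + r * s) \<eta>" by (simp add: s z_def)
        finally show ?thesis by blast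
      qed
    qed
    from this[of "Suc (j + degree S)" "Suc (degree S)"] show ?thesis by simp
  qed
  have "\<exists>b. coeff S j = iev b \<eta>" "\<exists>b. z * coeff S j = iev b \<eta>" for j
  proof -
    from Sq obtain s where s: "coeff S j = qev s \<eta>" by blast
    then show "\<exists>b. coeff S j = iev b \<eta>" using integral ai by metis
    have "z * coeff S j = qev (r * s) \<eta>" by (simp add: s z_def)
    then show "\<exists>b. z * coeff S j = iev b \<eta>" using integral ai by metis
  qed
  then obtain B B' where B: "\<And>j. coeff S j = iev (B j) \<eta>" "\<And>j. z * coeff S j = iev (B' j) \<eta>" by metis
  have 1: "iev (B j) x * qev r x = iev (B' j) x" if x: "x \<in> conjugates" for j x
  proof -
    have "qev (map_poly of_int (B j) * r) \<eta> = qev (map_poly of_int (B' j)) \<eta>"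
      using B[of j] by (simp add: z_def mult.commute)
    from conjugate_transfer_eq[OF this x] show ?thesis by simp
  qed
  have 2: "of_int (coeff C j) = (if j = 0 then 0 else iev (B (j - 1)) x) - iev (B' j) x"
    if x: "x \<in> conjugates" for j x
  proof -
    have "qev [:of_int (coeff C j):] \<eta> = 
        qev (map_poly of_int ((if j = 0 then 0 else B (j - 1)) - B' j)) \<eta>"
      unfolding qev_of_int_poly using rel[of j] B by simp
    from conjugate_transfer_eq[OF this x] show ?thesis unfolding qev_of_int_poly by simp
  qed
  have 3: "\<exists>j. unit (iev (B j) x) \<or> unit (iev (B' j) x)" if x: "x \<in> conjugates" for x
  proof (rule ccontr)
    assume "\<not> ?thesis"
    then have 0: "red (iev (B j) x) = 0" "red (iev (B' j) x) = 0" for j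
      using iev_V[OF conjugates_V[OF x]] by (auto simp: unit_def)
    \<comment> \<open>If all numerators and denominators reduced to 0, then so would every
      coefficient of \<open>C\<close>, against \<open>content C = 1\<close>.\<close>
    have "red (of_int (coeff C j)) = 0" for j
      unfolding 2[OF x] using 0 iev_V[OF conjugates_V[OF x]] by (simp add: redD VD)
    then have "\<And>j. int p dvd coeff C j" by (simp add: red_of_int_eq_0_iff)
    then have "[:int p:] dvd C" by (simp add: const_poly_dvd_iff)
    then have "int p dvd 1" using C(1) by (simp only: const_poly_dvd_iff_dvd_content)
    then show False using prime_p by simp
  qed
  show ?thesis using 1 3 by blast
qed

context
  fixes \<gamma> :: "'f poly" and x y :: complex
  assumes \<gamma>: "irreducible \<gamma>" and x: "x \<in> conjugates" "ev (red x) \<gamma> = 0"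
    and y: "y \<in> conjugates" "ev (red y) \<gamma> = 0"
begin

lemma same_center_iev: "red (iev s x) = 0 \<longleftrightarrow> red (iev s y) = 0"
  using ev_red_dvd[OF \<gamma> conjugates_V x(2)] ev_red_dvd[OF \<gamma> conjugates_V y(2)] x y by blast

text \<open>Conjugates reducing to roots of one \<open>\<gamma>\<close> give the same prime of
  \<int>[\<eta>]. By \<open>fraction_representation\<close>, integrality of any element of the field
  is decided by units of \<int>[\<eta>], hence by divisibility by \<open>\<gamma>\<close>. So the
  two embeddings also pull \<open>V\<close> back to the same ring.\<close>

lemma same_center:
  "qev r x \<in> V \<longleftrightarrow> qev r y \<in> V" "unit (qev r x) \<longleftrightarrow> unit (qev r y)"
proof -
  from fraction_representation[of r] obtain B B' where
    *: "\<forall>x\<in>conjugates. (\<forall>j :: nat. iev (B j) x * qev r x = iev (B' j) x) \<and>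
      (\<exists>j. unit (iev (B j) x) \<or> unit (iev (B' j) x))"
    by (elim exE)
  have B: "iev (B j) x * qev r x = iev (B' j) x" "\<exists>j. unit (iev (B j) x) \<or> unit (iev (B' j) x)"
    if "x \<in> conjugates" for j x using bspec[OF * that] by blast+
  have V: "iev s x \<in> V" "iev s y \<in> V" for s using iev_V conjugates_V x y by auto
  have unit_iff: "unit (iev s x) \<longleftrightarrow> unit (iev s y)" for s
    using same_center_iev V by (simp add: unit_def)
  obtain j where j: "unit (iev (B j) x) \<or> unit (iev (B' j) x)" using B(2) x by blast
  have "(qev r x \<in> V \<longleftrightarrow> qev r y \<in> V) \<and> (unit (qev r x) \<longleftrightarrow> unit (qev r y))"
  proof (cases "unit (iev (B j) x)")
    case True
    then have "unit (iev (B j) y)" using unit_iff by blast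
    then have "qev r x * iev (B j) x = iev (B' j) x" "qev r y * iev (B j) y = iev (B' j) y"
      using B(1) x y by (simp_all add: mult.commute)
    then show ?thesis using mult_unit_iff[OF True] mult_unit_iff[OF \<open>unit (iev (B j) y)\<close>] V unit_iff
      by metis
  next
    case False
    \<comment> \<open>A unit numerator over a non-unit denominator cannot be integral.\<close>
    have *: "qev r w \<notin> V" if w: "w \<in> conjugates" "\<not> unit (iev (B j) w)" "unit (iev (B' j) w)" for w
    proof
      assume "qev r w \<in> V"
      moreover have "iev (B j) w \<in> V" using iev_V conjugates_V w by blast
      ultimately have "red (iev (B' j) w) = red (iev (B j) w) * red (qev r w)"
        using B(1)[OF w(1), of j, symmetric] by (simp add: redD)
      then show False using w \<open>iev (B j) w \<in> V\<close> by (auto simp: unit_def)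
    qed
    then have xB: "unit (iev (B' j) x)" using j False by blast
    then have "qev r x \<notin> V" "qev r y \<notin> V"
      using *[OF x(1) False] *[OF y(1)] False unit_iff by blast+
    then show ?thesis by (simp add: unit_def)
  qed
  then show "qev r x \<in> V \<longleftrightarrow> qev r y \<in> V" "unit (qev r x) \<longleftrightarrow> unit (qev r y)" by auto
qed

end

end

section \<open>Residue degrees and ramification, by counting\<close>

definition polys_below :: "nat \<Rightarrow> 'a::zero poly set" where
  "polys_below m = {g. \<forall>i\<ge>m. coeff g i = 0}"

lemma polys_below_iff: "m > 0 \<Longrightarrow> g \<in> polys_below m \<longleftrightarrow> degree g < m"
  unfolding polys_below_def by (auto simp: coeff_eq_0) (metis leading_coeff_0_iff not_le degree_0)

lemma card_polys_below:
  "finite (polys_below m :: 'a::{zero,finite} poly set)"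
  "card (polys_below m :: 'a poly set) = card (UNIV :: 'a set) ^ m"
proof -
  have "finite (polys_below m :: 'a poly set) \<and> card (polys_below m :: 'a poly set) = card (UNIV :: 'a set) ^ m"
  proof (induction m)
    case 0
    have "polys_below 0 = {0 :: 'a poly}" by (auto simp: polys_below_def poly_eq_iff)
    then show ?case by simp
  next
    case (Suc m)
    have eq: "polys_below (Suc m) = (\<lambda>(c, g). pCons c g) ` (UNIV \<times> (polys_below m :: 'a poly set))"
    proof (intro equalityI subsetI)
      fix g :: "'a poly" assume g: "g \<in> polys_below (Suc m)"
      obtain c h where ch: "g = pCons c h" by (cases g)
      have "coeff h i = 0" if "i \<ge> m" for i
        using g that unfolding polys_below_def ch mem_Collect_eq by (metis Suc_le_mono coeff_pCons_Suc)
      then show "g \<in> (\<lambda>(c, g). pCons c g) ` (UNIV \<times> polys_below m)"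
        by (auto simp: ch polys_below_def)
    qed (auto simp: polys_below_def coeff_pCons split: nat.splits)
    have "inj_on (\<lambda>(c, g). pCons c g) (UNIV \<times> (polys_below m :: 'a poly set))"
      by (auto simp: inj_on_def)
    then show ?case unfolding eq using Suc by (simp add: card_image card_cartesian_product)
  qed
  then show "finite (polys_below m :: 'a poly set)"
    "card (polys_below m :: 'a poly set) = card (UNIV :: 'a set) ^ m" by auto
qed

lemma dvd_power_exact:
  fixes P Q :: "'a::field poly"
  assumes "P \<noteq> 0" "degree Q > 0"
  obtains E R where "P = Q ^ E * R" "\<not> Q dvd R"
proof -
  have "\<exists>E R. P = Q ^ E * R \<and> \<not> Q dvd R"
    using assms(1)
  proof (induction "degree P" arbitrary: P rule: less_induct)
    case less
    show ?case
    proof (cases "Q dvd P")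
      case True
      then obtain S where S: "P = Q * S" ..
      then have "S \<noteq> 0" "Q \<noteq> 0" using less by auto
      then have "degree S < degree P" using S assms(2) by (simp add: degree_mult_eq)
      then obtain E R where "S = Q ^ E * R" "\<not> Q dvd R" using less(1) \<open>S \<noteq> 0\<close> by blast
      then have "P = Q ^ Suc E * R" using S by (simp add: mult.assoc)
      then show ?thesis using \<open>\<not> Q dvd R\<close> by blast
    next
      case False
      then show ?thesis by (intro exI[of _ 0] exI[of _ P]) simp
    qed
  qed
  then show ?thesis using that by blast
qed

context generator
begin

text \<open>Comparison of sizes of residue fields. \<open>N\<close> sends \<open>r\<close> to a
  representative modulo \<open>\<gamma>\<close> of the value of \<open>r\<close> at the reduction of
  \<open>iev t x\<close>. It is injective below \<open>degree \<phi>\<close>, so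
  \<open>p ^ degree \<phi> \<le> p ^ degree \<gamma>\<close>.\<close>

lemma degree_residue_le:
  assumes x: "x \<in> V" and \<gamma>: "irreducible \<gamma>" "ev (red x) \<gamma> = 0"
    and \<phi>: "irreducible \<phi>" "ev (red (iev t x)) \<phi> = 0"
  shows "degree \<phi> \<le> degree \<gamma>"
proof -
  have pos: "degree g > 0" if "irreducible g" "ev c g = 0" for g c
  proof (rule ccontr)
    assume "\<not> degree g > 0"
    then obtain d where "g = [:d:]" by (metis degree_eq_zeroE gr0I)
    then show False using that by auto
  qed
  have tx: "iev t x \<in> V" by (rule iev_V[OF x])
  define L where "L r = (SOME s :: int poly. map_poly of_int s = (r :: 'f poly))" for r
  have L: "map_poly of_int (L r) = r" for r
    unfolding L_def by (rule someI_ex) (metis lift_poly)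
  define N where "N r = map_poly of_int (pcompose (L r) t) mod \<gamma>" for r
  have evN: "ev (red x) (N r) = ev (red (iev t x)) r" for r
  proof -
    define P :: "'f poly" where "P = map_poly of_int (pcompose (L r) t)"
    have "P = P div \<gamma> * \<gamma> + P mod \<gamma>" by simp
    then have "ev (red x) P = ev (red x) (P div \<gamma> * \<gamma> + P mod \<gamma>)" by (rule arg_cong)
    also have "\<dots> = ev (red x) (N r)" using \<gamma> by (simp only: ev_simps) (simp add: N_def P_def)
    finally have "ev (red x) (N r) = ev (red x) P" by simp
    also have "\<dots> = red (iev (L r) (iev t x))" unfolding P_def ev_red[OF x] iev_pcompose ..
    also have "\<dots> = ev (red (iev t x)) r" unfolding ev_red[OF tx, symmetric] L ..
    finally show ?thesis .
  qed
  have "inj_on N (polys_below (degree \<phi>))"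
  proof (rule inj_onI)
    fix r s assume rs: "r \<in> polys_below (degree \<phi>)" "s \<in> polys_below (degree \<phi>)" "N r = N s"
    then have "ev (red (iev t x)) (r - s) = 0" using evN[of r] evN[of s] by simp
    then have "\<phi> dvd r - s" using poly_eval.irreducible_minimal[OF poly_eval_ev \<phi>] by blast
    moreover have "degree (r - s) < degree \<phi>"
      using rs pos[OF \<phi>] by (simp add: polys_below_iff degree_diff_less)
    ultimately show "r = s" using dvd_imp_degree_le[of \<phi> "r - s"] by fastforce
  qed
  moreover have "N ` polys_below (degree \<phi>) \<subseteq> polys_below (degree \<gamma>)"
  proof (rule image_subsetI)
    fix r
    have "\<gamma> \<noteq> 0" using \<gamma>(1) by auto
    then have "degree (N r) < degree \<gamma>"
      unfolding N_def using degree_mod_less[of \<gamma>] pos[OF \<gamma>] by (metis degree_0)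
    then show "N r \<in> polys_below (degree \<gamma>)" using pos[OF \<gamma>] by (simp add: polys_below_iff)
  qed
  ultimately have "card (polys_below (degree \<phi>) :: 'f poly set) \<le> card (polys_below (degree \<gamma>) :: 'f poly set)"
    by (rule card_inj_on_le) (rule card_polys_below)
  then have "p ^ degree \<phi> \<le> p ^ degree \<gamma>" unfolding card_polys_below p_def[symmetric] .
  then show ?thesis by (rule power_le_imp_le_exp[OF prime_gt_1_nat[OF prime_p]])
qed

text \<open>Over the residue field \<open>G\<close> is the product of the factors
  \<open>X - red x\<close> over all conjugates, and \<open>\<gamma> ^ E\<close> still divides it
  after those at non-roots of \<open>\<gamma>\<close> are dropped.\<close>

lemma multiplicity_le_conjugates:
  fixes \<gamma> :: "'f poly"
  assumes "\<gamma> ^ E dvd map_poly of_int G"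
  shows "E * degree \<gamma> \<le> card {x \<in> conjugates. ev (red x) \<gamma> = 0}"
proof -
  define D where "D = map_poly emb (\<gamma> ^ E)"
  have "degree D = degree (\<gamma> ^ E)" unfolding D_def by (rule degree_map_poly) simp
  then have dD: "degree D = E * degree \<gamma>" by (cases "\<gamma> = 0") (auto simp: degree_power_eq power_0_left)
  have "map_poly red (map_poly of_int G) = map_poly emb (map_poly of_int G)"
    by (rule poly_eqI) (simp add: coeff_map_poly redD emb_of_int ring_hom_onD[OF ring_hom_on_emb])
  then have "D dvd map_poly red (map_poly of_int G)"
    using assms unfolding D_def by (auto elim!: dvdE simp: map_poly_hom_mult[OF ring_hom_on_emb])
  then have "D dvd (\<Prod>x\<in>conjugates. [:- red x, 1:])"
    unfolding G_prod by (subst (asm) reduction_split_prod(2)[OF finite_conjugates]) (use conjugates_V in auto)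
  then have "D dvd (\<Prod>x | x \<in> conjugates \<and> poly D (red x) = 0. [:- red x, 1:])"
    by (rule dvd_prod_linear_cancel[OF finite_conjugates])
  then have "degree D \<le> degree (\<Prod>x | x \<in> conjugates \<and> poly D (red x) = 0. [:- red x, 1:])"
    by (rule dvd_imp_degree_le) (simp add: finite_conjugates)
  also have "\<dots> = card {x \<in> conjugates. poly D (red x) = 0}" by (rule degree_prod_linear)
  also have "\<dots> \<le> card {x \<in> conjugates. ev (red x) \<gamma> = 0}"
  proof (intro card_mono)
    have pw: "ev c (\<gamma> ^ E) = ev c \<gamma> ^ E" for c by (induction E) auto
    show "{x \<in> conjugates. poly D (red x) = 0} \<subseteq> {x \<in> conjugates. ev (red x) \<gamma> = 0}"
      using pw unfolding D_def ev_def[symmetric] by auto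
  qed (use finite_conjugates in auto)
  finally show ?thesis by (simp add: dD)
qed

lemma int_poly_zero_mod_p:
  assumes "map_poly of_int s = (0 :: 'f poly)"
  obtains r where "\<And>x :: complex. iev s x = of_nat p * iev r x"
proof -
  have "int p dvd coeff s i" for i
    using arg_cong[OF assms, of "\<lambda>s. coeff s i"] by (simp add: coeff_map_poly of_int_Fp)
  then have "[:int p:] dvd s" by (simp add: const_poly_dvd_iff)
  then obtain r where "s = [:int p:] * r" ..
  then have "iev s x = of_nat p * iev r x" for x :: complex by (simp only: iev_simps) simp
  then show ?thesis by (rule that)
qed

text \<open>The prime is generated by \<open>p\<close> and a lift of \<open>\<gamma>\<close>, so this lift is at most as divisible as \<open>\<beta>\<close>,
  while its \<open>E\<close>-th power is divisible by \<open>p\<close>.\<close>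

lemma ramification_le:
  assumes x: "x \<in> conjugates" and \<gamma>: "irreducible \<gamma>" "ev (red x) \<gamma> = 0"
    and G\<gamma>: "map_poly of_int G = \<gamma> ^ E * h" "\<not> \<gamma> dvd h"
    and \<beta>: "unit (iev \<beta> x / \<pi>)" "\<pi> ^ e = of_nat p" "e > 1"
  shows "e \<le> E"
proof (rule ccontr)
  assume "\<not> e \<le> E"
  then have Ee: "E < e" by simp
  have xV: "x \<in> V" by (rule conjugates_V[OF x])
  have p0: "(of_nat p :: complex) \<noteq> 0" using prime_p by (auto simp: prime_gt_0_nat)
  have \<pi>V: "\<pi> \<in> V" using power_in_V[of \<pi> e] \<beta> by (simp add: VD)
  have "red \<pi> ^ e = 0" using red_p \<pi>V \<beta>(2) by (simp flip: redD(8))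
  then have r\<pi>: "red \<pi> = 0" by simp
  have \<pi>0: "\<pi> \<noteq> 0" using \<beta>(2,3) p0 by (metis power_0_left less_nat_zero_code)
  obtain g where g: "map_poly of_int g = \<gamma>" by (rule lift_poly)
  obtain H where H: "map_poly of_int H = h" by (rule lift_poly)
  note hom = map_poly_hom_mult[OF ring_hom_on_of_int] map_poly_hom_diff[OF ring_hom_on_of_int]
  have hpow: "map_poly of_int (g ^ k) = \<gamma> ^ k" for k
    by (induction k) (simp_all add: hom g)
  define y where "y = iev g x"
  have yV: "y \<in> V" unfolding y_def by (rule iev_V[OF xV])
  have "map_poly of_int (G - g ^ E * H) = (0 :: 'f poly)"
    by (simp add: hom hpow H G\<gamma>)
  then obtain r where "\<And>x :: complex. iev (G - g ^ E * H) x = of_nat p * iev r x"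
    by (rule int_poly_zero_mod_p) blast
  \<comment> \<open>\<open>G\<close> vanishes at \<open>x\<close>, so the lift of
    \<open>\<gamma> ^ E * h\<close> is divisible by \<open>p\<close> there. Since
    \<open>\<gamma>\<close> does not divide \<open>h\<close>, the lift of \<open>h\<close> is a
    unit, and \<open>y ^ E / p\<close> is integral.\<close>
  from this[of x] x have 1: "y ^ E * iev H x = - (of_nat p * iev r x)"
    by (simp add: conjugates_def y_def eq_neg_iff_add_eq_0 algebra_simps)
  have uH: "unit (iev H x)"
    using ev_red_dvd[OF \<gamma>(1) xV \<gamma>(2), of H] G\<gamma>(2) iev_V[OF xV] by (simp add: H unit_def)
  have yE: "y ^ E / of_nat p \<in> V"
  proof -
    have "y ^ E / of_nat p = - iev r x / iev H x"
      using 1 p0 unit_inverse(2)[OF uH] by (simp add: field_simps)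
    then show ?thesis using V_divide_unit[OF _ uH] iev_V[OF xV] VD by metis
  qed
  have "red (iev \<beta> x) = 0"
  proof -
    have "iev \<beta> x = iev \<beta> x / \<pi> * \<pi>" using \<pi>0 by simp
    then show ?thesis using \<beta>(1) \<pi>V r\<pi> redD(5) unfolding unit_def by (metis mult_zero_right)
  qed
  then have "\<gamma> dvd map_poly of_int \<beta>" using ev_red_dvd[OF \<gamma>(1) xV \<gamma>(2)] by blast
  then obtain q where q: "map_poly of_int \<beta> = \<gamma> * q" ..
  obtain Q where Q: "map_poly of_int Q = q" by (rule lift_poly)
  have "map_poly of_int (\<beta> - g * Q) = (0 :: 'f poly)" by (simp add: hom q Q g)
  then obtain s where "\<And>x :: complex. iev (\<beta> - g * Q) x = of_nat p * iev s x"
    by (rule int_poly_zero_mod_p) blast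
  from this[of x] have \<beta>x: "iev \<beta> x / \<pi> = y / \<pi> * iev Q x + of_nat p / \<pi> * iev s x"
    using \<pi>0 by (simp add: y_def field_simps)
  \<comment> \<open>As \<open>e > 1\<close>, this reduces to 0. The multiple of \<open>p\<close> in
    \<open>\<beta>\<close> is thus negligible modulo \<open>\<pi>\<close>, and since
    \<open>\<beta> / \<pi>\<close> is a unit, \<open>y\<close> cannot be more divisible than
    \<open>\<pi>\<close>.\<close>
  have p\<pi>: "of_nat p / \<pi> = \<pi> ^ (e - 1)"
    using \<beta>(2,3) \<pi>0 by (simp flip: \<beta>(2) add: power_diff)
  have ypi: "\<not> (y / \<pi> \<in> V \<and> red (y / \<pi>) = 0)"
  proof
    assume *: "y / \<pi> \<in> V \<and> red (y / \<pi>) = 0"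
    then have 1: "y / \<pi> * iev Q x \<in> V" "red (y / \<pi> * iev Q x) = 0"
      using VD(4)[of "y / \<pi>" "iev Q x"] redD(5)[of "y / \<pi>" "iev Q x"] iev_V[OF xV] by auto
    have 2: "\<pi> ^ (e - 1) * iev s x \<in> V" "red (\<pi> ^ (e - 1) * iev s x) = 0"
      using \<pi>V r\<pi> \<beta>(3) iev_V[OF xV] by (simp_all add: redD VD)
    have "red (iev \<beta> x / \<pi>) = 0" unfolding \<beta>x p\<pi> redD(7)[OF 1(1) 2(1)] 1 2 by (rule add_0)
    then show False using \<beta>(1) by (simp add: unit_def)
  qed
  then have y0: "y \<noteq> 0" by (auto simp: redD VD)
  have \<pi>y: "\<pi> / y \<in> V"
  proof (rule ccontr)
    assume "\<pi> / y \<notin> V"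
    then show False using ypi inverse_V red_inverse by fastforce
  qed
  \<comment> \<open>\<open>y\<close> divides \<open>\<pi>\<close>, and \<open>p = \<pi> ^ e\<close>
    divides \<open>y ^ E\<close>; with \<open>E < e\<close> this would make a negative power of
    \<open>\<pi>\<close> integral.\<close>
  have "(\<pi> / y) ^ E * (y ^ E / of_nat p) \<in> V" using yE \<pi>y by (intro VD)
  also have "(\<pi> / y) ^ E * (y ^ E / of_nat p) = 1 / \<pi> ^ (e - E)"
    using Ee y0 \<pi>0 by (simp flip: \<beta>(2) add: power_diff power_divide)
  finally have "1 / \<pi> ^ (e - E) \<in> V" .
  from redD(5)[OF this VD(7)[OF \<pi>V], of "e - E"]
  have "red 1 = red (1 / \<pi> ^ (e - E)) * red (\<pi> ^ (e - E))" using \<pi>0 by simp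
  moreover have "red (\<pi> ^ (e - E)) = 0" using \<pi>V r\<pi> Ee by (simp add: redD)
  ultimately show False by (simp add: redD)
qed

text \<open>The chain is \<open>E * degree \<gamma> \<le> card T \<le> degree \<phi> * e \<le>
  degree \<phi> * E\<close>, together with \<open>degree \<phi> \<le> degree \<gamma>\<close>. For
  \<open>e = 1\<close> the last inequality only needs \<open>E > 0\<close>, so a witness of
  ramification is asked for only when \<open>e > 1\<close>.\<close>

lemma local_degree:
  assumes x: "x \<in> conjugates" and \<gamma>: "irreducible \<gamma>" "ev (red x) \<gamma> = 0"
    and inj: "inj_on (iev t) conjugates"
    and T: "finite T" "card T \<le> degree \<phi> * e" 
      "\<And>y. y \<in> conjugates \<Longrightarrow> ev (red y) \<gamma> = 0 \<Longrightarrow> iev t y \<in> T"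
    and \<phi>: "irreducible \<phi>" "ev (red (iev t x)) \<phi> = 0"
    and e: "e = 1 \<or> e > 1 \<and> (\<exists>\<beta> \<pi>. unit (iev \<beta> x / \<pi>) \<and> \<pi> ^ e = of_nat p)"
  shows "degree \<gamma> = degree \<phi>"
proof -
  have xV: "x \<in> V" by (rule conjugates_V[OF x])
  have ge: "degree \<phi> \<le> degree \<gamma>" by (rule degree_residue_le[OF xV \<gamma> \<phi>])
  have pos: "degree \<gamma> > 0"
  proof (rule ccontr)
    assume "\<not> degree \<gamma> > 0"
    then obtain d where "\<gamma> = [:d:]" by (metis degree_eq_zeroE gr0I)
    then show False using \<gamma> by auto
  qed
  have "coeff (map_poly of_int G :: 'f poly) (degree G) = 1" using monic_G by (simp add: coeff_map_poly)
  then have "(map_poly of_int G :: 'f poly) \<noteq> 0" by auto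
  then obtain E h where E: "map_poly of_int G = \<gamma> ^ E * h" "\<not> \<gamma> dvd h"
    using dvd_power_exact pos by metis
  have "\<gamma> dvd map_poly of_int G"
    using ev_red_dvd[OF \<gamma>(1) xV \<gamma>(2), of G] x by (simp add: conjugates_def redD)
  then have "E > 0" using E by (cases E) auto
  then have eE: "e \<le> E" using e ramification_le[OF x \<gamma> E] by fastforce
  have "E * degree \<gamma> \<le> card {y \<in> conjugates. ev (red y) \<gamma> = 0}"
    using E by (intro multiplicity_le_conjugates) simp
  also have "\<dots> \<le> card T"
    using T inj by (intro card_inj_on_le[of "iev t"]) (auto intro: inj_on_subset)
  also have "\<dots> \<le> degree \<phi> * E" using T(2) eE by (meson le_trans mult_le_mono2)
  finally have "degree \<gamma> \<le> degree \<phi>" using \<open>E > 0\<close> by (simp add: mult.commute)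
  with ge show ?thesis by simp
qed

end

section \<open>Primes of the trinomial field\<close>

context trinomial
begin

definition omegas :: "complex set" where
  "omegas = {\<omega>. \<omega> ^ u = - of_int a}"

lemma omegas_unit: "\<omega> \<in> omegas \<Longrightarrow> unit \<omega>"
proof -
  assume "\<omega> \<in> omegas"
  then have "unit (\<omega> ^ u)" using a unit_of_int_iff[of a] by (simp add: omegas_def unit_uminus)
  then show "unit \<omega>" using unit_power_iff u_pos by blast
qed

lemma omegas_prod: "finite omegas" "monom 1 u + [:of_int a:] = (\<Prod>x\<in>omegas. [:- x, 1 :: complex:])"
proof -
  define P where "P = monom 1 u + [:of_int a :: complex:]"
  have a0: "a \<noteq> 0" using a by auto
  have lc: "lead_coeff P = 1" "P \<noteq> 0"
  proof -
    have "degree P = u" unfolding P_def using u_pos by (subst degree_add_eq_left) (auto simp: degree_monom_eq)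
    then show "lead_coeff P = 1" using u_pos by (cases u) (auto simp: P_def)
    then show "P \<noteq> 0" by auto
  qed
  have ev: "poly P x = x ^ u + of_int a" for x by (simp add: P_def poly_monom)
  have roots: "{x. poly P x = 0} = omegas" by (auto simp: omegas_def ev eq_neg_iff_add_eq_0)
  have "rsquarefree P" unfolding rsquarefree_roots
  proof (intro allI notI, elim conjE)
    fix x assume x: "poly P x = 0" "poly (pderiv P) x = 0"
    then have "of_nat u * x ^ (u - 1) = 0" by (simp add: P_def pderiv_add pderiv_monom poly_monom pderiv_pCons)
    then have "x = 0" using u_pos by simp
    then show False using x(1) a0 u_pos by (simp add: ev power_0_left)
  qed
  from complex_poly_decompose_rsquarefree[OF this] lc roots
  show "monom 1 u + [:of_int a:] = (\<Prod>x\<in>omegas. [:- x, 1 :: complex:])" by (simp add: P_def)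
  show "finite omegas" unfolding roots[symmetric] using lc by (intro poly_roots_finite)
qed

definition binom :: "'f poly" where
  "binom = monom 1 u + [:of_int a:]"

lemma binom_map: "binom = map_poly of_int (monom 1 u + [:a:])"
  unfolding binom_def by (rule poly_eqI) (simp add: coeff_map_poly coeff_pCons split: nat.splits)

lemma binom_prod: "map_poly emb binom = (\<Prod>\<omega>\<in>omegas. [:- red \<omega>, 1:])"
proof -
  have "map_poly emb binom = map_poly red (monom 1 u + [:of_int a:])"
    unfolding binom_map
    by (rule poly_eqI) (use u_pos in \<open>simp add: coeff_map_poly redD emb_of_int ring_hom_onD[OF ring_hom_on_emb] 
      coeff_pCons split: nat.splits\<close>)
  also have "\<dots> = (\<Prod>\<omega>\<in>omegas. [:- red \<omega>, 1:])"
    unfolding omegas_prod(2) using omegas_unit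
    by (intro reduction_split_prod(2) omegas_prod(1)) (auto simp: unit_def)
  finally show ?thesis .
qed

lemma omega_near:
  assumes "x \<in> V" "\<phi> dvd binom" "ev (red x) \<phi> = 0"
  obtains \<omega> where "\<omega> \<in> omegas" "red \<omega> = red x"
proof -
  have "ev (red x) binom = 0" using assms(2,3) by (rule ev_dvd)
  then have "(\<Prod>\<omega>\<in>omegas. red x - red \<omega>) = 0"
    unfolding ev_def binom_prod by (simp add: poly_prod)
  then show ?thesis using that omegas_prod(1) by auto
qed

text \<open>\<open>x ^ u + a\<close> replaces the distance \<open>x - \<omega>\<close>: it is an
  integral polynomial in \<open>x\<close>, so it can be compared across conjugates. The cofactor
  reduces to \<open>u * \<omega> ^ (u - 1)\<close>, nonzero because \<open>p\<close> divides neither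
  \<open>u\<close> nor \<open>a\<close>.\<close>

lemma beta_unit:
  assumes "\<omega> \<in> omegas" "x \<in> V" "red x = red \<omega>"
  obtains v where "unit v" "x ^ u + of_int a = (x - \<omega>) * v"
proof -
  define v where "v = (\<Sum>i<u. \<omega> ^ (u - Suc i) * x ^ i)"
  have \<omega>: "\<omega> \<in> V" "red \<omega> \<noteq> 0" "\<omega> ^ u = - of_int a"
    using omegas_unit[OF assms(1)] assms(1) by (auto simp: unit_def omegas_def)
  have "x ^ u + of_int a = x ^ u - \<omega> ^ u" by (simp add: \<omega>)
  also have "\<dots> = (x - \<omega>) * v" unfolding v_def by (rule power_diff_sumr2)
  finally have eq: "x ^ u + of_int a = (x - \<omega>) * v" .
  have vV: "v \<in> V" unfolding v_def using \<omega> assms by (intro subring_sum[OF subring_V] VD)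
  have "red v = (\<Sum>i<u. red \<omega> ^ (u - Suc i) * red \<omega> ^ i)"
    unfolding v_def using \<omega> assms by (subst ring_hom_on_sum[OF red_hom]) (auto simp: VD redD)
  also have "\<dots> = (\<Sum>i<u. red \<omega> ^ (u - 1))"
    by (intro sum.cong) (auto simp flip: power_add)
  also have "\<dots> = red (of_int (int u)) * red \<omega> ^ (u - 1)" by (simp add: redD)
  also have "\<dots> \<noteq> 0" using u \<omega> by (simp only: mult_eq_0_iff red_of_int_eq_0_iff int_dvd_int_iff power_eq_0_iff) simp
  finally have "unit v" using vV by (simp add: unit_def)
  then show ?thesis using eq by (rule that)
qed

lemma red_inj_omegas: "inj_on red omegas"
proof (rule inj_onI)
  fix x y assume xy: "x \<in> omegas" "y \<in> omegas" "red x = red y"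
  then obtain v where v: "unit v" "x ^ u + of_int a = (x - y) * v"
    using beta_unit[of y x] omegas_unit[of x] by (auto simp: unit_def)
  then have "(x - y) * v = 0" using xy by (simp add: omegas_def)
  then show "x = y" using unit_inverse(2)[OF v(1)] by simp
qed

lemma newton_class_beta:
  assumes "\<omega> \<in> omegas" "x \<in> V" "red x = red \<omega>"
  shows "newton_class p k \<kappa> s (x ^ u + of_int a) \<longleftrightarrow> newton_class p k \<kappa> s (x - \<omega>)"
proof -
  obtain v where v: "unit v" "x ^ u + of_int a = (x - \<omega>) * v" by (rule beta_unit[OF assms])
  show ?thesis unfolding v(2) by (rule newton_class_mult_unit[OF v(1)])
qed

section \<open>Roots of the trinomial over a given factor and side\<close>

definition tri :: "int poly" where
  "tri = monom 1 n + monom a 1 + monom b 0"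

lemma n_ge_2: "n \<ge> 2" using n u_pos p_ge_3 by (cases "u * p ^ k") auto

lemma iev_tri: "iev tri x = F x" for x :: complex
proof -
  have "map_poly of_int tri = (monom 1 n + monom (of_int a) 1 + monom (of_int b) 0 :: complex poly)"
    unfolding tri_def by (rule poly_eqI) (simp add: coeff_map_poly)
  then show ?thesis by (simp add: iev_def poly_monom)
qed

lemma tri_monic: "lead_coeff tri = 1"
proof -
  have "coeff tri n = 1" using n_ge_2 by (simp add: tri_def)
  moreover have "degree tri \<le> n" unfolding tri_def using n_ge_2
    by (intro degree_add_le) (auto intro: order_trans[OF degree_monom_le])
  moreover have "n \<le> degree tri" using \<open>coeff tri n = 1\<close> by (intro le_degree) simp
  ultimately show ?thesis by (metis antisym)
qed

lemma F_root_V: "F x = 0 \<Longrightarrow> x \<in> V"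
  using tri_monic iev_tri[of x] by (intro algebraic_int_V) (auto simp: algebraic_int_altdef_ipoly iev_def)

definition exact :: "'f poly \<Rightarrow> bool" where
  "exact \<phi> \<longleftrightarrow> (\<kappa> \<le> k \<longrightarrow> (\<forall>\<omega>\<in>omegas. ev (red \<omega>) \<phi> = 0 \<longrightarrow> unit (F \<omega> / of_nat p ^ \<kappa>)))"

text \<open>The Newton class is taken of \<open>x ^ u + a\<close> and not of
  \<open>x - \<omega>\<close>, so that membership depends only on the prime
  (\<open>center_side\<close>); \<open>newton_class_beta\<close> translates back.\<close>

definition side :: "'f poly \<Rightarrow> nat \<Rightarrow> complex set" where
  "side \<phi> s = {x. F x = 0 \<and> ev (red x) \<phi> = 0 \<and> newton_class p k \<kappa> s (x ^ u + of_int a)}"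

lemma finite_F_roots: "finite {x. F x = 0}"
proof -
  have "map_poly of_int tri \<noteq> (0 :: complex poly)" using tri_monic by (auto simp: map_poly_eq_0_iff)
  then show ?thesis using poly_roots_finite[of "map_poly of_int tri :: complex poly"] iev_tri
    by (simp add: iev_def)
qed

context
  fixes \<phi> :: "'f poly" and s :: nat
  assumes \<phi>: "irreducible \<phi>" "\<phi> dvd binom" "exact \<phi>" and s: "s < \<kappa>"
begin

lemma side_eq: "side \<phi> s = (\<Union>\<omega>\<in>{\<omega> \<in> omegas. ev (red \<omega>) \<phi> = 0}. {x. F x = 0 \<and> newton_class p k \<kappa> s (x - \<omega>)})"
proof (intro equalityI subsetI)
  fix x assume x: "x \<in> side \<phi> s"
  then have xV: "x \<in> V" using F_root_V by (auto simp: side_def)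
  from x obtain \<omega> where \<omega>: "\<omega> \<in> omegas" "red \<omega> = red x"
    using omega_near[OF xV \<phi>(2)] by (auto simp: side_def)
  then show "x \<in> (\<Union>\<omega>\<in>{\<omega> \<in> omegas. ev (red \<omega>) \<phi> = 0}. {x. F x = 0 \<and> newton_class p k \<kappa> s (x - \<omega>)})"
    using x newton_class_beta[OF \<omega>(1) xV \<omega>(2)[symmetric]] by (auto simp: side_def)
next
  fix x assume "x \<in> (\<Union>\<omega>\<in>{\<omega> \<in> omegas. ev (red \<omega>) \<phi> = 0}. {x. F x = 0 \<and> newton_class p k \<kappa> s (x - \<omega>)})"
  then obtain \<omega> where \<omega>: "\<omega> \<in> omegas" "ev (red \<omega>) \<phi> = 0" "F x = 0" "newton_class p k \<kappa> s (x - \<omega>)" by blast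
  have xV: "x \<in> V" using F_root_V \<omega> by blast
  have \<omega>V: "\<omega> \<in> V" using omegas_unit \<omega> by (auto simp: unit_def)
  have "red (x - \<omega>) = 0" using newton_class_red \<omega> s by blast
  then have red: "red x = red \<omega>" using xV \<omega>V by (simp add: redD)
  show "x \<in> side \<phi> s" using newton_class_beta[OF \<omega>(1) xV red] red \<omega> by (simp add: side_def)
qed

text \<open>The residues of the \<open>\<omega>\<close> over \<open>\<phi>\<close> are distinct
  roots of \<open>\<phi>\<close>, so there are at most \<open>degree \<phi>\<close> of them, and
  each contributes at most one width of roots.\<close>

lemma side_card:
  "side \<phi> s \<noteq> {}" "card (side \<phi> s) \<le> degree \<phi> * newton_width p k \<kappa> s"
proof -
  define W where "W = {\<omega> \<in> omegas. ev (red \<omega>) \<phi> = 0}"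
  have W: "finite W" "W \<subseteq> omegas" using omegas_prod(1) by (auto simp: W_def)
  have \<phi>0: "map_poly emb \<phi> \<noteq> 0" using \<phi>(1) by (auto simp: map_poly_eq_0_iff ring_hom_onD[OF ring_hom_on_emb])
  have deg: "degree (map_poly emb \<phi>) = degree \<phi>" by (rule degree_map_poly) simp
  have newton: "\<omega> ^ u = - of_int a" "\<kappa> \<le> k \<Longrightarrow> unit (F \<omega> / of_nat p ^ \<kappa>)" if "\<omega> \<in> W" for \<omega>
    using that \<phi>(3) by (auto simp: W_def omegas_def exact_def)
  \<comment> \<open>If no residue of \<open>omegas\<close> were a root of \<open>\<phi>\<close>,
    every linear factor would cancel and \<open>\<phi>\<close> would divide 1.\<close>
  have "W \<noteq> {}"
  proof
    assume e: "W = {}"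
    have "map_poly emb \<phi> dvd map_poly emb binom"
      using \<phi>(2) by (auto elim!: dvdE simp: map_poly_hom_mult[OF ring_hom_on_emb])
    then have "map_poly emb \<phi> dvd (\<Prod>\<omega> | \<omega> \<in> omegas \<and> poly (map_poly emb \<phi>) (red \<omega>) = 0. [:- red \<omega>, 1:])"
      unfolding binom_prod by (rule dvd_prod_linear_cancel[OF omegas_prod(1)])
    then have "map_poly emb \<phi> dvd 1" using e unfolding W_def ev_def by simp
    then have "degree \<phi> = 0" using deg dvd_imp_degree_le[of "map_poly emb \<phi>" 1] by simp
    then show False using \<phi>(1) by (metis degree_eq_zeroE irreducible_const_poly_iff is_unit_iff_degree
          irreducible_not_unit not_irreducible_zero)
  qed
  then obtain \<omega> where "\<omega> \<in> W" by blast
  then show "side \<phi> s \<noteq> {}"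
    using newton_roots(3)[OF newton[OF \<open>\<omega> \<in> W\<close>] s] unfolding side_eq W_def[symmetric] by blast
  have "inj_on red W" using red_inj_omegas W(2) by (rule inj_on_subset)
  then have "card W = card (red ` W)" by (simp add: card_image)
  also have "\<dots> \<le> card {c. poly (map_poly emb \<phi>) c = 0}"
    by (intro card_mono poly_roots_finite \<phi>0) (auto simp: W_def ev_def)
  also have "\<dots> \<le> degree \<phi>" using card_poly_roots_bound[OF \<phi>0] deg by simp
  finally have cW: "card W \<le> degree \<phi>" .
  have "card (side \<phi> s) \<le> (\<Sum>\<omega>\<in>W. card {x. F x = 0 \<and> newton_class p k \<kappa> s (x - \<omega>)})"
    unfolding side_eq W_def[symmetric] by (rule card_UN_le[OF W(1)])
  also have "\<dots> \<le> (\<Sum>\<omega>\<in>W. newton_width p k \<kappa> s)"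
    using newton_roots(2)[OF newton s] by (intro sum_mono) blast
  also have "\<dots> \<le> degree \<phi> * newton_width p k \<kappa> s" using cW by simp
  finally show "card (side \<phi> s) \<le> degree \<phi> * newton_width p k \<kappa> s" .
qed

end

text \<open>Modulo \<open>p\<close> the constant coefficient \<open>b\<close> vanishes and the
  linear coefficient \<open>a\<close> does not, so 0 is a simple root of the reduction.\<close>

lemma F_roots_max: "card {x. F x = 0 \<and> red x = 0} \<le> 1" "{x. F x = 0 \<and> red x = 0} \<noteq> {}"
proof -
  define P where "P = (map_poly of_int tri :: complex poly)"
  have P: "coeff (map_poly red P) i = of_int (coeff tri i)" for i
    by (simp add: P_def coeff_map_poly redD)
  have PV: "coeffs_in V P" by (simp add: P_def coeffs_in_def coeff_map_poly VD)
  have F: "poly P x = F x" for x using iev_tri[of x] by (simp add: P_def iev_def)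
  have "int p dvd b" using \<kappa> by (meson dvd_power dvd_trans)
  then have 0: "coeff (map_poly red P) 0 = 0"
    unfolding P using n_ge_2 red_of_int_eq_0_iff[of b] by (simp add: tri_def redD)
  have 1: "coeff (map_poly red P) 1 \<noteq> 0"
    unfolding P using n_ge_2 red_of_int_eq_0_iff[of a] a by (simp add: tri_def redD)
  then have n0: "map_poly red P \<noteq> 0" by auto
  have "order 0 (map_poly red P) = 1"
    using monom_1_dvd_iff[OF n0, of 1] monom_1_dvd_iff[OF n0, of 2] monom_1_dvd_iff'[of 1 "map_poly red P"]
      monom_1_dvd_iff'[of 2 "map_poly red P"] 0 1 by force
  then have sz: "size {#x \<in># proots P. x \<in> V \<and> red x = 0#} = 1" using reduction_roots[OF PV n0] by metis
  have "P \<noteq> 0" using n0 by auto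
  have "{x. F x = 0 \<and> red x = 0} = {x. poly P x = 0 \<and> (x \<in> V \<and> red x = 0)}" using F F_root_V by auto
  then show "card {x. F x = 0 \<and> red x = 0} \<le> 1" "{x. F x = 0 \<and> red x = 0} \<noteq> {}"
    using card_filter_roots_le[OF \<open>P \<noteq> 0\<close>, of "\<lambda>x. x \<in> V \<and> red x = 0"] sz by auto
qed

end

text \<open>The given root of the trinomial appears as \<open>iev t \<eta>\<close>: \<open>t\<close>
  is an integer polynomial because that root is integral, and \<open>h\<close> expresses
  \<open>\<eta>\<close> rationally through it.\<close>

locale trinomial_generator = trinomial V red Fp p n u k \<kappa> a b + generator V red Fp p \<eta> G
  for V and red :: "complex \<Rightarrow> 'r::field" and Fp :: "'f::{field,finite} itself" and p n u k \<kappa> a b \<eta> G +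
  fixes t :: "int poly" and h :: "rat poly"
  assumes irreducible_tri: "irreducible (map_poly of_int tri :: rat poly)"
    and t: "F (iev t \<eta>) = 0" and h: "qev h (iev t \<eta>) = \<eta>"
begin

lemma conj_F: "x \<in> conjugates \<Longrightarrow> F (iev t x) = 0"
  using conjugate_transfer[of "map_poly of_int (pcompose tri t)" x] t by (simp add: iev_pcompose iev_tri)

lemma conj_h: 
  assumes "x \<in> conjugates" shows "qev h (iev t x) = x"
proof -
  have "qev (pcompose h (map_poly of_int t)) \<eta> = qev [:0, 1:] \<eta>" by (simp add: qev_pcompose h)
  from conjugate_transfer_eq[OF this assms] show ?thesis by (simp add: qev_pcompose)
qed

lemma inj_t: "inj_on (iev t) conjugates"
  by (metis conj_h inj_onI)

text \<open>Irreducibility of the trinomial transfers rational identities from one root to any other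
  root \<open>y\<close>, so \<open>h\<close> evaluated at \<open>y\<close> is the wanted conjugate
  of \<open>\<eta>\<close>.\<close>

lemma root_from_conjugate:
  assumes "F y = 0" obtains x where "x \<in> conjugates" "iev t x = y"
proof -
  have tr: "qev r y = 0" if "qev r (iev t \<eta>) = 0" for r
  proof -
    have "map_poly of_int tri dvd r"
      using poly_eval.irreducible_minimal[OF poly_eval_qev irreducible_tri, of "iev t \<eta>"] t that
      by (simp add: iev_tri)
    then show ?thesis using assms iev_tri[of y] by (auto elim!: dvdE)
  qed
  have "qev (pcompose (map_poly of_int G) h) y = 0"
    by (rule tr) (simp only: qev_pcompose h qev_of_int_poly root_G)
  then have "qev h y \<in> conjugates" by (simp add: conjugates_def qev_pcompose)
  moreover have "qev (pcompose (map_poly of_int t) h - [:0, 1:]) y = 0"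
    by (rule tr) (simp add: qev_pcompose h)
  then have "iev t (qev h y) = y" by (simp add: qev_pcompose)
  ultimately show ?thesis by (rule that)
qed

lemma conjugate_minimal_polynomial:
  assumes x: "x \<in> conjugates"
  obtains \<gamma> where "lead_coeff \<gamma> = 1" "irreducible \<gamma>" "ev (red x) \<gamma> = 0"
proof -
  have "ev (red x) (map_poly of_int G) = 0"
    using x ev_red[OF conjugates_V[OF x]] by (simp add: conjugates_def redD)
  moreover have "coeff (map_poly of_int G :: 'f poly) (degree G) = 1" using monic_G by (simp add: coeff_map_poly)
  then have "(map_poly of_int G :: 'f poly) \<noteq> 0" by auto
  ultimately show ?thesis using poly_eval.minimal_polynomial[OF poly_eval_ev, of "map_poly of_int G" "red x"] that
    by (metis dvd_refl)
qed

definition center :: "complex \<Rightarrow> 'f poly \<Rightarrow> bool" where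
  "center x \<gamma> \<longleftrightarrow> x \<in> conjugates \<and> lead_coeff \<gamma> = 1 \<and> irreducible \<gamma> \<and> ev (red x) \<gamma> = 0"

lemma center_ev:
  assumes "center x \<gamma>" "center y \<gamma>" "ev (red (iev t x)) \<phi> = 0"
  shows "ev (red (iev t y)) \<phi> = 0"
proof -
  obtain s where s: "map_poly of_int s = \<phi>" by (rule lift_poly)
  have *: "ev (red (iev t z)) \<phi> = red (iev (pcompose s t) z)" if "z \<in> V" for z
    unfolding s[symmetric] using ev_red[OF iev_V[OF that]] by (simp add: iev_pcompose)
  have "red (iev (pcompose s t) x) = 0 \<longleftrightarrow> red (iev (pcompose s t) y) = 0"
    using assms by (intro same_center_iev[of \<gamma>]) (auto simp: center_def)
  then show ?thesis using * assms conjugates_V by (auto simp: center_def)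
qed

text \<open>\<open>\<beta> ^ e / p\<close> is an element of the field, so \<open>same_center\<close>
  applies to it. Exponent 1 serves the class \<open>s = k\<close>, the width serves all
  others.\<close>

lemma center_class:
  assumes "center x \<gamma>" "center y \<gamma>" "newton_class p k \<kappa> s (iev t x ^ u + of_int a)"
  shows "newton_class p k \<kappa> s (iev t y ^ u + of_int a)"
proof -
  define \<beta> where "\<beta> = map_poly rat_of_int (t ^ u + [:a:])"
  have \<beta>: "qev ([:inverse (of_nat p):] * \<beta> ^ e) z = (iev t z ^ u + of_int a) ^ e / of_nat p" for e and z :: complex
    by (simp add: \<beta>_def of_rat_inverse divide_inverse mult.commute del: mult_pCons_left)
  have "qev ([:inverse (of_nat p):] * \<beta> ^ e) x \<in> V \<longleftrightarrow> qev ([:inverse (of_nat p):] * \<beta> ^ e) y \<in> V"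
    "unit (qev ([:inverse (of_nat p):] * \<beta> ^ e) x) \<longleftrightarrow> unit (qev ([:inverse (of_nat p):] * \<beta> ^ e) y)" for e
    using assms same_center[of \<gamma>] unfolding center_def by blast+
  from this(1)[of 1] this(2)[of "newton_width p k \<kappa> s"] show ?thesis using assms(3)
    unfolding \<beta> newton_class_def by (cases "s = k") simp_all
qed

lemma center_side:
  assumes "center x \<gamma>" "center y \<gamma>" "iev t x \<in> side \<phi> s"
  shows "iev t y \<in> side \<phi> s"
  using assms center_ev[OF assms(1,2)] center_class[OF assms(1,2)] conj_F
  by (auto simp: side_def center_def)

lemma side_center:
  assumes \<phi>: "irreducible \<phi>" "\<phi> dvd binom" "exact \<phi>" and s: "s < \<kappa>"
  obtains x \<gamma> where "center x \<gamma>" "iev t x \<in> side \<phi> s" "degree \<gamma> = degree \<phi>"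
proof -
  obtain y where y: "y \<in> side \<phi> s" using side_card(1)[OF assms] by blast
  then obtain x where x: "x \<in> conjugates" "iev t x = y" using root_from_conjugate by (auto simp: side_def)
  obtain \<gamma> where \<gamma>: "lead_coeff \<gamma> = 1" "irreducible \<gamma>" "ev (red x) \<gamma> = 0"
    by (rule conjugate_minimal_polynomial[OF x(1)])
  have c: "center x \<gamma>" using x \<gamma> by (simp add: center_def)
  define w where "w = newton_width p k \<kappa> s"
  have "degree \<gamma> = degree \<phi>"
  proof (rule local_degree[OF x(1) \<gamma>(2,3) inj_t])
    show "finite (side \<phi> s)" using finite_F_roots by (rule finite_subset[rotated]) (auto simp: side_def)
    show "card (side \<phi> s) \<le> degree \<phi> * w" unfolding w_def by (rule side_card(2)[OF assms])
    show "iev t y \<in> side \<phi> s" if "y \<in> conjugates" "ev (red y) \<gamma> = 0" for y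
      using center_side[OF c] x y \<gamma> that by (auto simp: center_def)
    show "irreducible \<phi>" by fact
    show "ev (red (iev t x)) \<phi> = 0" using y x by (simp add: side_def)
    show "w = 1 \<or> w > 1 \<and> (\<exists>\<beta> \<pi>. unit (iev \<beta> x / \<pi>) \<and> \<pi> ^ w = of_nat p)"
    proof (cases "w = 1")
      case False
      have w: "w > 0" using width_pos s by (simp add: w_def)
      \<comment> \<open>The side \<open>s = k\<close>, whose slope is not exact, has width 1;
        \<open>local_degree\<close> asks for no \<open>\<pi>\<close> there.\<close>
      have "s \<noteq> k" using False s \<kappa>(2) by (auto simp: w_def newton_width_def)
      then have "unit ((iev t x ^ u + of_int a) ^ w / of_nat p)"
        using y x by (simp add: side_def newton_class_def w_def)
      moreover obtain \<pi> :: complex where \<pi>: "\<pi> ^ w = of_nat p" using nth_root_exists[OF w] by metis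
      ultimately have "unit ((iev (t ^ u + [:a:]) x / \<pi>) ^ w)" by (simp add: power_divide)
      then have "unit (iev (t ^ u + [:a:]) x / \<pi>)" using unit_power_iff[OF w] by blast
      moreover have "w > 1" using False w by simp
      ultimately show ?thesis using \<pi> by blast
    qed simp
  qed
  then show ?thesis using that c x y by blast
qed

text \<open>The factor \<open>x\<close> of the trinomial modulo \<open>p\<close>: a single root
  reduces to 0, so \<open>local_degree\<close> applies with \<open>e = 1\<close> and the polynomial
  \<open>[:0, 1:]\<close>.\<close>

lemma zero_center:
  obtains x \<gamma> where "center x \<gamma>" "F (iev t x) = 0" "red (iev t x) = 0" "degree \<gamma> = 1"
proof -
  obtain y where y: "F y = 0" "red y = 0" using F_roots_max by blast
  then obtain x where x: "x \<in> conjugates" "iev t x = y" using root_from_conjugate by blast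
  obtain \<gamma> where \<gamma>: "lead_coeff \<gamma> = 1" "irreducible \<gamma>" "ev (red x) \<gamma> = 0"
    by (rule conjugate_minimal_polynomial[OF x(1)])
  have c: "center x \<gamma>" using x \<gamma> by (simp add: center_def)
  have evX: "ev z [:0, 1:] = z" for z by (simp add: ring_hom_onD[OF ring_hom_on_emb])
  have "degree \<gamma> = degree [:0, 1 :: 'f:]"
  proof (rule local_degree[OF x(1) \<gamma>(2,3) inj_t])
    show "finite {y. F y = 0 \<and> red y = 0}" using finite_F_roots by (rule finite_subset[rotated]) auto
    show "card {y. F y = 0 \<and> red y = 0} \<le> degree [:0, 1 :: 'f:] * 1" using F_roots_max by simp
    show "iev t z \<in> {y. F y = 0 \<and> red y = 0}" if z: "z \<in> conjugates" "ev (red z) \<gamma> = 0" for z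
    proof -
      have "center z \<gamma>" using z \<gamma> by (simp add: center_def)
      moreover have "ev (red (iev t x)) [:0, 1:] = 0" unfolding evX using x y by simp
      ultimately have "ev (red (iev t z)) [:0, 1:] = 0" by (rule center_ev[OF c])
      then show ?thesis using conj_F[OF z(1)] by (simp only: evX mem_Collect_eq)
    qed
    show "irreducible [:0, 1 :: 'f:]" by (rule irreducible_linear_field_poly) simp
    show "ev (red (iev t x)) [:0, 1:] = 0" using x y evX by simp
  qed simp
  then show ?thesis using that c x y by auto
qed

end

section \<open>Counting the primes of a given degree\<close>

lemma finite_num_irred: "finite {f :: 'f::{field,finite} poly. lead_coeff f = 1 \<and> irreducible f \<and> degree f = m}"
  by (rule finite_subset[OF _ card_polys_below(1)[of "Suc m"]]) (auto simp: polys_below_iff)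

lemma num_irred_1_le: "num_irred (Fp :: 'f::{field,finite} itself) 1 \<le> card (UNIV :: 'f set)"
proof -
  have "{f :: 'f poly. lead_coeff f = 1 \<and> irreducible f \<and> degree f = 1} \<subseteq> (\<lambda>c. [:c, 1:]) ` UNIV"
  proof
    fix f :: "'f poly" assume f: "f \<in> {f. lead_coeff f = 1 \<and> irreducible f \<and> degree f = 1}"
    obtain c g where cg: "f = pCons c g" by (cases f)
    then have "degree g = 0" using f by (auto split: if_splits)
    then obtain d where "g = [:d:]" by (metis degree_eq_zeroE)
    then show "f \<in> (\<lambda>c. [:c, 1:]) ` UNIV" using f cg by (auto split: if_splits)
  qed
  then have "num_irred Fp 1 \<le> card ((\<lambda>c :: 'f. [:c, 1:]) ` UNIV)"
    unfolding num_irred_def by (rule card_mono[rotated]) simp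
  also have "\<dots> \<le> card (UNIV :: 'f set)" by (rule card_image_le) simp
  finally show ?thesis .
qed

context trinomial
begin

text \<open>\<open>F \<omega> / p ^ \<kappa>\<close> equals \<open>\<omega> * A + B\<close> with
  integers \<open>A\<close> and \<open>B\<close>, not both divisible by \<open>p\<close>. If one is
  divisible, the other term is a unit and decides. If neither is, only an \<open>\<omega>\<close>
  with residue in the prime field could make the terms cancel.\<close>

lemma exactI:
  assumes e: "\<kappa> \<le> k \<Longrightarrow> \<not> (int p ^ Suc \<kappa> dvd b \<and> int p ^ Suc \<kappa> dvd a ^ (p - 1) - 1)"
    and m: "\<kappa> \<le> k \<Longrightarrow> degree \<phi> > 1 \<or> int p ^ Suc \<kappa> dvd b \<or> int p ^ Suc \<kappa> dvd a ^ (p - 1) - 1"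
    and \<phi>: "irreducible \<phi>"
  shows "exact \<phi>"
  unfolding exact_def
proof (intro impI ballI)
  fix \<omega> assume \<kappa>k: "\<kappa> \<le> k" and \<omega>: "\<omega> \<in> omegas" "ev (red \<omega>) \<phi> = 0"
  obtain B where B: "b = int p ^ \<kappa> * B" using \<kappa>(3) by blast
  obtain A0 where A0: "a ^ (p - 1) - 1 = int p ^ \<kappa> * A0" using \<kappa>(4) by blast
  have "int p dvd a ^ (p - 1) - 1" using \<kappa>(1,4) by (meson dvd_trans dvd_power)
  from power_prime_power_diff[OF prime_p a this k] obtain D 
    where D: "a ^ (p ^ k) - a = (a ^ (p - 1) - 1) * D" "\<not> int p dvd D" by metis
  define A where "A = - (A0 * D)"
  have A: "a - a ^ (p ^ k) = int p ^ \<kappa> * A" using D(1) A0 by (simp add: A_def algebra_simps)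
  have p0: "int p ^ \<kappa> \<noteq> 0" using p_ge_3 by simp
  have dvd: "int p ^ Suc \<kappa> dvd int p ^ \<kappa> * X \<longleftrightarrow> int p dvd X" for X
    using p0 by (metis dvd_mult_cancel_left power_Suc2)
  have pp: "prime (int p)" using prime_p by simp
  have AA: "int p dvd A \<longleftrightarrow> int p dvd A0" unfolding A_def dvd_minus_iff
    using D(2) prime_dvd_mult_iff[OF pp] by blast
  have F\<omega>: "F \<omega> / of_nat p ^ \<kappa> = \<omega> * of_int A + of_int B"
  proof -
    have "F \<omega> = \<omega> * of_int (a - a ^ (p ^ k)) + of_int b"
      using \<omega>(1) odd_p by (simp add: n omegas_def power_mult algebra_simps)
    also have "\<dots> = of_nat p ^ \<kappa> * (\<omega> * of_int A + of_int B)" unfolding A B by (simp add: algebra_simps)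
    finally show ?thesis using of_nat_p(3) by simp
  qed
  have \<omega>u: "unit \<omega>" using omegas_unit \<omega> by blast
  have neq: "red (\<omega> * of_int A + of_int B) \<noteq> 0"
  proof
    assume 0: "red (\<omega> * of_int A + of_int B) = 0"
    have sum: "red (\<omega> * of_int A + of_int B) = red \<omega> * red (of_int A) + red (of_int B)"
      using \<omega>u by (simp add: unit_def redD VD)
    have AB: "\<not> (int p dvd A \<and> int p dvd B)" using e[OF \<kappa>k] unfolding A0 B dvd AA by blast
    have ne: "\<not> (int p dvd A \<or> int p dvd B)"
    proof
      assume "int p dvd A \<or> int p dvd B"
      then have "int p dvd A \<and> int p dvd B"
        using 0 sum \<omega>u unfolding red_of_int_eq_0_iff[symmetric] unit_def by auto
      then show False using AB by blast
    qed
    then have deg: "degree \<phi> > 1" using m[OF \<kappa>k] unfolding A0 B dvd AA by blast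
    \<comment> \<open>Cancellation makes the residue of \<open>\<omega>\<close> a root of a linear
      polynomial over the prime field, too small for \<open>\<phi>\<close> to divide.\<close>
    have "ev (red \<omega>) [:of_int B, of_int A:] = 0"
      using 0 sum by (simp add: emb_of_int redD algebra_simps)
    then have "\<phi> dvd [:of_int B, of_int A:]"
      using poly_eval.irreducible_minimal[OF poly_eval_ev \<phi> \<omega>(2)] by blast
    moreover have "(of_int A :: 'f) \<noteq> 0" using ne of_int_Fp(1) by blast
    ultimately have "degree \<phi> \<le> 1" using dvd_imp_degree_le[of \<phi> "[:of_int B, of_int A:]"] by simp
    then show False using deg by simp
  qed
  moreover have "\<omega> * of_int A + of_int B \<in> V" using \<omega>u by (simp add: unit_def VD)
  ultimately show "unit (F \<omega> / of_nat p ^ \<kappa>)" unfolding F\<omega> by (simp add: unit_def)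
qed

end

context trinomial_generator
begin

definition factors :: "nat \<Rightarrow> 'f poly set" where
  "factors m = {f. lead_coeff f = 1 \<and> irreducible f \<and> degree f = m \<and> f dvd binom}"

lemma side_unique:
  assumes "center x \<gamma>" "iev t x \<in> side \<phi> s" "center y \<gamma>" "iev t y \<in> side \<psi> r"
    and "\<phi> \<in> factors m" "\<psi> \<in> factors m" "s < \<kappa>" "r < \<kappa>"
  shows "\<phi> = \<psi> \<and> s = r"
proof -
  have y: "iev t y \<in> side \<phi> s" by (rule center_side[OF assms(1,3,2)])
  have "ev (red (iev t y)) \<phi> = 0" "ev (red (iev t y)) \<psi> = 0" using y assms(4) by (simp_all add: side_def)
  then have "\<phi> = \<psi>" 
    using poly_eval.irreducible_monic_unique[OF poly_eval_ev] assms(5,6) unfolding factors_def by blast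
  moreover have "s = r"
    using newton_class_unique[of s "iev t y ^ u + of_int a" r] y assms(4,7,8) by (simp add: side_def)
  ultimately show ?thesis ..
qed

lemma factors_bound:
  assumes ex: "\<And>\<phi>. \<phi> \<in> factors m \<Longrightarrow> exact \<phi>"
  shows "\<kappa> * card (factors m) \<le> num_irred Fp m"
    "m = 1 \<Longrightarrow> \<kappa> * card (factors m) + 1 \<le> num_irred Fp m"
proof -
  define A where "A = factors m \<times> {..<\<kappa>}"
  define I where "I = {f :: 'f poly. lead_coeff f = 1 \<and> irreducible f \<and> degree f = m}"
  have I: "finite I" "card I = num_irred Fp m" unfolding I_def num_irred_def by (rule finite_num_irred, rule refl)
  have "factors m \<subseteq> I" by (auto simp: factors_def I_def)
  then have "finite (factors m)" using I finite_subset by blast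
  then have A: "card A = \<kappa> * card (factors m)" by (simp add: A_def card_cartesian_product)
  have "\<forall>z\<in>A. \<exists>\<gamma>. \<exists>x. center x \<gamma> \<and> iev t x \<in> side (fst z) (snd z) \<and> degree \<gamma> = m"
  proof
    fix z assume z: "z \<in> A"
    then have "irreducible (fst z)" "fst z dvd binom" "exact (fst z)" "snd z < \<kappa>" "degree (fst z) = m"
      using ex by (auto simp: A_def factors_def)
    then show "\<exists>\<gamma>. \<exists>x. center x \<gamma> \<and> iev t x \<in> side (fst z) (snd z) \<and> degree \<gamma> = m"
      using side_center by metis
  qed
  then obtain g where g: "\<And>z. z \<in> A \<Longrightarrow> \<exists>x. center x (g z) \<and> iev t x \<in> side (fst z) (snd z) \<and> degree (g z) = m"
    by metis
  have inj: "inj_on g A"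
  proof (rule inj_onI)
    fix z z' assume z: "z \<in> A" "z' \<in> A" "g z = g z'"
    obtain x where x: "center x (g z)" "iev t x \<in> side (fst z) (snd z)" using g[OF z(1)] by blast
    obtain y where y: "center y (g z)" "iev t y \<in> side (fst z') (snd z')" using g[OF z(2)] z(3) by metis
    have "fst z = fst z' \<and> snd z = snd z'"
      by (rule side_unique[OF x y, of m]) (use z in \<open>auto simp: A_def\<close>)
    then show "z = z'" by (simp add: prod_eq_iff)
  qed
  have sub: "g ` A \<subseteq> I" using g by (fastforce simp: I_def center_def)
  have card: "card (g ` A) = \<kappa> * card (factors m)" using card_image[OF inj] A by simp
  show "\<kappa> * card (factors m) \<le> num_irred Fp m" using card_mono[OF I(1) sub] card I(2) by simp
  assume m: "m = 1"
  obtain x \<gamma> where \<gamma>: "center x \<gamma>" "F (iev t x) = 0" "red (iev t x) = 0" "degree \<gamma> = 1"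
    by (rule zero_center)
  \<comment> \<open>Otherwise a root reducing to 0 would have the same residue as some
    \<open>\<omega>\<close>, but every \<open>\<omega>\<close> is a unit.\<close>
  have "\<gamma> \<notin> g ` A"
  proof
    assume "\<gamma> \<in> g ` A"
    then obtain z where z: "z \<in> A" "\<gamma> = g z" by blast
    from g[OF z(1)] obtain y where y: "center y (g z)" "iev t y \<in> side (fst z) (snd z)" by blast
    have "iev t x \<in> side (fst z) (snd z)" using center_side[OF y(1) _ y(2)] \<gamma>(1) z(2) by blast
    then have "iev t x \<in> V" "fst z dvd binom" "ev (red (iev t x)) (fst z) = 0"
      using z(1) F_root_V \<gamma>(2) by (auto simp: side_def A_def factors_def)
    then obtain \<omega> where "\<omega> \<in> omegas" "red \<omega> = red (iev t x)" by (rule omega_near)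
    then show False using omegas_unit \<gamma>(3) by (auto simp: unit_def)
  qed
  then have "card (insert \<gamma> (g ` A)) = \<kappa> * card (factors m) + 1"
    using card finite_subset[OF sub I(1)] by simp
  moreover have "insert \<gamma> (g ` A) \<subseteq> I" using sub \<gamma> m by (auto simp: I_def center_def)
  ultimately show "\<kappa> * card (factors m) + 1 \<le> num_irred Fp m"
    using card_mono[OF I(1)] I(2) by metis
qed

lemma factors_card: "card (factors m) = num_irred_factors Fp m u a"
  by (simp add: factors_def num_irred_factors_def binom_def)

end

section \<open>From the hypotheses on the field to the counting bound\<close>

lemma enat_le_padic_val: 
  assumes "prime p" shows "enat s \<le> padic_val p x \<longleftrightarrow> int p ^ s dvd x"
proof (cases "x = 0")
  case False
  have "\<not> is_unit (int p)" using prime_gt_1_nat[OF assms] by simp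
  then show ?thesis using False by (simp add: padic_val_def power_dvd_iff_le_multiplicity)
qed (simp add: padic_val_def)

lemma trinomial_generator_exists:
  fixes n p u k c :: nat and a b :: int and \<theta> :: complex
  assumes irr: "irreducible (map_poly rat_of_int (monom 1 n + monom a 1 + monom b 0))"
    and root: "poly (map_poly of_int (monom 1 n + monom a 1 + monom b 0)) \<theta> = 0"
    and mono: "monogenic (rat_adjoin \<theta>)"
    and p: "prime p" "odd p" "card (UNIV :: 'f::{field,finite} set) = p"
    and n: "n = Suc (u * p ^ k)" and k: "k > 0" and u: "\<not> p dvd u" and a: "\<not> int p dvd a"
    and c: "c > 0" "c \<le> Suc k" "int p ^ c dvd b" "int p ^ c dvd a ^ (p - 1) - 1"
  obtains V and red :: "complex \<Rightarrow> 'f::{field,finite} residue" and \<eta> G t h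
  where "trinomial_generator TYPE('f::{field,finite}) V red p n u k c a b \<eta> G t h"
proof -
  obtain V and red :: "complex \<Rightarrow> 'f residue" where
    place: "place V red" "red (of_nat (card (UNIV :: 'f set))) = 0" using place_exists by blast
  interpret place V red by (rule place)
  interpret fplace V red "TYPE('f)" p by unfold_locales (use place p in auto)
  interpret trinomial V red "TYPE('f)" p n u k c a b by unfold_locales (use assms in auto)
  have tri: "tri = monom 1 n + monom a 1 + monom b 0" by (rule tri_def)
  have F\<theta>: "F \<theta> = 0" using root iev_tri[of \<theta>] by (simp add: tri iev_def)
  define K where "K = rat_adjoin \<theta>"
  obtain \<eta> where \<eta>: "\<eta> \<in> ring_of_integers K" "ring_of_integers K = int_adjoin \<eta>" "K = rat_adjoin \<eta>"
    using mono by (auto simp: monogenic_def K_def)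
  have ai: "algebraic_int \<eta>" "\<eta> \<in> K" using \<eta>(1) by (auto simp: ring_of_integers_def)
  obtain G where G: "lead_coeff G = 1" "irreducible (map_poly of_int G :: rat poly)" "iev G \<eta> = 0"
    by (rule algebraic_int_minimal_polynomial[OF ai(1)])
  have integral: "\<exists>s. qev r \<eta> = iev s \<eta>" if "algebraic_int (qev r \<eta>)" for r
  proof -
    have "qev r \<eta> \<in> ring_of_integers K"
      using that qev_in_rat_adjoin[of r \<eta>] \<eta>(3) by (simp add: ring_of_integers_def)
    then show ?thesis unfolding \<eta>(2) int_adjoin_def iev_def by blast
  qed
  have "algebraic_int \<theta>" using tri_monic F\<theta> iev_tri[of \<theta>] by (auto simp: algebraic_int_altdef_ipoly iev_def)
  moreover have "\<theta> \<in> K" using qev_in_rat_adjoin[of "[:0, 1:]" \<theta>] by (simp add: K_def)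
  ultimately have "\<theta> \<in> int_adjoin \<eta>" using \<eta>(2) by (auto simp: ring_of_integers_def)
  then obtain t where t: "\<theta> = iev t \<eta>" unfolding int_adjoin_def iev_def by blast
  have "qev (map_poly of_int tri) \<theta> = 0" using F\<theta> by (simp add: iev_tri)
  then obtain h where h: "\<eta> = qev h \<theta>"
    using rat_adjoin_algebraic[of "map_poly of_int tri" \<theta> \<eta>] irr ai(2) unfolding tri[symmetric] K_def by metis
  have "trinomial_generator TYPE('f) V red p n u k c a b \<eta> G t h"
  proof unfold_locales
    show "irreducible (map_poly of_int tri :: rat poly)" using irr by (simp add: tri)
    show "F (iev t \<eta>) = 0" "qev h (iev t \<eta>) = \<eta>" unfolding t[symmetric] by (rule F\<theta>, rule h[symmetric])
  qed (fact G integral)+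
  then show ?thesis by (rule that)
qed

theorem theorem2p7:
  fixes n p u k :: nat and a b :: int and F :: "int poly"
    and \<theta> :: complex and K :: "complex set"
    and \<sigma> \<rho> \<tau> \<kappa> :: enat
    and Fp :: "'f::{field,finite} itself"
  assumes F: "F = monom 1 n + monom a 1 + monom b 0"
    and irr: "irreducible (map_poly rat_of_int F)"
    and root: "poly (map_poly of_int F) \<theta> = 0"
    and K: "K = rat_adjoin \<theta>"
    and p: "prime p" "odd p"
    and Fp: "card (UNIV :: 'f set) = p"
    and dvds: "int p dvd b" "p dvd n - 1" "\<not> int p dvd a"
    and u: "n - 1 = u * p ^ k" "\<not> p dvd u"
    and \<sigma>: "\<sigma> = padic_val p b"
    and \<rho>: "\<rho> = padic_val p (a ^ (p - 1) - 1)"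
    and \<tau>: "\<tau> = min \<sigma> \<rho>"
    and \<kappa>: "\<kappa> = min \<tau> (enat (k + 1))"
    and cond:
      "(\<tau> \<noteq> enat (k + 1) \<and>
          (\<exists>m>1. num_irred_factors Fp m u a > 0 \<and>
             ereal_of_enat \<kappa> > ereal (real (num_irred Fp m) / real (num_irred_factors Fp m u a)))) \<or>
       (enat p < \<sigma> * enat (num_irred_factors Fp 1 u a) + 1 \<and> \<sigma> < min \<rho> (enat (k + 1))) \<or>
       (enat p < \<rho> * enat (num_irred_factors Fp 1 u a) + 1 \<and> \<rho> < min \<sigma> (enat (k + 1))) \<or>
       (enat p < enat (k + 1) * enat (num_irred_factors Fp 1 u a) + 1 \<and> enat (k + 1) < \<tau>)"
  shows "\<not> monogenic K"
proof
  assume mono: "monogenic K"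
  define N where "N = (\<lambda>m. num_irred_factors Fp m u a)"
  have p2: "p \<ge> 2" by (rule prime_ge_2_nat[OF p(1)])
  have "u * p ^ k \<noteq> 0" using u(2) p2 by (auto intro: Nat.gr0I)
  then have n: "n = Suc (u * p ^ k)" unfolding u(1)[symmetric] by simp
  have k: "k > 0"
  proof (rule ccontr)
    assume "\<not> k > 0"
    then show False using dvds(2) u by simp
  qed
  \<comment> \<open>\<open>\<kappa>\<close> is at most \<open>k + 1\<close>, hence finite even if
    \<open>b = 0\<close> or \<open>a ^ (p - 1) = 1\<close>.\<close>
  obtain c where c: "\<kappa> = enat c" unfolding \<kappa> by (metis enat_ile min.cobounded2)
  have ck: "c \<le> Suc k" using c unfolding \<kappa> by (metis Suc_eq_plus1 enat_ord_simps(1) min.cobounded2)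
  have dvd: "int p ^ s dvd b \<longleftrightarrow> enat s \<le> \<sigma>" "int p ^ s dvd a ^ (p - 1) - 1 \<longleftrightarrow> enat s \<le> \<rho>" for s
    using enat_le_padic_val[OF p(1)] by (simp_all add: \<sigma> \<rho>)
  have cs: "enat c \<le> \<sigma>" "enat c \<le> \<rho>" using c unfolding \<kappa> \<tau> by (metis min.boundedE order_refl)+
  \<comment> \<open>With \<open>c \<le> k\<close> the minimum is attained at \<open>\<sigma>\<close>
    or \<open>\<rho>\<close>, so one of the two valuations is exactly \<open>c\<close>.\<close>
  have small: "\<not> (enat (Suc c) \<le> \<sigma> \<and> enat (Suc c) \<le> \<rho>)" if "c \<le> k"
  proof
    assume "enat (Suc c) \<le> \<sigma> \<and> enat (Suc c) \<le> \<rho>"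
    then have "enat (Suc c) \<le> \<kappa>" using that by (simp add: \<kappa> \<tau>)
    then show False by (simp add: c)
  qed
  \<comment> \<open>For \<open>c = Suc k\<close> the predicate \<open>exact\<close> is vacuous. For
    \<open>c \<le> k\<close> the third premise is what \<open>exactI\<close> needs: a degree above
    1, or one valuation larger than \<open>c\<close>.\<close>
  have bound: "c * N m \<le> num_irred Fp m \<and> (m = 1 \<longrightarrow> c * N m + 1 \<le> p)"
    if "c \<noteq> 0" "m > 0" "c \<le> k \<Longrightarrow> m > 1 \<or> \<sigma> \<noteq> \<rho>" for m
  proof -
    have c0: "c > 0" using that(1) by simp
    have d: "int p ^ c dvd b" "int p ^ c dvd a ^ (p - 1) - 1" using cs by (simp_all only: dvd)
    obtain V and red :: "complex \<Rightarrow> 'f residue" and \<eta> G t h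
      where tg: "trinomial_generator TYPE('f) V red p n u k c a b \<eta> G t h"
      by (rule trinomial_generator_exists[OF irr[unfolded F] root[unfolded F] mono[unfolded K]
            p Fp n k u(2) dvds(3) c0 ck d])
    interpret trinomial_generator V red Fp p n u k c a b \<eta> G t h by (rule tg)
    have *: "enat (Suc c) \<le> \<sigma> \<or> enat (Suc c) \<le> \<rho>" if "\<sigma> \<noteq> \<rho>"
      using that cs by (metis Suc_ile_eq order_le_less)
    have ex: "exact \<phi>" if "\<phi> \<in> factors m" for \<phi>
    proof (rule exactI)
      show "\<not> (int p ^ Suc c dvd b \<and> int p ^ Suc c dvd a ^ (p - 1) - 1)" if "c \<le> k"
        unfolding dvd by (rule small[OF that])
      show "1 < degree \<phi> \<or> int p ^ Suc c dvd b \<or> int p ^ Suc c dvd a ^ (p - 1) - 1" if "c \<le> k"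
        using \<open>c \<le> k \<Longrightarrow> m > 1 \<or> \<sigma> \<noteq> \<rho>\<close>[OF that] * \<open>\<phi> \<in> factors m\<close> unfolding dvd by (auto simp: factors_def)
      show "irreducible \<phi>" using \<open>\<phi> \<in> factors m\<close> by (simp add: factors_def)
    qed
    show ?thesis using factors_bound[OF ex] num_irred_1_le[of Fp] Fp by (auto simp: factors_card N_def)
  qed
  \<comment> \<open>Conditions (2) to (4) all say \<open>p < \<kappa> * N 1 + 1\<close>. In (2) and
    (3) the valuations differ; in (4) \<open>c = Suc k\<close>, so the clause about
    \<open>c \<le> k\<close> holds vacuously.\<close>
  consider (1) m where "m > 1" "N m > 0"
      "ereal_of_enat \<kappa> > ereal (real (num_irred Fp m) / real (N m))"
    | (2) "enat p < enat c * enat (N 1) + 1" "c \<le> k \<Longrightarrow> \<sigma> \<noteq> \<rho>"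
  proof -
    from cond show ?thesis
    proof (elim disjE conjE exE)
      fix m assume "m > 1" "num_irred_factors Fp m u a > 0"
        "ereal_of_enat \<kappa> > ereal (real (num_irred Fp m) / real (num_irred_factors Fp m u a))"
      then show ?thesis using 1 by (simp add: N_def)
    next
      assume *: "enat p < \<sigma> * enat (num_irred_factors Fp 1 u a) + 1" "\<sigma> < min \<rho> (enat (k + 1))"
      then have "\<sigma> < \<rho>" "\<sigma> < enat (k + 1)" by simp_all
      then have "enat c = \<sigma>" unfolding c[symmetric] \<kappa> \<tau> by (simp add: min_absorb1)
      then show ?thesis using * \<open>\<sigma> < \<rho>\<close> by (intro 2) (auto simp: N_def)
    next
      assume *: "enat p < \<rho> * enat (num_irred_factors Fp 1 u a) + 1" "\<rho> < min \<sigma> (enat (k + 1))"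
      then have "\<rho> < \<sigma>" "\<rho> < enat (k + 1)" by simp_all
      then have "enat c = \<rho>" unfolding c[symmetric] \<kappa> \<tau> by (simp add: min_absorb1 min_absorb2)
      then show ?thesis using * \<open>\<rho> < \<sigma>\<close> by (intro 2) (auto simp: N_def)
    next
      assume *: "enat p < enat (k + 1) * enat (num_irred_factors Fp 1 u a) + 1" "enat (k + 1) < \<tau>"
      then have "enat c = enat (k + 1)" unfolding c[symmetric] \<kappa> by (simp add: min_absorb2)
      then show ?thesis using * by (intro 2) (auto simp: N_def)
    qed
  qed
  then show False
  proof cases
    case 1
    have "real (num_irred Fp m) / real (N m) < real c"
      using 1(3) by (simp add: c)
    then have "real (num_irred Fp m) < real c * real (N m)" using 1(2) by (simp add: field_simps)
    then have lt: "num_irred Fp m < c * N m" by (metis of_nat_less_iff of_nat_mult)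
    then have "c \<noteq> 0" by (metis mult_0 not_less_zero)
    then show False using bound[of m] 1(1) lt by simp
  next
    case 2
    have lt: "p < c * N 1 + 1" using 2(1) by (simp add: one_enat_def)
    then have "c \<noteq> 0" using p2 by (metis add_0 less_one mult_0 not_numeral_le_zero)
    then show False using bound[of 1] 2(2) lt by simp
  qed
qed

end
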